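(* Let $d \ge 3$ and $n \ge 1$ be integers, let $\mathbb{k}$ be an algebraically closed field with $\operatorname{char}\mathbb{k} = 0$ or $\operatorname{char}\mathbb{k} > d$, and let $f \in \mathbb{k}[x_1,\dots,x_n]$ be a nondegenerate form of degree $d$. Suppose that $Z(f)$ is semisimple (or equivalently, that $f$ is not an LDS form). Then the number of indecomposable direct summands of $f$ is exactly $\dim_{\mathbb{k}} Z(f)$.
   Context: A form of degree $d$ in $n$ variables is a homogeneous polynomial of degree $d$ in $\mathbb{k}[x_1,\dots,x_n]$ (a linear combination of monomials of degree $d$). It is nondegenerate if no variable can be removed by an invertible linear change of variables; equivalently, its first partial derivatives are linearly independent over $\mathbb{k}$. A form $f$ is called a direct sum if, after an invertible linear change of variables, it can be written as a sum of $t\ge 2$ forms in disjoint (nonempty) sets of variables, $f = f_1(x_1,\dots,x_{a_1}) + \cdots + f_t(x_{a_{t-1}+1},\dots,x_n)$; otherwise $f$ is called indecomposable. Every nondegenerate form can be written, after an invertible linear change of variables, as a sum of indecomposable forms in disjoint sets of variables (each indecomposable as a form in its own set of variables; a single summand is allowed), and it is known (Harrison) that this decomposition is unique up to equivalence and permutation of the summands. The number of indecomposable direct summands of $f$ is the number of summands in this decomposition. For $f$ with Hessian matrix $H = \left(\frac{\partial^2 f}{\partial x_i \partial x_j}\right)_{1\le i,j\le n}$, the center of $f$ is $$Z(f) := \{X \in \mathbb{k}^{n\times n} \mid (HX)^T = HX\}.$$ It is known that for $f$ nondegenerate, $Z(f)$ is a commutative subalgebra of $\mathbb{k}^{n\times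 n}$; semisimplicity refers to this finite-dimensional $\mathbb{k}$-algebra. A form $f$ of degree $d$ is called a limit of direct sums (LDS) form if, after an invertible linear change of variables, $$f(x_1,\dots,x_n) = \sum_{i=1}^{l} x_i \frac{\partial h(x_{l+1},\dots,x_{2l})}{\partial x_{l+i}} + g(x_{l+1},\dots,x_n)$$ for some integer $l$ with $l \ge 1$ and $2l \le n$, where $h$ and $g$ are forms of degree $d$ in $l$ and $n-l$ variables respectively. *)

theory Defs
  imports
    "HOL-Library.Poly_Mapping"
    "HOL-Computational_Algebra.Polynomial"
    "HOL-Algebra.AbelCoset"
    "Jordan_Normal_Form.VS_Connect"
begin

section \<open>Polynomials in several variables\<close>

text \<open>
  A polynomial is a finitely supported map from monomials to coefficients; a monomial is a finitely
  supported map from variables to exponents. Variables are numbered from \<open>0\<close>, so the informal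
  \<open>x\<^sub>1, \<dots>, x\<^sub>n\<close> are \<open>X 0, \<dots>, X (n - 1)\<close>. Sum, product, 0 and 1 are those of
  \<^theory>\<open>HOL-Library.Poly_Mapping\<close>.
\<close>

type_synonym 'k mpoly = "(nat \<Rightarrow>\<^sub>0 nat) \<Rightarrow>\<^sub>0 'k"

definition X :: "nat \<Rightarrow> 'k::field mpoly" where
  "X i = Poly_Mapping.single (Poly_Mapping.single i 1) 1"

definition C :: "'k \<Rightarrow> 'k::field mpoly" where
  "C c = Poly_Mapping.single 0 c"

definition subst :: "(nat \<Rightarrow> 'k mpoly) \<Rightarrow> 'k mpoly \<Rightarrow> 'k::field mpoly" where
  "subst s p = (\<Sum>m\<in>Poly_Mapping.keys p. C (Poly_Mapping.lookup p m) *
      (\<Prod>i\<in>Poly_Mapping.keys m. s i ^ Poly_Mapping.lookup m i))"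

text \<open>\<open>lin_subst P f\<close> is \<open>f (P x)\<close>, where \<open>x\<close> is the column of variables.\<close>

definition lin_subst :: "'k mat \<Rightarrow> 'k mpoly \<Rightarrow> 'k::field mpoly" where
  "lin_subst P = subst (\<lambda>i. \<Sum>j<dim_col P. C (P $$ (i, j)) * X j)"

text \<open>\<open>shift a f\<close> is \<open>f(x\<^bsub>a+1\<^esub>, x\<^bsub>a+2\<^esub>, \<dots>)\<close>.\<close>

definition shift :: "nat \<Rightarrow> 'k mpoly \<Rightarrow> 'k::field mpoly" where
  "shift a = subst (\<lambda>i. X (a + i))"

text \<open>If the exponent of the variable is 0, the truncated subtraction is harmless because the
  coefficient of that term is 0.\<close>

definition partial_deriv :: "nat \<Rightarrow> 'k mpoly \<Rightarrow> 'k::field mpoly" where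
  "partial_deriv i p = (\<Sum>m\<in>Poly_Mapping.keys p.
      Poly_Mapping.single (m - Poly_Mapping.single i 1)
        (of_nat (Poly_Mapping.lookup m i) * Poly_Mapping.lookup p m))"


section \<open>Forms\<close>

text \<open>The zero polynomial is a form of every degree.\<close>

definition form :: "nat \<Rightarrow> nat \<Rightarrow> 'k::field mpoly \<Rightarrow> bool" where
  "form d n f \<longleftrightarrow> (\<forall>m\<in>Poly_Mapping.keys f.
      Poly_Mapping.keys m \<subseteq> {..<n} \<and>
      (\<Sum>i\<in>Poly_Mapping.keys m. Poly_Mapping.lookup m i) = d)"

definition linear_change :: "nat \<Rightarrow> 'k::field mat \<Rightarrow> bool" where
  "linear_change n P \<longleftrightarrow> P \<in> carrier_mat n n \<and> invertible_mat P"

text \<open>No invertible linear change of variables makes one of the variables disappear.\<close>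

definition nondegenerate :: "nat \<Rightarrow> 'k::field mpoly \<Rightarrow> bool" where
  "nondegenerate n f \<longleftrightarrow> \<not> (\<exists>P. linear_change n P \<and>
      (\<exists>i<n. \<forall>m\<in>Poly_Mapping.keys (lin_subst P f). i \<notin> Poly_Mapping.keys m))"

text \<open>
  A list \<open>[(a\<^sub>1, f\<^sub>1), \<dots>, (a\<^sub>t, f\<^sub>t)]\<close> stands for forms \<open>f\<^sub>i\<close> in \<open>a\<^sub>i\<close> variables, each
  written in its own variables \<open>x\<^sub>1, \<dots>\<close>; \<open>block_sum\<close> adds them up in consecutive disjoint
  blocks of variables.
\<close>

fun block_sum :: "(nat \<times> 'k mpoly) list \<Rightarrow> 'k::field mpoly" where
  "block_sum [] = 0"
| "block_sum ((a, g) # fs) = g + shift a (block_sum fs)"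

definition decomposition :: "nat \<Rightarrow> nat \<Rightarrow> 'k::field mpoly \<Rightarrow> (nat \<times> 'k mpoly) list \<Rightarrow> bool" where
  "decomposition d n f fs \<longleftrightarrow>
      (\<forall>(a, g)\<in>set fs. a \<ge> 1 \<and> form d a g) \<and>
      (\<Sum>(a, g)\<leftarrow>fs. a) = n \<and>
      (\<exists>P. linear_change n P \<and> lin_subst P f = block_sum fs)"

definition direct_sum_form :: "nat \<Rightarrow> nat \<Rightarrow> 'k::field mpoly \<Rightarrow> bool" where
  "direct_sum_form d n f \<longleftrightarrow> (\<exists>fs. length fs \<ge> 2 \<and> decomposition d n f fs)"

definition indecomposable_decomposition ::
    "nat \<Rightarrow> nat \<Rightarrow> 'k::field mpoly \<Rightarrow> (nat \<times> 'k mpoly) list \<Rightarrow> bool" where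
  "indecomposable_decomposition d n f fs \<longleftrightarrow>
      decomposition d n f fs \<and> (\<forall>(a, g)\<in>set fs. \<not> direct_sum_form d a g)"

text \<open>Limits of direct sums.\<close>

definition LDS_form :: "nat \<Rightarrow> nat \<Rightarrow> 'k::field mpoly \<Rightarrow> bool" where
  "LDS_form d n f \<longleftrightarrow> (\<exists>l h g P. 1 \<le> l \<and> 2 * l \<le> n \<and>
      form d l h \<and> form d (n - l) g \<and> linear_change n P \<and>
      lin_subst P f = (\<Sum>i<l. X i * partial_deriv (l + i) (shift l h)) + shift l g)"


section \<open>The center\<close>

definition hessian :: "nat \<Rightarrow> 'k::field mpoly \<Rightarrow> 'k mpoly mat" where
  "hessian n f = mat n n (\<lambda>(i, j). partial_deriv i (partial_deriv j f))"

text \<open>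
  The center carries the matrix product, the matrix sum and the scalar multiplication, so the same
  record is used as a ring (for semisimplicity) and as a vector space (for the dimension).
\<close>

definition center :: "nat \<Rightarrow> 'k::field mpoly \<Rightarrow> ('k, 'k mat) module" where
  "center n f = (module_mat TYPE('k) n n)
    \<lparr>carrier := {A \<in> carrier_mat n n.
       transpose_mat (hessian n f * map_mat C A) = hessian n f * map_mat C A}\<rparr>"

text \<open>
  A ring is semisimple if it is semisimple as a left module over itself, that is, if every
  submodule (left ideal) is a direct summand. For a finite-dimensional algebra the left ideals are
  automatically linear subspaces.
\<close>

definition left_ideal :: "('a, 'm) ring_scheme \<Rightarrow> 'a set \<Rightarrow> bool" where
  "left_ideal R I \<longleftrightarrow> additive_subgroup I R \<and>
      (\<forall>a\<in>carrier R. \<forall>x\<in>I. a \<otimes>\<^bsub>R\<^esub> x \<in> I)"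

definition semisimple_ring :: "('a, 'm) ring_scheme \<Rightarrow> bool" where
  "semisimple_ring R \<longleftrightarrow> (\<forall>I. left_ideal R I \<longrightarrow>
      (\<exists>J. left_ideal R J \<and> I <+>\<^bsub>R\<^esub> J = carrier R \<and> I \<inter> J = {\<zero>\<^bsub>R\<^esub>}))"

end

theory Submission
  imports Defs "HOL-Library.Function_Algebras" "Jordan_Normal_Form.Char_Poly"
begin

text \<open>
  Write \<open>D\<^sub>u f\<close> for the derivative of \<open>f\<close> in direction \<open>u\<close>. A matrix \<open>A\<close> lies in the center iff
  \<open>D\<^bsub>Au\<^esub> D\<^sub>v f = D\<^sub>u D\<^bsub>Av\<^esub> f\<close> for all \<open>u\<close>, \<open>v\<close>, so linear changes of variables conjugate the center,
  and the center of a nondegenerate sum of two forms in disjoint variables consists of the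
  block diagonal matrices whose blocks lie in the two centers.

  If the center has no nonzero nilpotents, then the center of an indecomposable form consists of
  scalars: for an eigenvalue \<open>c\<close> of \<open>A\<close>, the image and the kernel of a high power of
  \<open>A - c\<close> would otherwise split the form. An indecomposable decomposition into \<open>t\<close> blocks thus
  makes the center a product of \<open>t\<close> copies of the field, which is semisimple of dimension \<open>t\<close>.

  A semisimple commutative ring has no nonzero nilpotents. If \<open>N \<noteq> 0\<close> is in the center and
  \<open>N\<^sup>2 = 0\<close>, then in coordinates \<open>N w\<^sub>1, \<dots>, N w\<^sub>l, w\<^sub>1, \<dots>, w\<^sub>l, \<dots>\<close> adapted to \<open>N\<close>
  the form becomes an LDS form; conversely the matrix with \<open>e\<^bsub>l+i\<^esub> \<mapsto> e\<^sub>i\<close> is a square-zero element of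
  the center of an LDS form.
\<close>

text \<open>The hypotheses enter at separate points. The bound on the characteristic makes
  \<open>d\<close> and every positive exponent in a form of degree \<open>d\<close> invertible; so a
  vanishing derivative means an absent variable, and the potential \<open>h\<close> of an LDS form
  can be divided by \<open>d\<close>. The bound \<open>d \<ge> 3\<close> gives third derivatives, in
  which two elements of the center can be moved past each other, and second derivatives of positive
  degree, so that no constant can be exchanged between two blocks. Algebraic closedness supplies an
  eigenvalue: over the reals, the indecomposable form Re(z^3) has the complex numbers as its center.
  Semisimplicity is awkward to hand down to the blocks. The pivot is \<open>reduced_center\<close>,
  a statement about single matrices: it passes to blocks by padding with zeros and to new
  coordinates by conjugation. The way back to semisimplicity, and the dimension, both come from the
  matrices that are the identity on one block and 0 on the others, conjugated back to the original
  coordinates.\<close>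

section \<open>Constants, coefficients and induction over monomials\<close>

lemma lookup_C: "Poly_Mapping.lookup (C c) m = (if m = 0 then c else 0)"
  by (simp add: C_def lookup_single when_def)

lemma C_0 [simp]: "C 0 = 0" and C_1 [simp]: "C 1 = 1"
  by (simp_all add: C_def)

lemma C_add: "C (a + b) = C a + C b"
  by (simp add: C_def single_add)

lemma C_mult: "C (a * b) = C a * C b"
  by (simp add: C_def mult_single)

lemma C_uminus: "C (- a) = - C a"
  by (simp add: C_def single_uminus)

lemma C_sum: "C (sum f A) = (\<Sum>a\<in>A. C (f a))"
  by (induction A rule: infinite_finite_induct) (simp_all add: C_add)

lemma C_mult_single: "C c * Poly_Mapping.single m a = Poly_Mapping.single m (c * a)"
  by (simp add: C_def mult_single)

lemma mpoly_sum_single: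
  fixes p :: "'k::field mpoly"
  assumes "finite A" "Poly_Mapping.keys p \<subseteq> A"
  shows "p = (\<Sum>m\<in>A. Poly_Mapping.single m (Poly_Mapping.lookup p m))"
proof (rule poly_mapping_eqI)
  fix k
  have "Poly_Mapping.lookup p k = (\<Sum>m\<in>A. if m = k then Poly_Mapping.lookup p m else 0)"
    using assms by (auto simp: in_keys_iff)
  then show "Poly_Mapping.lookup p k =
      Poly_Mapping.lookup (\<Sum>m\<in>A. Poly_Mapping.single m (Poly_Mapping.lookup p m)) k"
    by (simp add: lookup_sum lookup_single when_def)
qed

text \<open>Restricting the case \<open>single\<close> to monomials of \<open>p\<close> keeps bounds
  on the degree and the variables of \<open>p\<close> available inside the induction, as Euler's
  formula requires.\<close>

lemma mpoly_single_induct [case_names zero single add]: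
  fixes p :: "'k::field mpoly"
  assumes "P 0" "\<And>m c. m \<in> Poly_Mapping.keys p \<Longrightarrow> P (Poly_Mapping.single m c)"
    "\<And>p q. P p \<Longrightarrow> P q \<Longrightarrow> P (p + q)"
  shows "P p"
proof -
  have "P (\<Sum>m\<in>A. Poly_Mapping.single m (Poly_Mapping.lookup p m))"
    if "finite A" "A \<subseteq> Poly_Mapping.keys p" for A
    using that by (induction A rule: finite_induct) (auto intro: assms)
  from this[of "Poly_Mapping.keys p"] mpoly_sum_single[of "Poly_Mapping.keys p" p] show ?thesis
    by (metis finite_keys subset_refl)
qed

lemma lookup_C_mult: "Poly_Mapping.lookup (C c * p) m = c * Poly_Mapping.lookup p m"
  unfolding C_def mult_map_scale_conv_mult[symmetric] by (simp add: map.rep_eq when_def)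


section \<open>Substitution\<close>

definition monom_subst :: "(nat \<Rightarrow> 'k mpoly) \<Rightarrow> (nat \<Rightarrow>\<^sub>0 nat) \<Rightarrow> 'k::field mpoly" where
  "monom_subst s m = (\<Prod>i\<in>Poly_Mapping.keys m. s i ^ Poly_Mapping.lookup m i)"

lemma monom_subst_superset:
  assumes "finite A" "Poly_Mapping.keys m \<subseteq> A"
  shows "monom_subst s m = (\<Prod>i\<in>A. s i ^ Poly_Mapping.lookup m i)"
  unfolding monom_subst_def using assms
  by (intro prod.mono_neutral_left) (auto simp: in_keys_iff)

lemma monom_subst_add: "monom_subst s (m + m') = monom_subst s m * monom_subst s m'"
proof -
  let ?A = "Poly_Mapping.keys m \<union> Poly_Mapping.keys m'"
  have "Poly_Mapping.keys (m + m') \<subseteq> ?A" by (rule keys_add)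
  then show ?thesis
    by (simp add: monom_subst_superset[of ?A] lookup_add power_add prod.distrib)
qed

lemma subst_superset:
  assumes "finite A" "Poly_Mapping.keys p \<subseteq> A"
  shows "subst s p = (\<Sum>m\<in>A. C (Poly_Mapping.lookup p m) * monom_subst s m)"
  unfolding subst_def monom_subst_def using assms
  by (intro sum.mono_neutral_left) (auto simp: in_keys_iff)

lemma subst_0 [simp]: "subst s 0 = 0"
  by (simp add: subst_def)

lemma subst_single: "subst s (Poly_Mapping.single m c) = C c * monom_subst s m"
  by (cases "c = 0") (simp_all add: subst_def monom_subst_def)

lemma subst_add: "subst s (p + q) = subst s p + subst s q"
proof -
  let ?A = "Poly_Mapping.keys p \<union> Poly_Mapping.keys q"
  have "Poly_Mapping.keys (p + q) \<subseteq> ?A" by (rule keys_add)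
  then show ?thesis
    by (simp add: subst_superset[of ?A] lookup_add C_add sum.distrib distrib_right)
qed

lemma subst_mult: "subst s (p * q) = subst s p * subst s q"
proof (induction p rule: mpoly_single_induct)
  case (single m c)
  show ?case
    by (induction q rule: mpoly_single_induct)
      (auto simp: subst_add subst_single mult_single C_mult monom_subst_add algebra_simps)
qed (auto simp: subst_add distrib_right)

lemma subst_C [simp]: "subst s (C c) = C c"
  unfolding C_def subst_single by (simp add: monom_subst_def C_def)

lemma subst_1 [simp]: "subst s 1 = 1"
  using subst_C[of s 1] by simp

lemma subst_X [simp]: "subst s (X i) = s i"
  unfolding X_def subst_single by (simp add: monom_subst_def)

lemma subst_sum: "subst s (sum f A) = (\<Sum>a\<in>A. subst s (f a))"
  by (induction A rule: infinite_finite_induct) (simp_all add: subst_add)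

lemma subst_uminus: "subst s (- p) = - subst s p"
  using subst_add[of s p "- p"] by (simp add: eq_neg_iff_add_eq_0 add.commute)

lemma subst_diff: "subst s (p - q) = subst s p - subst s q"
  using subst_add[of s p "- q"] by (simp add: subst_uminus)

lemma X_power: "X i ^ k = Poly_Mapping.single (Poly_Mapping.single i k) (1::'k::field)"
  by (induction k) (simp_all add: X_def mult_single flip: single_add)

lemma monom_subst_X: "monom_subst X m = Poly_Mapping.single m (1::'k::field)"
proof -
  have *: "(\<Prod>i\<in>A. X i ^ e i) = Poly_Mapping.single (\<Sum>i\<in>A. Poly_Mapping.single i (e i)) (1::'k)"
    if "finite A" for A :: "nat set" and e
    using that by (induction A rule: finite_induct) (simp_all add: X_power mult_single)
  have "(\<Sum>i\<in>Poly_Mapping.keys m. Poly_Mapping.single i (Poly_Mapping.lookup m i)) = m"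
    by (rule poly_mapping_eqI) (auto simp: lookup_sum lookup_single when_def in_keys_iff)
  then show ?thesis by (simp add: monom_subst_def *)
qed

lemma subst_X_id [simp]: "subst X p = p"
  by (induction p rule: mpoly_single_induct)
    (simp_all add: subst_add subst_single monom_subst_X C_mult_single)


section \<open>Variables and homogeneity\<close>

definition vars_in :: "nat set \<Rightarrow> 'k::field mpoly \<Rightarrow> bool" where
  "vars_in A p \<longleftrightarrow> (\<forall>m\<in>Poly_Mapping.keys p. Poly_Mapping.keys m \<subseteq> A)"

definition tdeg :: "(nat \<Rightarrow>\<^sub>0 nat) \<Rightarrow> nat" where
  "tdeg m = (\<Sum>i\<in>Poly_Mapping.keys m. Poly_Mapping.lookup m i)"

text \<open>Generalizes \<open>form\<close> to an arbitrary set of variables, so that shifted forms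
  and remainders living on an interval such as \<open>{a..<n}\<close> are covered.\<close>

definition hom_in :: "nat set \<Rightarrow> nat \<Rightarrow> 'k::field mpoly \<Rightarrow> bool" where
  "hom_in A d p \<longleftrightarrow> (\<forall>m\<in>Poly_Mapping.keys p. Poly_Mapping.keys m \<subseteq> A \<and> tdeg m = d)"

lemma form_hom_in: "form d n f \<longleftrightarrow> hom_in {..<n} d f"
  by (auto simp: form_def hom_in_def tdeg_def)

lemma hom_in_vars_in: "hom_in A d p \<Longrightarrow> vars_in A p"
  by (auto simp: hom_in_def vars_in_def)

lemma vars_in_UNIV: "vars_in UNIV p"
  by (simp add: vars_in_def)

lemma tdeg_superset:
  assumes "finite A" "Poly_Mapping.keys m \<subseteq> A"
  shows "tdeg m = (\<Sum>i\<in>A. Poly_Mapping.lookup m i)"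
  unfolding tdeg_def using assms
  by (intro sum.mono_neutral_left) (auto simp: in_keys_iff)

lemma tdeg_add: "tdeg (m + m') = tdeg m + tdeg m'"
proof -
  let ?A = "Poly_Mapping.keys m \<union> Poly_Mapping.keys m'"
  have "Poly_Mapping.keys (m + m') \<subseteq> ?A" by (rule keys_add)
  then show ?thesis
    by (simp add: tdeg_superset[of ?A] lookup_add sum.distrib)
qed

lemma tdeg_single [simp]: "tdeg (Poly_Mapping.single i k) = k"
  by (simp add: tdeg_def)

lemma tdeg_0 [simp]: "tdeg 0 = 0"
  by (simp add: tdeg_def)

lemma lookup_le_tdeg: "Poly_Mapping.lookup m i \<le> tdeg m"
proof (cases "i \<in> Poly_Mapping.keys m")
  case True
  then show ?thesis unfolding tdeg_def by (intro member_le_sum) auto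
qed (simp add: in_keys_iff)

lemma hom_in_0 [simp]: "hom_in A d 0"
  by (simp add: hom_in_def)

lemma hom_in_add: "hom_in A d p \<Longrightarrow> hom_in A d q \<Longrightarrow> hom_in A d (p + q)"
  unfolding hom_in_def using keys_add[of p q] by blast

lemma hom_in_mult:
  assumes "hom_in A d p" "hom_in A e q"
  shows "hom_in A (d + e) (p * q)"
  unfolding hom_in_def
proof
  fix m assume "m \<in> Poly_Mapping.keys (p * q)"
  then obtain a b where m: "m = a + b" "a \<in> Poly_Mapping.keys p" "b \<in> Poly_Mapping.keys q"
    using keys_mult[of p q] by blast
  have "Poly_Mapping.keys a \<subseteq> A \<and> Poly_Mapping.keys b \<subseteq> A" "tdeg a = d" "tdeg b = e"
    using assms m by (auto simp: hom_in_def)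
  then show "Poly_Mapping.keys m \<subseteq> A \<and> tdeg m = d + e"
    using m keys_add[of a b] by (auto simp: tdeg_add)
qed

lemma hom_in_sum: "(\<And>i. i \<in> I \<Longrightarrow> hom_in A d (f i)) \<Longrightarrow> hom_in A d (sum f I)"
  by (induction I rule: infinite_finite_induct) (simp_all add: hom_in_add)

lemma hom_in_C [simp]: "hom_in A 0 (C c)"
  by (auto simp: hom_in_def C_def)

lemma hom_in_C_mult: "hom_in A d p \<Longrightarrow> hom_in A d (C c * p)"
  using hom_in_mult[OF hom_in_C] by fastforce

lemma hom_in_X: "i \<in> A \<Longrightarrow> hom_in A 1 (X i)"
  by (auto simp: hom_in_def X_def)

lemma hom_in_uminus: "hom_in A d p \<Longrightarrow> hom_in A d (- p)"
  by (simp add: hom_in_def)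

lemma hom_in_diff: "hom_in A d p \<Longrightarrow> hom_in A d q \<Longrightarrow> hom_in A d (p - q)"
  using hom_in_add[of A d p "- q"] hom_in_uminus[of A d q] by simp

lemma hom_in_mono: "hom_in A d p \<Longrightarrow> A \<subseteq> B \<Longrightarrow> hom_in B d p"
  by (auto simp: hom_in_def)

lemma hom_in_Int: "hom_in A d p \<Longrightarrow> vars_in B p \<Longrightarrow> hom_in (A \<inter> B) d p"
  by (auto simp: hom_in_def vars_in_def)

text \<open>The only monomial without variables has degree 0.\<close>

lemma hom_in_empty:
  assumes "hom_in {} d p" "d \<ge> 1" shows "p = 0"
proof (rule poly_mapping_eqI)
  fix m
  have "m \<notin> Poly_Mapping.keys p"
    using assms by (auto simp: hom_in_def)
  then show "Poly_Mapping.lookup p m = Poly_Mapping.lookup 0 m"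
    by (simp add: in_keys_iff)
qed

lemma hom_in_subst:
  assumes p: "hom_in A d p" and s: "\<And>i. i \<in> A \<Longrightarrow> hom_in B 1 (s i)"
  shows "hom_in B d (subst s p)"
proof -
  have power: "hom_in B e (s i ^ e)" if "i \<in> A" for i e
    using that
  proof (induction e)
    case 0
    then show ?case using hom_in_C[of B 1] by simp
  next
    case (Suc e)
    then show ?case using hom_in_mult[OF s Suc.IH] by simp
  qed
  have prod: "hom_in B (\<Sum>i\<in>I. e i) (\<Prod>i\<in>I. s i ^ e i)" if "finite I" "I \<subseteq> A" for I e
    using that
  proof (induction I rule: finite_induct)
    case empty
    then show ?case using hom_in_C[of B 1] by simp
  next
    case (insert i I)
    then show ?case using hom_in_mult[OF power] by simp
  qed
  show ?thesis
    unfolding subst_def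
  proof (intro hom_in_sum hom_in_C_mult)
    fix m assume "m \<in> Poly_Mapping.keys p"
    then have "Poly_Mapping.keys m \<subseteq> A" "tdeg m = d" using p by (auto simp: hom_in_def)
    then show "hom_in B d (\<Prod>i\<in>Poly_Mapping.keys m. s i ^ Poly_Mapping.lookup m i)"
      using prod[of "Poly_Mapping.keys m" "Poly_Mapping.lookup m"] by (simp add: tdeg_def)
  qed
qed

text \<open>The polynomials in the variables \<open>A\<close> form the ring generated by the
  constants and these variables; homomorphisms and derivations can thus be compared on
  generators.\<close>

lemma mpoly_induct_vars [consumes 1, case_names C X add mult]:
  assumes p: "vars_in A p"
    and "\<And>c. P (C c)" "\<And>i. i \<in> A \<Longrightarrow> P (X i)"
    and "\<And>p q. P p \<Longrightarrow> P q \<Longrightarrow> P (p + q)" "\<And>p q. P p \<Longrightarrow> P q \<Longrightarrow> P (p * q)"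
  shows "P p"
proof -
  have power: "P (X i ^ e)" if "i \<in> A" for i e
    using that assms(2)[of 1] by (induction e) (auto intro: assms)
  have prod: "P (\<Prod>i\<in>I. X i ^ e i)" if "finite I" "I \<subseteq> A" for I e
    using that assms(2)[of 1] by (induction I rule: finite_induct) (auto intro: assms power)
  have "P (\<Sum>m\<in>M. C (Poly_Mapping.lookup p m) * (\<Prod>i\<in>Poly_Mapping.keys m. X i ^ Poly_Mapping.lookup m i))"
    if "finite M" "M \<subseteq> Poly_Mapping.keys p" for M
    using that
  proof (induction M rule: finite_induct)
    case empty
    then show ?case using assms(2)[of 0] by simp
  next
    case (insert m M)
    have "Poly_Mapping.keys m \<subseteq> A" using insert p by (auto simp: vars_in_def)
    then show ?case using insert by (auto intro!: assms(2,4,5) prod)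
  qed
  from this[of "Poly_Mapping.keys p"] show ?thesis
    by (simp flip: subst_def)
qed

lemma subst_cong:
  assumes "vars_in A p" "\<And>i. i \<in> A \<Longrightarrow> s i = t i"
  shows "subst s p = subst t p"
  using assms(1) by (induction p rule: mpoly_induct_vars) (simp_all add: assms(2) subst_add subst_mult)

lemma subst_subst: "subst s (subst t p) = subst (\<lambda>i. subst s (t i)) p"
  using vars_in_UNIV[of p] by (induction p rule: mpoly_induct_vars) (simp_all add: subst_add subst_mult)


section \<open>Partial derivatives\<close>

lemma lookup_partial_deriv: "Poly_Mapping.lookup (partial_deriv i p) m =
    of_nat (Poly_Mapping.lookup m i + 1) * Poly_Mapping.lookup p (m + Poly_Mapping.single i 1)"
proof -
  let ?e = "Poly_Mapping.single i (1::nat)"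
  \<comment> \<open>Truncated subtraction lets a monomial \<open>k\<close> free of the variable
    \<open>i\<close> collide with \<open>m\<close>; the exponent as a factor then annihilates its
    term, which leaves \<open>m + ?e\<close> as the only contribution.\<close>
  have eq: "(of_nat (Poly_Mapping.lookup k i) * Poly_Mapping.lookup p k when k - ?e = m) =
      (if k = m + ?e then of_nat (Poly_Mapping.lookup m i + 1) * Poly_Mapping.lookup p k else 0)" for k
  proof (cases "Poly_Mapping.lookup k i = 0")
    case True
    then have "k \<noteq> m + ?e" by (auto simp: lookup_add)
    with True show ?thesis by simp
  next
    case False
    have "k - ?e = m \<longleftrightarrow> k = m + ?e"
    proof
      assume *: "k - ?e = m"
      show "k = m + ?e"
        unfolding *[symmetric] using False
        by (intro poly_mapping_eqI) (auto simp: lookup_add lookup_minus lookup_single when_def)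
    next
      assume "k = m + ?e"
      then show "k - ?e = m" by simp
    qed
    then show ?thesis by (auto simp: lookup_add)
  qed
  show ?thesis
    unfolding partial_deriv_def lookup_sum lookup_single eq
    by (auto simp: in_keys_iff)
qed

lemma partial_deriv_0 [simp]: "partial_deriv i 0 = 0"
  by (simp add: partial_deriv_def)

lemma partial_deriv_add: "partial_deriv i (p + q) = partial_deriv i p + partial_deriv i q"
  by (rule poly_mapping_eqI) (simp add: lookup_partial_deriv lookup_add algebra_simps)

lemma partial_deriv_uminus: "partial_deriv i (- p) = - partial_deriv i p"
  by (rule poly_mapping_eqI) (simp add: lookup_partial_deriv)

lemma partial_deriv_diff: "partial_deriv i (p - q) = partial_deriv i p - partial_deriv i q"
  using partial_deriv_add[of i p "- q"] by (simp add: partial_deriv_uminus)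

lemma partial_deriv_sum: "partial_deriv i (sum f A) = (\<Sum>a\<in>A. partial_deriv i (f a))"
  by (induction A rule: infinite_finite_induct) (simp_all add: partial_deriv_add)

lemma partial_deriv_C_mult: "partial_deriv i (C c * p) = C c * partial_deriv i p"
  by (rule poly_mapping_eqI) (simp add: lookup_partial_deriv lookup_C_mult)

lemma partial_deriv_commute: "partial_deriv i (partial_deriv j p) = partial_deriv j (partial_deriv i p)"
  by (cases "i = j", simp, rule poly_mapping_eqI)
    (simp add: lookup_partial_deriv lookup_add lookup_single ac_simps)

lemma partial_deriv_C [simp]: "partial_deriv i (C c) = 0"
  by (rule poly_mapping_eqI) (auto simp: lookup_partial_deriv lookup_C poly_mapping_eq_iff fun_eq_iff lookup_add lookup_single when_def)

lemma partial_deriv_single: "partial_deriv i (Poly_Mapping.single m c) =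
    Poly_Mapping.single (m - Poly_Mapping.single i 1) (of_nat (Poly_Mapping.lookup m i) * c)"
  by (cases "c = 0") (simp_all add: partial_deriv_def)

lemma partial_deriv_X: "partial_deriv i (X j) = (if i = j then 1 else 0)"
  by (auto simp: X_def partial_deriv_single lookup_single)

lemma partial_deriv_mult:
  "partial_deriv i (p * q) = partial_deriv i p * q + p * partial_deriv i q"
proof (induction p rule: mpoly_single_induct)
  case (single m c)
  show ?case
  proof (induction q rule: mpoly_single_induct)
    case (single m' c')
    let ?e = "Poly_Mapping.single i (1::nat)"
    let ?a = "Poly_Mapping.lookup m i" and ?b = "Poly_Mapping.lookup m' i"
    \<comment> \<open>Truncated subtraction passes through the sum only at a positive exponent;
      otherwise the corresponding factor is 0.\<close>
    have 1: "m - ?e + m' = m + m' - ?e" if "?a \<noteq> 0"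
      using that by (auto simp: poly_mapping_eq_iff fun_eq_iff lookup_add lookup_minus lookup_single when_def)
    have 2: "m + (m' - ?e) = m + m' - ?e" if "?b \<noteq> 0"
      using that by (auto simp: poly_mapping_eq_iff fun_eq_iff lookup_add lookup_minus lookup_single when_def)
    show ?case
      unfolding partial_deriv_single mult_single lookup_add of_nat_add
      by (cases "?a = 0"; cases "?b = 0")
        (simp_all add: 1 2 distrib_left distrib_right mult_ac single_add del: One_nat_def)
  qed (simp_all add: partial_deriv_add algebra_simps)
qed (simp_all add: partial_deriv_add algebra_simps)

lemma chain_rule:
  assumes "vars_in A p" "finite A"
  shows "partial_deriv j (subst s p) = (\<Sum>i\<in>A. subst s (partial_deriv i p) * partial_deriv j (s i))"
  using assms(1)
proof (induction p rule: mpoly_induct_vars)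
  case (C c)
  then show ?case by simp
next
  case (X i)
  have "(\<Sum>k\<in>A. subst s (partial_deriv k (X i)) * partial_deriv j (s k)) =
      (\<Sum>k\<in>A. if k = i then partial_deriv j (s k) else 0)"
    by (rule sum.cong) (auto simp: partial_deriv_X)
  then show ?case using X assms(2) by simp
next
  case (add p q)
  then show ?case by (simp add: partial_deriv_add subst_add distrib_right sum.distrib)
next
  case (mult p q)
  then show ?case
    by (simp add: partial_deriv_mult subst_mult subst_add distrib_right sum.distrib sum_distrib_left sum_distrib_right algebra_simps)
qed

lemma hom_in_partial_deriv:
  assumes "hom_in A d p" shows "hom_in A (d - 1) (partial_deriv i p)"
  unfolding hom_in_def
proof
  fix m assume "m \<in> Poly_Mapping.keys (partial_deriv i p)"
  then have "m + Poly_Mapping.single i 1 \<in> Poly_Mapping.keys p"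
    by (auto simp: in_keys_iff lookup_partial_deriv)
  then have *: "Poly_Mapping.keys (m + Poly_Mapping.single i 1) \<subseteq> A" "tdeg (m + Poly_Mapping.single i 1) = d"
    using assms by (auto simp: hom_in_def)
  moreover have "Poly_Mapping.keys m \<subseteq> Poly_Mapping.keys (m + Poly_Mapping.single i 1)"
    by (auto simp: in_keys_iff lookup_add)
  ultimately show "Poly_Mapping.keys m \<subseteq> A \<and> tdeg m = d - 1"
    by (auto simp: tdeg_add)
qed

lemma partial_deriv_eq_0: "vars_in A p \<Longrightarrow> i \<notin> A \<Longrightarrow> partial_deriv i p = 0"
proof (rule poly_mapping_eqI)
  fix m :: "nat \<Rightarrow>\<^sub>0 nat" assume "vars_in A p" "i \<notin> A"
  have "i \<in> Poly_Mapping.keys (m + Poly_Mapping.single i 1)"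
    unfolding in_keys_iff lookup_add lookup_single_eq by simp
  then have "m + Poly_Mapping.single i 1 \<notin> Poly_Mapping.keys p"
    using \<open>vars_in A p\<close> \<open>i \<notin> A\<close> by (auto simp: vars_in_def)
  then have "Poly_Mapping.lookup p (m + Poly_Mapping.single i 1) = 0"
    by (simp only: in_keys_iff not_not)
  then show "Poly_Mapping.lookup (partial_deriv i p) m = Poly_Mapping.lookup 0 m"
    by (simp only: lookup_partial_deriv mult_zero_right lookup_zero)
qed

text \<open>On a monomial, \<open>X i * partial_deriv i\<close> multiplies by the exponent of
  \<open>i\<close>, and the exponents add up to \<open>d\<close>.\<close>

lemma euler_formula:
  assumes "hom_in A d p" "finite A"
  shows "(\<Sum>i\<in>A. X i * partial_deriv i p) = C (of_nat d) * p"
proof (induction p rule: mpoly_single_induct)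
  case zero
  then show ?case by simp
next
  case (add p q)
  then show ?case by (simp add: partial_deriv_add distrib_left sum.distrib)
next
  case (single m c)
  then have m: "Poly_Mapping.keys m \<subseteq> A" "tdeg m = d"
    using assms by (auto simp: hom_in_def)
  have "X i * partial_deriv i (Poly_Mapping.single m c) =
      Poly_Mapping.single m (of_nat (Poly_Mapping.lookup m i) * c)" for i
  proof (cases "Poly_Mapping.lookup m i = 0")
    case True
    then show ?thesis by (simp add: partial_deriv_single)
  next
    case False
    then have "Poly_Mapping.single i 1 + (m - Poly_Mapping.single i 1) = m"
      by (auto simp: poly_mapping_eq_iff fun_eq_iff lookup_add lookup_minus lookup_single when_def)
    then show ?thesis by (simp add: partial_deriv_single X_def mult_single)
  qed
  moreover have "(\<Sum>i\<in>A. Poly_Mapping.single m (of_nat (Poly_Mapping.lookup m i) * c)) =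
      Poly_Mapping.single m (\<Sum>i\<in>A. of_nat (Poly_Mapping.lookup m i) * c)"
    using assms(2) by (induction A rule: finite_induct) (simp_all add: single_add)
  moreover have "(\<Sum>i\<in>A. of_nat (Poly_Mapping.lookup m i) * c) = of_nat d * c"
    using m assms(2) by (simp add: tdeg_superset[of A] flip: sum_distrib_right of_nat_sum)
  ultimately show ?case by (simp add: C_mult_single)
qed

section \<open>Linear substitutions and directional derivatives\<close>

lemma square_mat_closed:
  "A \<in> carrier_mat n n \<Longrightarrow> B \<in> carrier_mat n n \<Longrightarrow> A * B \<in> carrier_mat n n"
  "A \<in> carrier_mat n n \<Longrightarrow> v \<in> carrier_vec n \<Longrightarrow> A *\<^sub>v v \<in> carrier_vec n"
  by auto

lemma mult_mat_unit_vec: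
  fixes A :: "'a::semiring_1 mat"
  assumes "A \<in> carrier_mat n m" "j < m" shows "A *\<^sub>v unit_vec m j = col A j"
  using assms by (intro eq_vecI) (auto simp: unit_vec_def scalar_prod_def if_distrib cong: if_cong)

lemma smult_mat_mult_vec:
  fixes A :: "'a::comm_ring_1 mat"
  assumes "A \<in> carrier_mat n m" "v \<in> carrier_vec m"
  shows "(c \<cdot>\<^sub>m A) *\<^sub>v v = c \<cdot>\<^sub>v (A *\<^sub>v v)"
  using assms by (intro eq_vecI) (auto simp: scalar_prod_def sum_distrib_left mult.assoc)

lemma zero_mat_mult_vec: "v \<in> carrier_vec m \<Longrightarrow> 0\<^sub>m n m *\<^sub>v v = 0\<^sub>v n"
  by (intro eq_vecI) (auto simp: scalar_prod_def)

lemma mult_mat_zero_vec: "A \<in> carrier_mat n m \<Longrightarrow> A *\<^sub>v 0\<^sub>v m = 0\<^sub>v n"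
  by (intro eq_vecI) (auto simp: scalar_prod_def)

lemma eq_mat_multI:
  fixes A :: "'a::semiring_1 mat"
  assumes "A \<in> carrier_mat n m" "B \<in> carrier_mat n m"
    and "\<And>v. v \<in> carrier_vec m \<Longrightarrow> A *\<^sub>v v = B *\<^sub>v v"
  shows "A = B"
proof (rule eq_matI)
  fix i j assume "i < dim_row B" "j < dim_col B"
  then show "A $$ (i, j) = B $$ (i, j)"
    using assms(3)[of "unit_vec m j"] assms(1,2)
    by (auto simp: mult_mat_unit_vec vec_eq_iff)
qed (use assms in auto)

lemma pow_mat_add:
  assumes A: "A \<in> carrier_mat n n"
  shows "A ^\<^sub>m (i + j) = A ^\<^sub>m i * A ^\<^sub>m j"
  using A by (induction j) (auto simp: assoc_mult_mat[of _ n n _ n _ n])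

text \<open>The characteristic divides no positive number below it. Every appeal to the hypothesis
  on the characteristic ends here.\<close>

lemma of_nat_neq_0_char:
  assumes "CHAR('k::field) = 0 \<or> CHAR('k) > d" "0 < j" "j \<le> d"
  shows "of_nat j \<noteq> (0::'k)"
  using assms by (auto simp: of_nat_eq_0_iff_char_dvd dest: dvd_imp_le)

text \<open>A monomial with exponent \<open>e > 0\<close> at \<open>i\<close> leaves
  \<open>e\<close> times its coefficient in the derivative, at a place reached by no other monomial;
  since \<open>e \<le> d\<close> is invertible, the coefficient must be 0.\<close>

lemma hom_in_remove_var:
  fixes p :: "'k::field mpoly"
  assumes char: "CHAR('k) = 0 \<or> CHAR('k) > d"
    and p: "hom_in A d p" and 0: "partial_deriv i p = 0"
  shows "hom_in (A - {i}) d p"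
  unfolding hom_in_def
proof
  fix m assume m: "m \<in> Poly_Mapping.keys p"
  then have m': "Poly_Mapping.keys m \<subseteq> A" "tdeg m = d" using p by (auto simp: hom_in_def)
  have "i \<notin> Poly_Mapping.keys m"
  proof
    assume i: "i \<in> Poly_Mapping.keys m"
    let ?m = "m - Poly_Mapping.single i 1"
    have eq: "?m + Poly_Mapping.single i 1 = m"
      using i by (intro poly_mapping_eqI) (auto simp: in_keys_iff lookup_add lookup_minus lookup_single when_def)
    have l: "Poly_Mapping.lookup ?m i + 1 = Poly_Mapping.lookup m i"
      using i by (simp add: lookup_minus in_keys_iff)
    have "of_nat (Poly_Mapping.lookup m i) * Poly_Mapping.lookup p m = 0"
      using lookup_partial_deriv[of i p ?m] unfolding eq l 0 by simp
    then have "of_nat (Poly_Mapping.lookup m i) = (0::'k)"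
      using m by (simp add: in_keys_iff)
    then show False
      using of_nat_neq_0_char[OF char, of "Poly_Mapping.lookup m i"] i lookup_le_tdeg[of m i] m'(2)
      by (simp add: in_keys_iff)
  qed
  with m' show "Poly_Mapping.keys m \<subseteq> A - {i} \<and> tdeg m = d" by auto
qed

lemma hom_in_remove_vars:
  fixes p :: "'k::field mpoly"
  assumes char: "CHAR('k) = 0 \<or> CHAR('k) > d" and p: "hom_in A d p"
    and B: "finite B" "\<And>i. i \<in> B \<Longrightarrow> partial_deriv i p = 0"
  shows "hom_in (A - B) d p"
  using B
proof (induction B rule: finite_induct)
  case empty
  then show ?case using p by simp
next
  case (insert i B)
  then show ?case
    using hom_in_remove_var[OF char, of "A - B" p i] by (simp add: Diff_insert[of A i B])
qed

definition lin_form :: "'k mat \<Rightarrow> nat \<Rightarrow> 'k::field mpoly" where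
  "lin_form P i = (\<Sum>j<dim_col P. C (P $$ (i, j)) * X j)"

lemma lin_subst_def': "lin_subst P = subst (lin_form P)"
  by (simp add: lin_subst_def lin_form_def[abs_def])

lemma hom_in_lin_form: "dim_col P = m \<Longrightarrow> hom_in {..<m} 1 (lin_form P i)"
  unfolding lin_form_def by (intro hom_in_sum hom_in_C_mult hom_in_X) auto

lemma form_lin_subst: "form d n f \<Longrightarrow> P \<in> carrier_mat n m \<Longrightarrow> form d m (lin_subst P f)"
  unfolding form_hom_in lin_subst_def' by (intro hom_in_subst hom_in_lin_form) auto

text \<open>Replacing \<open>x\<close> by \<open>Q x\<close> in \<open>f (P x)\<close> gives
  \<open>f (P (Q x))\<close>, so the substitution performed first is the left factor.\<close>

lemma lin_subst_mult:
  assumes f: "form d n f" and P: "P \<in> carrier_mat n m" and Q: "Q \<in> carrier_mat m k"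
  shows "lin_subst Q (lin_subst P f) = lin_subst (P * Q) f"
  unfolding lin_subst_def' subst_subst
proof (rule subst_cong[OF hom_in_vars_in[OF f[unfolded form_hom_in]]])
  fix i assume i: "i \<in> {..<n}"
  have "subst (lin_form Q) (lin_form P i) = (\<Sum>j<m. C (P $$ (i, j)) * (\<Sum>l<k. C (Q $$ (j, l)) * X l))"
    using P Q by (simp add: lin_form_def subst_sum subst_mult)
  also have "\<dots> = (\<Sum>l<k. (\<Sum>j<m. C (P $$ (i, j) * Q $$ (j, l))) * X l)"
    unfolding sum_distrib_left sum_distrib_right
    by (subst sum.swap) (simp add: C_mult mult.assoc)
  also have "\<dots> = lin_form (P * Q) i"
    using P Q i by (simp add: lin_form_def scalar_prod_def C_sum lessThan_atLeast0)
  finally show "subst (lin_form Q) (lin_form P i) = lin_form (P * Q) i" .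
qed

lemma lin_subst_one:
  assumes "form d n f" shows "lin_subst (1\<^sub>m n) f = f"
proof -
  have "lin_subst (1\<^sub>m n) f = subst X f"
    unfolding lin_subst_def'
  proof (rule subst_cong[OF hom_in_vars_in[OF assms[unfolded form_hom_in]]])
    fix i assume "i \<in> {..<n}"
    then have "lin_form (1\<^sub>m n) i = (\<Sum>j<n. if i = j then X j else 0)"
      unfolding lin_form_def by (intro sum.cong) auto
    then show "lin_form (1\<^sub>m n) i = (X i :: 'a mpoly)" using \<open>i \<in> _\<close> by simp
  qed
  then show ?thesis by simp
qed

lemma linear_change_iff:
  "linear_change n P \<longleftrightarrow> P \<in> carrier_mat n n \<and> (\<exists>Q\<in>carrier_mat n n. P * Q = 1\<^sub>m n \<and> Q * P = 1\<^sub>m n)"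
  (is "?L \<longleftrightarrow> ?R")
proof
  assume L: ?L
  then obtain Q where P: "P \<in> carrier_mat n n" and Q: "P * Q = 1\<^sub>m n" "Q * P = 1\<^sub>m (dim_row Q)"
    by (auto simp: linear_change_def invertible_mat_def inverts_mat_def)
  \<comment> \<open>\<open>inverts_mat\<close> leaves the dimensions of \<open>Q\<close> open; the
    two unit matrices fix them.\<close>
  have "dim_col (P * Q) = n" "dim_col (Q * P) = dim_row Q" unfolding Q by auto
  then have "Q \<in> carrier_mat n n" using P by auto
  with P Q show ?R by auto
next
  assume ?R
  then show ?L by (auto simp: linear_change_def invertible_mat_def inverts_mat_def square_mat.simps)
qed

lemma linear_changeE:
  assumes "linear_change n P"
  obtains Q where "P \<in> carrier_mat n n" "Q \<in> carrier_mat n n" "P * Q = 1\<^sub>m n" "Q * P = 1\<^sub>m n" "linear_change n Q"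
  using assms unfolding linear_change_iff by blast

lemma linear_changeI: "P \<in> carrier_mat n n \<Longrightarrow> Q \<in> carrier_mat n n \<Longrightarrow> P * Q = 1\<^sub>m n \<Longrightarrow> linear_change n P"
  for P :: "'k::field mat"
  using mat_mult_left_right_inverse[of P n Q] unfolding linear_change_iff by blast

lemma linear_change_one: "linear_change n (1\<^sub>m n)"
  by (rule linear_changeI[of _ _ "1\<^sub>m n"]) auto

lemma linear_change_mult:
  fixes P P' :: "'k::field mat"
  assumes "linear_change n P" "linear_change n P'"
  shows "linear_change n (P * P')"
proof -
  obtain Q where Q: "P \<in> carrier_mat n n" "Q \<in> carrier_mat n n" "P * Q = 1\<^sub>m n"
    by (rule linear_changeE[OF assms(1)])
  obtain Q' where Q': "P' \<in> carrier_mat n n" "Q' \<in> carrier_mat n n" "P' * Q' = 1\<^sub>m n"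
    by (rule linear_changeE[OF assms(2)])
  have "P' * (Q' * Q) = (P' * Q') * Q"
    using Q Q' by (intro assoc_mult_mat[symmetric]) auto
  also have "\<dots> = Q" using Q Q' by simp
  finally have "(P * P') * (Q' * Q) = 1\<^sub>m n"
    using Q Q' assoc_mult_mat[of P n n P' n "Q' * Q" n] by simp
  then show ?thesis using Q Q' by (intro linear_changeI[of _ _ "Q' * Q"]) auto
qed

section \<open>Directional derivatives\<close>

definition dderiv :: "nat \<Rightarrow> 'k vec \<Rightarrow> 'k mpoly \<Rightarrow> 'k::field mpoly" where
  "dderiv n u f = (\<Sum>k<n. C (u $ k) * partial_deriv k f)"

lemma dderiv_0 [simp]: "dderiv n u 0 = 0"
  by (simp add: dderiv_def)

lemma dderiv_add: "dderiv n u (f + g) = dderiv n u f + dderiv n u g"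
  by (simp add: dderiv_def partial_deriv_add distrib_left sum.distrib)

lemma dderiv_C_mult: "dderiv n u (C c * f) = C c * dderiv n u f"
  by (simp add: dderiv_def partial_deriv_C_mult sum_distrib_left mult.left_commute)

lemma dderiv_sum: "dderiv n u (sum f A) = (\<Sum>a\<in>A. dderiv n u (f a))"
  by (induction A rule: infinite_finite_induct) (simp_all add: dderiv_add)

lemma dderiv_add_vec: "v \<in> carrier_vec n \<Longrightarrow> dderiv n (u + v) f = dderiv n u f + dderiv n v f"
  by (simp add: dderiv_def C_add distrib_right sum.distrib)

lemma dderiv_diff_vec:
  assumes "v \<in> carrier_vec n" shows "dderiv n (u - v) f = dderiv n u f - dderiv n v f"
proof -
  have "C (a - b) = C a - C b" for a b :: 'a
    using C_add[of a "- b"] by (simp add: C_uminus)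
  then show ?thesis using assms by (simp add: dderiv_def left_diff_distrib sum_subtractf)
qed

lemma dderiv_smult_vec: "u \<in> carrier_vec n \<Longrightarrow> dderiv n (c \<cdot>\<^sub>v u) f = C c * dderiv n u f"
  by (simp add: dderiv_def C_mult sum_distrib_left mult_ac)

lemma dderiv_zero_vec [simp]: "dderiv n (0\<^sub>v n) f = 0"
  by (simp add: dderiv_def)

lemma dderiv_unit_vec: "k < n \<Longrightarrow> dderiv n (unit_vec n k) f = partial_deriv k f"
proof -
  assume "k < n"
  then have "dderiv n (unit_vec n k) f = (\<Sum>i<n. if i = k then partial_deriv i f else 0)"
    unfolding dderiv_def by (intro sum.cong) auto
  then show ?thesis using \<open>k < n\<close> by simp
qed

lemma partial_deriv_dderiv: "partial_deriv i (dderiv n v f) = dderiv n v (partial_deriv i f)"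
  by (simp add: dderiv_def partial_deriv_sum partial_deriv_C_mult partial_deriv_commute[of i])

lemma dderiv_commute: "dderiv n u (dderiv m v f) = dderiv m v (dderiv n u f)"
  by (simp add: dderiv_def[of n] partial_deriv_dderiv dderiv_sum dderiv_C_mult)

lemma form_dderiv: "form d n f \<Longrightarrow> form (d - 1) n (dderiv m u f)"
  unfolding form_hom_in dderiv_def by (intro hom_in_sum hom_in_C_mult hom_in_partial_deriv)

text \<open>The chain rule for linear forms, whose derivatives are the constant entries of
  \<open>P\<close>: the direction \<open>u\<close> in the new coordinates is the direction
  \<open>P u\<close> in the old ones.\<close>

lemma dderiv_lin_subst:
  assumes f: "form d n f" and P: "P \<in> carrier_mat n m" and u: "u \<in> carrier_vec m"
  shows "dderiv m u (lin_subst P f) = lin_subst P (dderiv n (P *\<^sub>v u) f)"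
proof -
  have deriv: "partial_deriv j (lin_form P i) = C (P $$ (i, j))" if "j < m" for i j
  proof -
    have "partial_deriv j (lin_form P i) = (\<Sum>l<m. if l = j then C (P $$ (i, j)) else 0)"
      unfolding lin_form_def partial_deriv_sum partial_deriv_C_mult partial_deriv_X using P
      by (intro sum.cong) auto
    then show ?thesis using that by simp
  qed
  have "dderiv m u (lin_subst P f) =
      (\<Sum>j<m. C (u $ j) * (\<Sum>i<n. subst (lin_form P) (partial_deriv i f) * C (P $$ (i, j))))"
    unfolding dderiv_def lin_subst_def'
    by (intro sum.cong refl arg_cong2[of _ _ _ _ "(*)"])
      (simp add: chain_rule[OF hom_in_vars_in[OF f[unfolded form_hom_in]]] deriv)
  also have "\<dots> = (\<Sum>i<n. (\<Sum>j<m. C (P $$ (i, j) * u $ j)) * subst (lin_form P) (partial_deriv i f))"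
    unfolding sum_distrib_left sum_distrib_right by (subst sum.swap) (simp add: C_mult mult_ac)
  also have "\<dots> = lin_subst P (dderiv n (P *\<^sub>v u) f)"
    unfolding dderiv_def lin_subst_def' subst_sum subst_mult subst_C
    using P u by (intro sum.cong refl) (simp add: scalar_prod_def C_sum lessThan_atLeast0)
  finally show ?thesis .
qed

lemma lin_subst_0 [simp]: "lin_subst P 0 = 0"
  by (simp add: lin_subst_def')

lemma lin_subst_eq_0:
  fixes f :: "'k::field mpoly"
  assumes f: "form d n f" and P: "linear_change n P" and 0: "lin_subst P f = 0"
  shows "f = 0"
proof -
  obtain Q where "P \<in> carrier_mat n n" "Q \<in> carrier_mat n n" "P * Q = 1\<^sub>m n"
    by (rule linear_changeE[OF P])
  then have "lin_subst Q (lin_subst P f) = f"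
    using f by (simp add: lin_subst_mult lin_subst_one)
  with 0 show ?thesis by simp
qed

text \<open>All variables can be removed one after another, and a form of positive degree in no
  variables is 0.\<close>

lemma form_eq_0_if_partials:
  fixes f :: "'k::field mpoly"
  assumes "CHAR('k) = 0 \<or> CHAR('k) > d" "d \<ge> 1" "form d n f"
    and "\<And>u. u \<in> carrier_vec n \<Longrightarrow> dderiv n u f = 0"
  shows "f = 0"
proof -
  have "partial_deriv i f = 0" if "i \<in> {..<n}" for i
    using assms(4)[of "unit_vec n i"] that by (simp add: dderiv_unit_vec)
  then have "hom_in ({..<n} - {..<n}) d f"
    using assms by (intro hom_in_remove_vars) (auto simp: form_hom_in)
  then show ?thesis using assms(2) hom_in_empty by simp
qed


section \<open>Nondegeneracy and the center in terms of directional derivatives\<close>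

text \<open>Linear independence of the first partial derivatives: \<open>dderiv n u f\<close> is
  their combination with coefficients \<open>u\<close>.\<close>

definition indep_partials :: "nat \<Rightarrow> 'k::field mpoly \<Rightarrow> bool" where
  "indep_partials n f \<longleftrightarrow> (\<forall>u\<in>carrier_vec n. dderiv n u f = 0 \<longrightarrow> u = 0\<^sub>v n)"

text \<open>A direction \<open>u \<noteq> 0\<close> with \<open>dderiv n u f = 0\<close> can be made
  a coordinate direction; the corresponding variable then disappears from the form.\<close>

lemma nondegenerate_imp_indep_partials:
  fixes f :: "'k::field mpoly"
  assumes char: "CHAR('k) = 0 \<or> CHAR('k) > d" and f: "form d n f" and nd: "nondegenerate n f"
  shows "indep_partials n f"
  unfolding indep_partials_def
proof (intro ballI impI)
  fix u :: "'k vec"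
  assume u: "u \<in> carrier_vec n" and 0: "dderiv n u f = 0"
  show "u = 0\<^sub>v n"
  proof (rule ccontr)
    assume "u \<noteq> 0\<^sub>v n"
    then obtain k where k: "k < n" "u $ k \<noteq> 0" using u by (metis eq_vecI carrier_vecD index_zero_vec)
    \<comment> \<open>The unit matrix with column \<open>k\<close> replaced by \<open>u\<close>,
      which is invertible because \<open>u $ k \<noteq> 0\<close>; \<open>Q\<close> is its explicit
      inverse.\<close>
    define P where "P = mat n n (\<lambda>(i, j). if j = k then u $ i else if i = j then 1 else 0)"
    define Q where "Q = mat n n (\<lambda>(i, j). if j = k then (if i = k then 1 / u $ k else - u $ i / u $ k)
      else if i = j then 1 else 0)"
    have PQ: "P \<in> carrier_mat n n" "Q \<in> carrier_mat n n" by (auto simp: P_def Q_def)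
    have "P * Q = 1\<^sub>m n"
    proof (rule eq_matI)
      fix i j assume ij: "i < dim_row (1\<^sub>m n :: 'k mat)" "j < dim_col (1\<^sub>m n :: 'k mat)"
      then have "(P * Q) $$ (i, j) = (\<Sum>l<n. P $$ (i, l) * Q $$ (l, j))"
        by (simp add: P_def Q_def scalar_prod_def lessThan_atLeast0)
      also have "\<dots> = u $ i * Q $$ (k, j) + (\<Sum>l\<in>{..<n} - {k}. if l = i then Q $$ (l, j) else 0)"
      proof -
        have "(\<Sum>l\<in>{..<n} - {k}. P $$ (i, l) * Q $$ (l, j)) =
            (\<Sum>l\<in>{..<n} - {k}. if l = i then Q $$ (l, j) else 0)"
          using ij by (intro sum.cong) (auto simp: P_def)
        then show ?thesis using ij k by (simp add: sum.remove[of "{..<n}" k] P_def)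
      qed
      also have "\<dots> = u $ i * Q $$ (k, j) + (if i = k then 0 else Q $$ (i, j))"
        using ij by simp
      also have "\<dots> = 1\<^sub>m n $$ (i, j)"
        using ij k by (auto simp: Q_def)
      finally show "(P * Q) $$ (i, j) = 1\<^sub>m n $$ (i, j)" .
    qed (auto simp: P_def Q_def)
    then have P: "linear_change n P" using PQ by (intro linear_changeI)
    have "P *\<^sub>v unit_vec n k = u"
      using u k by (intro eq_vecI) (auto simp: P_def mult_mat_unit_vec)
    then have "partial_deriv k (lin_subst P f) = 0"
      using dderiv_lin_subst[OF f PQ(1), of "unit_vec n k"] 0 k by (simp add: dderiv_unit_vec)
    then have "hom_in ({..<n} - {k}) d (lin_subst P f)"
      using form_lin_subst[OF f PQ(1)] char by (intro hom_in_remove_var) (auto simp: form_hom_in)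
    then have "\<forall>m\<in>Poly_Mapping.keys (lin_subst P f). k \<notin> Poly_Mapping.keys m"
      by (auto simp: hom_in_def)
    with P k nd show False by (auto simp: nondegenerate_def)
  qed
qed

definition in_center :: "nat \<Rightarrow> 'k::field mpoly \<Rightarrow> 'k mat \<Rightarrow> bool" where
  "in_center n f A \<longleftrightarrow> A \<in> carrier_mat n n \<and>
    (\<forall>u\<in>carrier_vec n. \<forall>v\<in>carrier_vec n.
      dderiv n (A *\<^sub>v u) (dderiv n v f) = dderiv n u (dderiv n (A *\<^sub>v v) f))"

lemma dderiv_mult_mat_vec:
  assumes "A \<in> carrier_mat n m" "u \<in> carrier_vec m"
  shows "dderiv n (A *\<^sub>v u) f = (\<Sum>i<m. C (u $ i) * dderiv n (col A i) f)"
proof -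
  have "dderiv n (A *\<^sub>v u) f = (\<Sum>k<n. (\<Sum>i<m. C (A $$ (k, i)) * C (u $ i)) * partial_deriv k f)"
    unfolding dderiv_def using assms
    by (intro sum.cong refl) (simp add: scalar_prod_def C_sum C_mult lessThan_atLeast0)
  also have "\<dots> = (\<Sum>i<m. \<Sum>k<n. C (u $ i) * (C (A $$ (k, i)) * partial_deriv k f))"
    unfolding sum_distrib_right by (subst sum.swap) (simp add: mult_ac)
  also have "\<dots> = (\<Sum>i<m. C (u $ i) * dderiv n (col A i) f)"
    unfolding dderiv_def using assms by (simp add: sum_distrib_left)
  finally show ?thesis .
qed

text \<open>Both sides of the center relation are bilinear in the two directions, so unit vectors
  suffice. This version is the symmetry of the Hessian times \<open>A\<close>, entry by
  entry.\<close>

lemma in_center_entries: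
  assumes A: "A \<in> carrier_mat n n"
  shows "in_center n f A \<longleftrightarrow>
    (\<forall>i<n. \<forall>j<n. partial_deriv j (dderiv n (col A i) f) = partial_deriv i (dderiv n (col A j) f))"
    (is "_ \<longleftrightarrow> ?R")
proof
  assume L: "in_center n f A"
  show ?R
  proof (intro allI impI)
    fix i j assume "i < n" "j < n"
    then show "partial_deriv j (dderiv n (col A i) f) = partial_deriv i (dderiv n (col A j) f)"
      using L[unfolded in_center_def, THEN conjunct2, rule_format, of "unit_vec n i" "unit_vec n j"] A
      by (simp add: dderiv_unit_vec mult_mat_unit_vec partial_deriv_dderiv)
  qed
next
  assume R: ?R
  show "in_center n f A"
    unfolding in_center_def
  proof (intro conjI ballI A)
    fix u v :: "'a vec"
    assume u: "u \<in> carrier_vec n" and v: "v \<in> carrier_vec n"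
    have "dderiv n (A *\<^sub>v u) (dderiv n v f) =
        (\<Sum>i<n. \<Sum>j<n. C (u $ i) * (C (v $ j) * partial_deriv j (dderiv n (col A i) f)))"
      unfolding dderiv_mult_mat_vec[OF A u] dderiv_def[of n v]
      by (simp add: dderiv_sum dderiv_C_mult partial_deriv_dderiv sum_distrib_left)
    also have "\<dots> = (\<Sum>i<n. \<Sum>j<n. C (u $ i) * (C (v $ j) * partial_deriv i (dderiv n (col A j) f)))"
      using R by (intro sum.cong refl) simp
    also have "\<dots> = dderiv n u (dderiv n (A *\<^sub>v v) f)"
      unfolding dderiv_mult_mat_vec[OF A v] dderiv_def[of n u]
      by (simp add: partial_deriv_sum partial_deriv_C_mult sum_distrib_left)
    finally show "dderiv n (A *\<^sub>v u) (dderiv n v f) = dderiv n u (dderiv n (A *\<^sub>v v) f)" .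
  qed
qed

lemma carrier_center: "carrier (center n f) = {A. in_center n f A}"
proof -
  have "transpose_mat (hessian n f * map_mat C A) = hessian n f * map_mat C A \<longleftrightarrow> in_center n f A"
    if A: "A \<in> carrier_mat n n" for A
  proof -
    have H: "hessian n f \<in> carrier_mat n n" by (simp add: hessian_def)
    have entry: "(hessian n f * map_mat C A) $$ (i, j) = partial_deriv i (dderiv n (col A j) f)"
      if "i < n" "j < n" for i j
      using that A H
      by (simp add: scalar_prod_def hessian_def dderiv_def partial_deriv_sum partial_deriv_C_mult lessThan_atLeast0 mult.commute[of _ "C _"])
    show ?thesis
      unfolding in_center_entries[OF A] mat_eq_iff using A H by (auto simp: entry simp del: index_mult_mat(1))
  qed
  then show ?thesis by (auto simp: center_def in_center_def)
qed

lemma in_center_carrier: "in_center n f A \<Longrightarrow> A \<in> carrier_mat n n"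
  by (simp add: in_center_def)

lemma in_centerD:
  "in_center n f A \<Longrightarrow> u \<in> carrier_vec n \<Longrightarrow> v \<in> carrier_vec n \<Longrightarrow>
    dderiv n (A *\<^sub>v u) (dderiv n v f) = dderiv n u (dderiv n (A *\<^sub>v v) f)"
  by (simp add: in_center_def)

lemma in_center_add: "in_center n f A \<Longrightarrow> in_center n f B \<Longrightarrow> in_center n f (A + B)"
  unfolding in_center_def by (auto simp: add_mult_distrib_mat_vec dderiv_add_vec dderiv_add square_mat_closed(2))

lemma in_center_smult: "in_center n f A \<Longrightarrow> in_center n f (c \<cdot>\<^sub>m A)"
  unfolding in_center_def by (auto simp: smult_mat_mult_vec dderiv_smult_vec[OF square_mat_closed(2)] dderiv_C_mult)

lemma in_center_zero: "in_center n f (0\<^sub>m n n)"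
  unfolding in_center_def by (auto simp: zero_mat_mult_vec)

lemma in_center_one: "in_center n f (1\<^sub>m n)"
  unfolding in_center_def by auto

text \<open>In a third derivative along \<open>A (B u)\<close>, \<open>x\<close>, \<open>y\<close>
  the matrix \<open>A\<close> can be parked at \<open>x\<close>, then \<open>B\<close> at
  \<open>y\<close>, after which \<open>A\<close> and then \<open>B\<close> return to
  \<open>u\<close>; this yields the direction \<open>B (A u)\<close>. The difference
  \<open>w\<close> of the two directions therefore kills all second derivatives of \<open>f\<close>.
  As these arise from forms of degrees \<open>d - 2 \<ge> 1\<close> and \<open>d - 1\<close>,
  already \<open>dderiv n w f = 0\<close>, and independence of the partials gives
  \<open>w = 0\<close>.\<close>

lemma in_center_comm:
  fixes f :: "'k::field mpoly"
  assumes char: "CHAR('k) = 0 \<or> CHAR('k) > d" and d: "d \<ge> 3"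
    and f: "form d n f" and nd: "indep_partials n f"
    and A: "in_center n f A" and B: "in_center n f B"
  shows "A * B = B * A"
proof -
  note [simp] = in_center_carrier[OF A] in_center_carrier[OF B] square_mat_closed[of _ n]
  \<comment> \<open>The direction \<open>z\<close> is a spectator: the relation is differentiated
    once more along it.\<close>
  have third: "dderiv n (C *\<^sub>v x) (dderiv n y (dderiv n z f)) = dderiv n x (dderiv n (C *\<^sub>v y) (dderiv n z f))"
    if "in_center n f C" "x \<in> carrier_vec n" "y \<in> carrier_vec n" for C x y z
  proof -
    have "dderiv n z (dderiv n (C *\<^sub>v x) (dderiv n y f)) = dderiv n z (dderiv n x (dderiv n (C *\<^sub>v y) f))"
      using in_centerD[OF that] by simp
    then show ?thesis by (simp only: dderiv_commute)
  qed
  have "(A * B) *\<^sub>v u = (B * A) *\<^sub>v u" if u: "u \<in> carrier_vec n" for u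
  proof -
    define w where "w = A *\<^sub>v (B *\<^sub>v u) - B *\<^sub>v (A *\<^sub>v u)"
    have w: "w \<in> carrier_vec n" using u by (simp add: w_def)
    have three: "dderiv n x (dderiv n y (dderiv n w f)) = 0"
      if x: "x \<in> carrier_vec n" and y: "y \<in> carrier_vec n" for x y
    proof -
      have "dderiv n (A *\<^sub>v (B *\<^sub>v u)) (dderiv n x (dderiv n y f)) =
          dderiv n (B *\<^sub>v u) (dderiv n (A *\<^sub>v x) (dderiv n y f))"
        using u x by (intro third[OF A]) auto
      also have "\<dots> = dderiv n (B *\<^sub>v u) (dderiv n y (dderiv n (A *\<^sub>v x) f))"
        by (simp only: dderiv_commute)
      also have "\<dots> = dderiv n u (dderiv n (B *\<^sub>v y) (dderiv n (A *\<^sub>v x) f))"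
        using u y by (intro third[OF B]) auto
      also have "\<dots> = dderiv n u (dderiv n (A *\<^sub>v x) (dderiv n (B *\<^sub>v y) f))"
        by (simp only: dderiv_commute)
      also have "\<dots> = dderiv n (A *\<^sub>v u) (dderiv n x (dderiv n (B *\<^sub>v y) f))"
        using u x by (intro third[OF A, symmetric]) auto
      also have "\<dots> = dderiv n (A *\<^sub>v u) (dderiv n (B *\<^sub>v y) (dderiv n x f))"
        by (simp only: dderiv_commute)
      also have "\<dots> = dderiv n (B *\<^sub>v (A *\<^sub>v u)) (dderiv n y (dderiv n x f))"
        using u y by (intro third[OF B, symmetric]) auto
      also have "\<dots> = dderiv n (B *\<^sub>v (A *\<^sub>v u)) (dderiv n x (dderiv n y f))"
        by (simp only: dderiv_commute)
      finally have "dderiv n w (dderiv n x (dderiv n y f)) = 0"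
        using u by (simp add: w_def dderiv_diff_vec)
      then show ?thesis by (simp only: dderiv_commute)
    qed
    have two: "dderiv n y (dderiv n w f) = 0" if y: "y \<in> carrier_vec n" for y
    proof (rule form_eq_0_if_partials[of "d - 2" n])
      show "CHAR('k) = 0 \<or> d - 2 < CHAR('k)" "1 \<le> d - 2" using char d by auto
      have "d - 1 - 1 = d - 2" by simp
      then show "form (d - 2) n (dderiv n y (dderiv n w f))"
        using form_dderiv[OF form_dderiv[OF f]] by metis
    qed (rule three[OF _ y])
    have "dderiv n w f = 0"
    proof (rule form_eq_0_if_partials[of "d - 1" n])
      show "CHAR('k) = 0 \<or> d - 1 < CHAR('k)" "1 \<le> d - 1" using char d by auto
      show "form (d - 1) n (dderiv n w f)" by (rule form_dderiv[OF f])
    qed (rule two)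
    then have "w = 0\<^sub>v n" using nd w by (auto simp: indep_partials_def)
    then have "(A *\<^sub>v (B *\<^sub>v u)) $ i - (B *\<^sub>v (A *\<^sub>v u)) $ i = 0" if "i < n" for i
      using that carrier_matD(1)[OF in_center_carrier[OF B]]
        index_minus_vec(1)[of i "B *\<^sub>v (A *\<^sub>v u)" "A *\<^sub>v (B *\<^sub>v u)"]
      by (simp add: w_def[symmetric] del: index_mult_mat_vec)
    then have "A *\<^sub>v (B *\<^sub>v u) = B *\<^sub>v (A *\<^sub>v u)"
      using carrier_matD(1)[OF in_center_carrier[OF A]] carrier_matD(1)[OF in_center_carrier[OF B]]
      by (intro eq_vecI) (auto simp del: index_mult_mat_vec)
    then show ?thesis
      using u by (simp add: assoc_mult_mat_vec[of _ n n _ n])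
  qed
  then show ?thesis by (intro eq_mat_multI[of _ n n]) auto
qed

text \<open>Moving \<open>A\<close> and then \<open>B\<close> to the other direction reverses the
  product there; commutativity restores the order.\<close>

lemma in_center_mult:
  fixes f :: "'k::field mpoly"
  assumes char: "CHAR('k) = 0 \<or> CHAR('k) > d" and d: "d \<ge> 3"
    and f: "form d n f" and nd: "indep_partials n f"
    and A: "in_center n f A" and B: "in_center n f B"
  shows "in_center n f (A * B)"
proof -
  note [simp] = in_center_carrier[OF A] in_center_carrier[OF B]
  note [simp] = square_mat_closed[of _ n]
  have "dderiv n ((A * B) *\<^sub>v u) (dderiv n v f) = dderiv n u (dderiv n ((A * B) *\<^sub>v v) f)"
    if u: "u \<in> carrier_vec n" and v: "v \<in> carrier_vec n" for u v
  proof -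
    have "dderiv n ((A * B) *\<^sub>v u) (dderiv n v f) = dderiv n u (dderiv n ((B * A) *\<^sub>v v) f)"
      using u v by (simp add: assoc_mult_mat_vec[of _ n n _ n] in_centerD[OF A] in_centerD[OF B])
    then show ?thesis using in_center_comm[OF char d f nd A B] by simp
  qed
  then show ?thesis by (simp add: in_center_def)
qed

text \<open>The reversal of factors on the other side is harmless for powers of a single
  matrix.\<close>

lemma in_center_pow:
  assumes A: "in_center n f A"
  shows "in_center n f (A ^\<^sub>m k)"
proof (induction k)
  case 0
  then show ?case using in_center_carrier[OF A] in_center_one by (simp)
next
  case (Suc k)
  note [simp] = in_center_carrier[OF A] square_mat_closed[of _ n] pow_carrier_mat[of _ n]
  have comm: "A ^\<^sub>m k * A = A * A ^\<^sub>m k"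
    using pow_mat_add[of A n 1 k] pow_mat_add[of A n k 1] by (simp add: add.commute)
  have "dderiv n (A ^\<^sub>m Suc k *\<^sub>v u) (dderiv n v f) = dderiv n u (dderiv n (A ^\<^sub>m Suc k *\<^sub>v v) f)"
    if u: "u \<in> carrier_vec n" and v: "v \<in> carrier_vec n" for u v
    using u v by (simp add: assoc_mult_mat_vec[of _ n n _ n] in_centerD[OF A] in_centerD[OF Suc])
     (simp add: comm flip: assoc_mult_mat_vec[of _ n n _ n])
  then show ?case by (simp add: in_center_def)
qed

text \<open>\<open>A * P = P * B\<close> says that \<open>B\<close> is \<open>A\<close> read in the
  coordinates \<open>P\<close>; the direction \<open>B u\<close> downstairs is then the direction
  \<open>A (P u)\<close> for \<open>f\<close>.\<close>

lemma in_center_lin_subst: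
  fixes f :: "'k::field mpoly"
  assumes f: "form d n f" and P: "P \<in> carrier_mat n n" and A: "in_center n f A"
    and B: "B \<in> carrier_mat n n" and AB: "A * P = P * B"
  shows "in_center n (lin_subst P f) B"
proof -
  note [simp] = in_center_carrier[OF A] P B square_mat_closed[of _ n]
  have eq: "P *\<^sub>v (B *\<^sub>v u) = A *\<^sub>v (P *\<^sub>v u)" if "u \<in> carrier_vec n" for u
    using that AB by (simp flip: assoc_mult_mat_vec[of _ n n _ n])
  have "dderiv n (B *\<^sub>v u) (dderiv n v (lin_subst P f)) = dderiv n u (dderiv n (B *\<^sub>v v) (lin_subst P f))"
    if u: "u \<in> carrier_vec n" and v: "v \<in> carrier_vec n" for u v
    using u v by (simp add: dderiv_lin_subst[OF f] dderiv_lin_subst[OF form_dderiv[OF f]] eq in_centerD[OF A])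
  then show ?thesis by (simp add: in_center_def)
qed

lemma indep_partials_lin_subst:
  fixes f :: "'k::field mpoly"
  assumes f: "form d n f" and P: "linear_change n P" and nd: "indep_partials n f"
  shows "indep_partials n (lin_subst P f)"
  unfolding indep_partials_def
proof (intro ballI impI)
  fix u assume u: "u \<in> carrier_vec n" and 0: "dderiv n u (lin_subst P f) = 0"
  obtain Q where Q: "P \<in> carrier_mat n n" "Q \<in> carrier_mat n n" "Q * P = 1\<^sub>m n"
    by (rule linear_changeE[OF P])
  have "lin_subst P (dderiv n (P *\<^sub>v u) f) = 0"
    using 0 u Q by (simp add: dderiv_lin_subst[OF f])
  then have "dderiv n (P *\<^sub>v u) f = 0"
    by (rule lin_subst_eq_0[OF form_dderiv[OF f] P])
  then have "P *\<^sub>v u = 0\<^sub>v n"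
    using nd u Q by (simp add: indep_partials_def square_mat_closed[of _ n])
  then have "(Q * P) *\<^sub>v u = 0\<^sub>v n"
    using Q(1,2) u by (simp add: assoc_mult_mat_vec[of _ n n _ n] mult_mat_zero_vec)
  then show "u = 0\<^sub>v n" using Q u by simp
qed

section \<open>Bases adapted to a matrix\<close>

lemma (in vector_space) independent_Un_disjoint:
  assumes fin: "finite A" "finite B" and ind: "independent A" "independent B"
    and int: "span A \<inter> span B \<subseteq> {0}"
  shows "independent (A \<union> B) \<and> A \<inter> B = {}"
proof
  have "x = 0" if "x \<in> A \<inter> B" for x using int that span_base by blast
  then show disj: "A \<inter> B = {}" using ind(1) dependent_zero by blast
  show "independent (A \<union> B)"
  proof (rule independent_if_scalars_zero)
    fix f x assume 0: "(\<Sum>x\<in>A \<union> B. f x *s x) = 0" and x: "x \<in> A \<union> B"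
    have sum: "(\<Sum>x\<in>A. f x *s x) + (\<Sum>x\<in>B. f x *s x) = 0"
      using 0 fin disj by (simp add: sum.union_disjoint)
    have "(\<Sum>x\<in>A. f x *s x) \<in> span A" "(\<Sum>x\<in>B. f x *s x) \<in> span B"
      by (rule span_sum, rule span_scale, rule span_base, assumption)+
    moreover have "(\<Sum>x\<in>A. f x *s x) = - (\<Sum>x\<in>B. f x *s x)"
      using sum by (simp add: eq_neg_iff_add_eq_0)
    ultimately have "(\<Sum>x\<in>A. f x *s x) \<in> span A \<inter> span B"
      by (auto intro: span_neg)
    then have "(\<Sum>x\<in>A. f x *s x) = 0" using int by blast
    with sum have "(\<Sum>x\<in>A. f x *s x) = 0" "(\<Sum>x\<in>B. f x *s x) = 0" by auto
    then show "f x = 0"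
      using x ind fin independentD[of A A f x] independentD[of B B f x] by auto
  qed (use fin in auto)
qed

text \<open>Rank-nullity with explicit bases. \<open>U\<close> consists of one preimage for each
  vector of the image basis \<open>B\<close>, so the map is injective on its span, whereas it is 0
  on the span of \<open>W\<close>. The bijection from \<open>U\<close> to \<open>B\<close> is
  recorded because a Jordan basis must be ordered along it.\<close>

lemma (in Vector_Spaces.linear) image_kernel_basis:
  assumes S: "vs1.subspace S"
    and B: "finite B" "vs2.independent B" "B \<subseteq> f ` S" "f ` S \<subseteq> vs2.span B"
    and W: "finite W" "vs1.independent W" "W \<subseteq> S" "\<And>w. w \<in> W \<Longrightarrow> f w = 0"
      "\<And>w. w \<in> S \<Longrightarrow> f w = 0 \<Longrightarrow> w \<in> vs1.span W"
  obtains U where "U \<subseteq> S" "bij_betw f U B" "U \<inter> W = {}" "vs1.independent (U \<union> W)" "S \<subseteq> vs1.span (U \<union> W)"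
proof -
  define U where "U = inv_into S f ` B"
  have US: "U \<subseteq> S" using B(3) by (auto simp: U_def intro: inv_into_into)
  have fU: "f ` U = B" using B(3) by (force simp: U_def f_inv_into_f)
  have inj: "inj_on f U"
    using B(3) by (auto simp: U_def inj_on_def f_inv_into_f subset_iff)
  have finU: "finite U" using B(1) by (simp add: U_def)
  have inj_span: "inj_on f (vs1.span U)"
    using inj_on_span_independent_image[of U] fU inj B(2) by simp
  have indU: "vs1.independent U"
  proof (rule vs1.independent_if_scalars_zero[OF finU])
    fix c x assume 0: "(\<Sum>x\<in>U. s1 (c x) x) = 0" and x: "x \<in> U"
    have "f (\<Sum>x\<in>U. s1 (c x) x) = (\<Sum>x\<in>U. s2 (c x) (f x))"
      by (simp add: sum scale)
    also have "\<dots> = (\<Sum>y\<in>B. s2 (c (inv_into U f y)) y)"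
      unfolding fU[symmetric] using inj by (simp add: sum.reindex)
    finally have "(\<Sum>y\<in>B. s2 (c (inv_into U f y)) y) = 0" using 0 by simp
    then show "c x = 0"
      using vs2.independentD[OF B(2,1) subset_refl, of "\<lambda>y. c (inv_into U f y)" "f x"] x fU inj by auto
  qed
  have kernel: "f x = 0" if "x \<in> vs1.span W" for x
    using eq_0_on_span[OF W(4) that] .
  have "x = 0" if "x \<in> vs1.span U" "x \<in> vs1.span W" for x
    using inj_onD[OF inj_span _ that(1) vs1.span_zero] kernel[OF that(2)] zero by simp
  then have "vs1.span U \<inter> vs1.span W \<subseteq> {0}" by blast
  then have ind: "vs1.independent (U \<union> W) \<and> U \<inter> W = {}"
    using vs1.independent_Un_disjoint[OF finU W(1) indU W(2)] by blast
  have "S \<subseteq> vs1.span (U \<union> W)"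
  proof
    fix v assume v: "v \<in> S"
    then have "f v \<in> f ` vs1.span U" using B(4) fU span_image[of U] by auto
    then obtain u where u: "u \<in> vs1.span U" "f v = f u" by auto
    have "u \<in> S" using u(1) US S vs1.span_minimal by blast
    then have "v - u \<in> vs1.span W" using u(2) v S by (intro W(5)) (auto simp: diff vs1.subspace_diff)
    then have "u + (v - u) \<in> vs1.span (U \<union> W)"
      using u(1) vs1.span_mono[of U "U \<union> W"] vs1.span_mono[of W "U \<union> W"]
      by (intro vs1.span_add) auto
    then show "v \<in> vs1.span (U \<union> W)" by simp
  qed
  then show ?thesis using that US ind inj fU by (auto simp: bij_betw_def)
qed

section \<open>The space k^n as functions that vanish from \<open>n\<close> on\<close>

text \<open>Spans and bases are taken in one space of functions with the subspace
  \<open>fvec n\<close> in the role of k^n. The type of vectors mixes all dimensions and has no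
  common zero, so it is no vector space as a whole.\<close>

definition fscale :: "'k::field \<Rightarrow> (nat \<Rightarrow> 'k) \<Rightarrow> nat \<Rightarrow> 'k" where
  "fscale c v = (\<lambda>i. c * v i)"

interpretation fv: vector_space fscale
  by unfold_locales (auto simp: fun_eq_iff fscale_def algebra_simps)

definition fvec :: "nat \<Rightarrow> (nat \<Rightarrow> 'k::field) set" where
  "fvec n = {v. \<forall>i\<ge>n. v i = 0}"

definition funit :: "nat \<Rightarrow> nat \<Rightarrow> 'k::field" where
  "funit i = (\<lambda>j. if j = i then 1 else 0)"

lemma subspace_fvec: "fv.subspace (fvec n)"
  by (auto simp: fv.subspace_def fvec_def fscale_def)

lemma sum_fun_apply: "(\<Sum>a\<in>A. g a) i = (\<Sum>a\<in>A. g a i)" for g :: "'b \<Rightarrow> nat \<Rightarrow> 'k::field"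
  by (induction A rule: infinite_finite_induct) auto

lemma fvec_expand:
  assumes "v \<in> fvec n" shows "v = (\<Sum>i<n. fscale (v i) (funit i))"
proof
  fix j
  have "(\<Sum>i<n. fscale (v i) (funit i)) j = (\<Sum>i<n. if i = j then v i else 0)"
    unfolding sum_fun_apply fscale_def funit_def by (intro sum.cong) auto
  also have "\<dots> = v j" using assms by (auto simp: fvec_def)
  finally show "v j = (\<Sum>i<n. fscale (v i) (funit i)) j" ..
qed

lemma inj_funit: "inj (funit :: nat \<Rightarrow> nat \<Rightarrow> 'k::field)"
  by (rule injI) (metis funit_def zero_neq_one)

lemma span_funit: "fv.span (funit ` {..<n}) = (fvec n :: (nat \<Rightarrow> 'k::field) set)"
proof
  show "fv.span (funit ` {..<n}) \<subseteq> (fvec n :: (nat \<Rightarrow> 'k) set)"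
    by (rule fv.span_minimal[OF _ subspace_fvec]) (auto simp: funit_def fvec_def)
  show "fvec n \<subseteq> fv.span (funit ` {..<n} :: (nat \<Rightarrow> 'k) set)"
  proof
    fix v :: "nat \<Rightarrow> 'k" assume "v \<in> fvec n"
    then show "v \<in> fv.span (funit ` {..<n})"
      by (subst fvec_expand, assumption) (intro fv.span_sum fv.span_scale fv.span_base imageI)
  qed
qed

lemma independent_funit: "fv.independent (funit ` {..<n} :: (nat \<Rightarrow> 'k::field) set)"
proof (rule fv.independent_if_scalars_zero)
  fix c :: "(nat \<Rightarrow> 'k) \<Rightarrow> 'k" and x :: "nat \<Rightarrow> 'k"
  assume 0: "(\<Sum>x\<in>funit ` {..<n}. fscale (c x) x) = 0" and "x \<in> funit ` {..<n}"
  then obtain i where i: "i < n" "x = funit i" by auto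
  have "(\<Sum>x\<in>funit ` {..<n}. fscale (c x) x) i = (\<Sum>j<n. fscale (c (funit j)) (funit j) i)"
    by (subst sum.reindex) (auto simp: inj_on_subset[OF inj_funit] sum_fun_apply)
  also have "\<dots> = (\<Sum>j<n. if j = i then c (funit j) else 0)"
    by (intro sum.cong) (auto simp: fscale_def funit_def)
  also have "\<dots> = c x" using i by simp
  finally show "c x = 0" using 0 by simp
qed auto

lemma card_funit: "card (funit ` {..<n} :: (nat \<Rightarrow> 'k::field) set) = n"
  by (subst card_image) (auto simp: inj_on_subset[OF inj_funit])

lemma independent_fvec_bound:
  fixes B :: "(nat \<Rightarrow> 'k::field) set"
  assumes "fv.independent B" "B \<subseteq> fvec n"
  shows "finite B \<and> card B \<le> n"
  using fv.independent_span_bound[of "funit ` {..<n}" B] assms by (simp add: span_funit card_funit)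

lemma card_fvec_basis:
  fixes B :: "(nat \<Rightarrow> 'k::field) set"
  assumes "fv.independent B" "B \<subseteq> fvec n" "fvec n \<subseteq> fv.span B"
  shows "card B = n"
proof -
  have "funit ` {..<n} \<subseteq> fv.span B"
    using assms(3) span_funit[of n] fv.span_superset[of "funit ` {..<n}"] by blast
  then have "n \<le> card B"
    using fv.independent_span_bound[OF _ independent_funit, of B n] independent_fvec_bound[OF assms(1,2)]
    by (simp add: card_funit)
  then show ?thesis using independent_fvec_bound[OF assms(1,2)] by simp
qed

lemma independent_card_spans_fvec:
  fixes B :: "(nat \<Rightarrow> 'k::field) set"
  assumes "fv.independent B" "B \<subseteq> fvec n" "card B = n"
  shows "fvec n \<subseteq> fv.span B"
proof
  fix v :: "nat \<Rightarrow> 'k" assume v: "v \<in> fvec n"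
  show "v \<in> fv.span B"
  proof (rule ccontr)
    assume nv: "v \<notin> fv.span B"
    then have "fv.independent (insert v B)" using assms(1) fv.independent_insertI by blast
    then have "card (insert v B) \<le> n" using independent_fvec_bound[of "insert v B" n] v assms(2) by simp
    moreover have "v \<notin> B" using nv fv.span_base by blast
    ultimately show False using assms independent_fvec_bound[OF assms(1,2)] by simp
  qed
qed

lemma basis_matrix:
  fixes bs :: "(nat \<Rightarrow> 'k::field) list"
  assumes bs: "distinct bs" "length bs = n" "set bs \<subseteq> fvec n" "fv.independent (set bs)"
  shows "linear_change n (mat n n (\<lambda>(i, j). (bs ! j) i))"
proof -
  have span: "fvec n \<subseteq> fv.span (set bs)"
    using bs by (intro independent_card_spans_fvec) (auto simp: distinct_card)
  have "\<exists>u. funit k = (\<Sum>v\<in>set bs. fscale (u v) v)" if "k < n" for k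
  proof -
    have "(funit k :: nat \<Rightarrow> 'k) \<in> fv.span (set bs)"
      using span that by (auto simp: fvec_def funit_def subset_iff)
    then show ?thesis by (auto simp: fv.span_finite)
  qed
  then obtain u where u: "\<And>k. k < n \<Longrightarrow> funit k = (\<Sum>v\<in>set bs. fscale (u k v) v)" by metis
  let ?P = "mat n n (\<lambda>(i, j). (bs ! j) i)"
  \<comment> \<open>Column \<open>k\<close> of \<open>Q\<close> holds the coordinates of the unit
    vector \<open>funit k\<close> with respect to \<open>bs\<close>.\<close>
  define Q where "Q = mat n n (\<lambda>(j, k). u k (bs ! j))"
  have "?P * Q = 1\<^sub>m n"
  proof (rule eq_matI)
    fix i k assume ik: "i < dim_row (1\<^sub>m n :: 'k mat)" "k < dim_col (1\<^sub>m n :: 'k mat)"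
    then have "(?P * Q) $$ (i, k) = (\<Sum>j<n. (bs ! j) i * u k (bs ! j))"
      by (simp add: Q_def scalar_prod_def lessThan_atLeast0)
    also have "\<dots> = (\<Sum>v\<in>set bs. v i * u k v)"
      using bs by (intro sum.reindex_bij_betw bij_betw_nth) auto
    also have "\<dots> = (\<Sum>v\<in>set bs. fscale (u k v) v) i"
      by (simp add: sum_fun_apply fscale_def mult.commute)
    also have "\<dots> = 1\<^sub>m n $$ (i, k)"
      using ik by (simp add: funit_def flip: u)
    finally show "(?P * Q) $$ (i, k) = 1\<^sub>m n $$ (i, k)" .
  qed (auto simp: Q_def)
  then show ?thesis by (intro linear_changeI[of _ _ Q]) (auto simp: Q_def)
qed

text \<open>Total on functions: only the first \<open>dim_col A\<close> values are read, and the
  cut-off places the result in \<open>fvec (dim_row A)\<close>.\<close>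

definition mat_fun :: "'k mat \<Rightarrow> (nat \<Rightarrow> 'k) \<Rightarrow> nat \<Rightarrow> 'k::field" where
  "mat_fun A v = (\<lambda>i. if i < dim_row A then \<Sum>j<dim_col A. A $$ (i, j) * v j else 0)"

lemma mat_fun_fvec: "A \<in> carrier_mat n m \<Longrightarrow> mat_fun A v \<in> fvec n"
  by (auto simp: mat_fun_def fvec_def)

lemma vec_mat_fun: "A \<in> carrier_mat n m \<Longrightarrow> vec n (mat_fun A v) = A *\<^sub>v vec m v"
  by (intro eq_vecI) (auto simp: mat_fun_def scalar_prod_def lessThan_atLeast0)

lemma vec_inj_fvec: "u \<in> fvec n \<Longrightarrow> v \<in> fvec n \<Longrightarrow> vec n u = vec n v \<Longrightarrow> u = v"
  by (rule ext, rename_tac i, case_tac "i < n") (auto simp: fvec_def vec_eq_iff)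

lemma linear_mat_fun: "Vector_Spaces.linear fscale fscale (mat_fun A)"
  by unfold_locales (auto simp: mat_fun_def fscale_def fun_eq_iff sum_distrib_left algebra_simps sum.distrib)

lemma col_basis_matrix: "j < n \<Longrightarrow> col (mat n n (\<lambda>(i, j). (bs ! j) i)) j = vec n (bs ! j)"
  by (intro eq_vecI) auto

lemma vec_zero_fun [simp]: "vec n 0 = 0\<^sub>v n"
  by (intro eq_vecI) auto

section \<open>Bases for square-zero matrices and for the Fitting decomposition\<close>

text \<open>A Jordan basis with blocks of size at most 2. The number \<open>l\<close> of blocks of
  size 2 is the rank of \<open>N\<close>.\<close>

lemma square_zero_basis:
  fixes N :: "'k::field mat"
  assumes N: "N \<in> carrier_mat n n" and NN: "N * N = 0\<^sub>m n n"
  obtains P l where "linear_change n P" "2 * l \<le> n"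
    "\<And>j. j < n \<Longrightarrow> N *\<^sub>v col P j = (if l \<le> j \<and> j < 2 * l then col P (j - l) else 0\<^sub>v n)"
proof -
  interpret T: Vector_Spaces.linear fscale fscale "mat_fun N" by (rule linear_mat_fun)
  let ?T = "mat_fun N"
  have TT: "?T (?T v) = 0" for v
  proof (rule vec_inj_fvec)
    have "vec n (?T (?T v)) = (N * N) *\<^sub>v vec n v"
      using N by (simp add: vec_mat_fun[OF N] assoc_mult_mat_vec[of _ n n _ n])
    then show "vec n (?T (?T v)) = vec n 0" by (simp add: NN zero_mat_mult_vec)
  qed (use mat_fun_fvec[OF N] in \<open>auto simp: fvec_def\<close>)
  obtain B where B: "B \<subseteq> ?T ` fvec n" "fv.independent B" "?T ` fvec n \<subseteq> fv.span B"
    by (rule fv.maximal_independent_subset)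
  have BS: "B \<subseteq> fvec n" using B(1) mat_fun_fvec[OF N] by blast
  \<comment> \<open>Because \<open>N * N = 0\<close>, the image lies in the kernel; hence a basis of
    the kernel can be chosen to extend the image basis \<open>B\<close>.\<close>
  have BK: "B \<subseteq> {v \<in> fvec n. ?T v = 0}" using B(1) BS TT by blast
  obtain W where W: "B \<subseteq> W" "W \<subseteq> {v \<in> fvec n. ?T v = 0}" "fv.independent W"
      "{v \<in> fvec n. ?T v = 0} \<subseteq> fv.span W"
    by (rule fv.maximal_independent_subset_extend[OF BK B(2)])
  have finB: "finite B" using independent_fvec_bound[OF B(2) BS] by simp
  have finW: "finite W" using independent_fvec_bound[OF W(3)] W(2) by blast
  obtain U where U: "U \<subseteq> fvec n" "bij_betw ?T U B" "U \<inter> W = {}" "fv.independent (U \<union> W)"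
      "fvec n \<subseteq> fv.span (U \<union> W)"
    by (rule T.image_kernel_basis[OF subspace_fvec finB B(2,1,3) finW W(3)]) (use W in auto)
  define l where "l = card B"
  obtain bl where bl: "set bl = B" "distinct bl" using finite_distinct_list[OF finB] by blast
  obtain wl where wl: "set wl = W - B" "distinct wl" using finite_distinct_list[of "W - B"] finW by blast
  define ul where "ul = map (inv_into U ?T) bl"
  \<comment> \<open>Image basis, its preimages in the same order, remaining kernel vectors: position
    \<open>l + i\<close> is mapped to position \<open>i\<close>, and all other positions to
    0.\<close>
  define bs where "bs = bl @ ul @ wl"
  have inv: "bij_betw (inv_into U ?T) B U" using U(2) by (rule bij_betw_inv_into)
  have ul: "set ul = U" "distinct ul"
    using inv bl by (auto simp: ul_def bij_betw_def distinct_map)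
  have len: "length bl = l" "length ul = l" using bl by (auto simp: l_def ul_def distinct_card[symmetric])
  have set: "set bs = U \<union> W" using bl wl ul W(1) by (auto simp: bs_def)
  have dist: "distinct bs" using bl wl ul U(3) W(1) by (auto simp: bs_def)
  have sub: "set bs \<subseteq> fvec n" using set U(1) W(2) by auto
  have n: "length bs = n"
    using card_fvec_basis[of "set bs" n] sub U(4,5) distinct_card[OF dist] set by simp
  define P where "P = mat n n (\<lambda>(i, j). (bs ! j) i)"
  have "linear_change n P"
    unfolding P_def using basis_matrix[OF dist n sub] U(4) set by simp
  moreover have "2 * l \<le> n" using n len by (simp add: bs_def)
  moreover have "N *\<^sub>v col P j = (if l \<le> j \<and> j < 2 * l then col P (j - l) else 0\<^sub>v n)" if j: "j < n" for j
  proof -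
    have "?T (bs ! j) = (if l \<le> j \<and> j < 2 * l then bs ! (j - l) else 0)"
    proof (cases "l \<le> j \<and> j < 2 * l")
      case True
      then have "bs ! j = inv_into U ?T (bl ! (j - l))" "bs ! (j - l) = bl ! (j - l)" "bl ! (j - l) \<in> B"
        using len bl by (auto simp: bs_def nth_append ul_def)
      then show ?thesis using True U(2) by (simp add: bij_betw_inv_into_right)
    next
      case False
      then have "bs ! j \<in> set bl \<or> bs ! j \<in> set wl"
        using len n j by (auto simp: bs_def nth_append)
      then have "bs ! j \<in> W" using bl wl W(1) by auto
      then show ?thesis using W(2) False by auto
    qed
    then have "vec n (?T (bs ! j)) = (if l \<le> j \<and> j < 2 * l then vec n (bs ! (j - l)) else 0\<^sub>v n)"
      by simp
    then show ?thesis using j by (simp add: P_def col_basis_matrix vec_mat_fun[OF N])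
  qed
  ultimately show ?thesis using that by blast
qed

text \<open>By the assumption on \<open>A\<close>, a vector of the image that lies in the kernel is
  0. By dimension count, image and kernel then span everything.\<close>

lemma image_kernel_splitting:
  fixes A :: "'k::field mat"
  assumes A: "A \<in> carrier_mat n n"
    and AA: "\<And>v. v \<in> carrier_vec n \<Longrightarrow> A *\<^sub>v (A *\<^sub>v v) = 0\<^sub>v n \<Longrightarrow> A *\<^sub>v v = 0\<^sub>v n"
  obtains P a where "linear_change n P" "a \<le> n"
    "\<And>j. j < a \<Longrightarrow> \<exists>w\<in>carrier_vec n. col P j = A *\<^sub>v w"
    "\<And>j. a \<le> j \<Longrightarrow> j < n \<Longrightarrow> A *\<^sub>v col P j = 0\<^sub>v n"
proof -
  interpret T: Vector_Spaces.linear fscale fscale "mat_fun A" by (rule linear_mat_fun)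
  let ?T = "mat_fun A"
  have TT: "?T v = 0" if "?T (?T v) = 0" for v
  proof (rule vec_inj_fvec)
    have "vec n (?T (?T v)) = 0\<^sub>v n" using that by simp
    then have "A *\<^sub>v (A *\<^sub>v vec n v) = 0\<^sub>v n" by (simp add: vec_mat_fun[OF A])
    then have "A *\<^sub>v vec n v = 0\<^sub>v n" by (rule AA[OF vec_carrier])
    then show "vec n (?T v) = vec n 0" by (simp add: vec_mat_fun[OF A])
  qed (use mat_fun_fvec[OF A] in \<open>auto simp: fvec_def\<close>)
  obtain B where B: "B \<subseteq> ?T ` fvec n" "fv.independent B" "?T ` fvec n \<subseteq> fv.span B"
    by (rule fv.maximal_independent_subset)
  have BS: "B \<subseteq> fvec n" using B(1) mat_fun_fvec[OF A] by blast
  obtain W where W: "W \<subseteq> {v \<in> fvec n. ?T v = 0}" "fv.independent W" "{v \<in> fvec n. ?T v = 0} \<subseteq> fv.span W"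
    by (rule fv.maximal_independent_subset)
  have finB: "finite B" using independent_fvec_bound[OF B(2) BS] by simp
  have finW: "finite W" using independent_fvec_bound[OF W(2)] W(1) by blast
  obtain U where U: "U \<subseteq> fvec n" "bij_betw ?T U B" "U \<inter> W = {}" "fv.independent (U \<union> W)"
      "fvec n \<subseteq> fv.span (U \<union> W)"
    by (rule T.image_kernel_basis[OF subspace_fvec finB B(2,1,3) finW W(2)]) (use W in auto)
  \<comment> \<open>The preimages \<open>U\<close> serve only to count; the basis itself uses the
    image vectors \<open>B\<close> in their place.\<close>
  have "card (U \<union> W) = n" using card_fvec_basis[OF U(4) _ U(5)] U(1) W(1) by blast
  then have cards: "card B + card W = n"
    using U(2,3) finW finB by (simp add: card_Un_disjoint bij_betw_finite bij_betw_same_card)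
  have "x = 0" if "x \<in> fv.span B" "x \<in> fv.span W" for x
  proof -
    have "fv.subspace (?T ` fvec n)" by (rule T.subspace_image[OF subspace_fvec])
    then have "x \<in> ?T ` fvec n" using that(1) fv.span_minimal[OF B(1)] by blast
    then obtain v where v: "x = ?T v" by blast
    have "?T w = 0" if "w \<in> W" for w using W(1) that by blast
    then have "?T x = 0" by (rule T.eq_0_on_span[OF _ that(2)])
    then show "x = 0" unfolding v by (rule TT)
  qed
  then have ind: "fv.independent (B \<union> W)" "B \<inter> W = {}"
    using fv.independent_Un_disjoint[OF finB finW B(2) W(2)] by auto
  obtain bl where bl: "set bl = B" "distinct bl" using finite_distinct_list[OF finB] by blast
  obtain wl where wl: "set wl = W" "distinct wl" using finite_distinct_list[OF finW] by blast
  define P where "P = mat n n (\<lambda>(i, j). ((bl @ wl) ! j) i)"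
  have len: "length bl = card B" "length wl = card W" using bl wl by (auto simp: distinct_card[symmetric])
  have "linear_change n P"
    unfolding P_def using bl wl ind BS W(1) cards len by (intro basis_matrix) auto
  moreover have "card B \<le> n" using cards by simp
  moreover have "\<exists>w\<in>carrier_vec n. col P j = A *\<^sub>v w" if j: "j < card B" for j
  proof -
    have "(bl @ wl) ! j \<in> B" using j len bl by (auto simp: nth_append)
    then obtain v where "(bl @ wl) ! j = ?T v" using B(1) by blast
    then have "col P j = A *\<^sub>v vec n v"
      using j cards by (simp add: P_def col_basis_matrix vec_mat_fun[OF A])
    then show ?thesis by auto
  qed
  moreover have "A *\<^sub>v col P j = 0\<^sub>v n" if j: "card B \<le> j" "j < n" for j
  proof -
    have "(bl @ wl) ! j \<in> W" using j len wl cards by (auto simp: nth_append)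
    then have "?T ((bl @ wl) ! j) = 0" using W(1) by blast
    then have "vec n (?T ((bl @ wl) ! j)) = 0\<^sub>v n" by simp
    then show ?thesis using j by (simp add: P_def col_basis_matrix vec_mat_fun[OF A])
  qed
  ultimately show ?thesis using that by blast
qed

text \<open>The kernels of the powers increase. A basis of their union is finite, so it lies in one
  of them, and from there on the chain is constant.\<close>

lemma kernel_power_stable:
  fixes A :: "'k::field mat"
  assumes A: "A \<in> carrier_mat n n"
  obtains m where "m \<ge> 1"
    "\<And>v. v \<in> carrier_vec n \<Longrightarrow> A ^\<^sub>m m *\<^sub>v (A ^\<^sub>m m *\<^sub>v v) = 0\<^sub>v n \<Longrightarrow> A ^\<^sub>m m *\<^sub>v v = 0\<^sub>v n"
proof -
  define K where "K k = {v \<in> fvec n. A ^\<^sub>m k *\<^sub>v vec n v = 0\<^sub>v n}" for k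
  have Ak: "A ^\<^sub>m k \<in> carrier_mat n n" for k using A by simp
  have mono: "K k \<subseteq> K (k + j)" for k j
  proof
    fix v assume v: "v \<in> K k"
    have "A ^\<^sub>m (k + j) = A ^\<^sub>m j * A ^\<^sub>m k" using pow_mat_add[OF A, of j k] by (simp add: add.commute)
    then show "v \<in> K (k + j)"
      using v Ak by (simp add: K_def assoc_mult_mat_vec[of _ n n _ n] mult_mat_zero_vec[of _ n n])
  qed
  have subspace: "fv.subspace (K k)" for k
  proof (rule fv.subspaceI)
    show "0 \<in> K k" using Ak by (auto simp: K_def fvec_def mult_mat_zero_vec[of _ n n])
    have [simp]: "vec n (u + v) = vec n u + vec n v" "vec n (fscale c u) = c \<cdot>\<^sub>v vec n u" for u v and c :: 'k
      by (auto simp: fscale_def)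
    fix u v c assume "u \<in> K k"
    then show "fscale c u \<in> K k"
      using Ak by (auto simp: K_def fv.subspace_scale[OF subspace_fvec] mult_mat_vec[of _ n n])
    assume "v \<in> K k"
    with \<open>u \<in> K k\<close> show "u + v \<in> K k"
      using Ak by (auto simp: K_def fv.subspace_add[OF subspace_fvec] mult_add_distrib_mat_vec[of _ n n])
  qed
  obtain B where B: "B \<subseteq> (\<Union>k. K k)" "fv.independent B" "(\<Union>k. K k) \<subseteq> fv.span B"
    by (rule fv.maximal_independent_subset)
  have "B \<subseteq> fvec n" using B(1) by (auto simp: K_def)
  then have fin: "finite B" using independent_fvec_bound[OF B(2)] by blast
  have "\<exists>m. B' \<subseteq> K m" if "finite B'" "B' \<subseteq> (\<Union>k. K k)" for B'
    using that
  proof (induction B' rule: finite_induct)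
    case (insert b B')
    then obtain m k where "B' \<subseteq> K m" "b \<in> K k" by auto
    then have "insert b B' \<subseteq> K (m + k)" using mono[of m k] mono[of k m] by (auto simp: add.commute)
    then show ?case by blast
  qed auto
  from this[OF fin B(1)] obtain m where "B \<subseteq> K m" by blast
  \<comment> \<open>One further step makes the exponent positive, so that the power still kills the
    kernel of \<open>A\<close>.\<close>
  then have m: "B \<subseteq> K (Suc m)" using mono[of m 1] by auto
  have all: "K k \<subseteq> K (Suc m)" for k
    using B(3) fv.span_minimal[OF m subspace] by blast
  show ?thesis
  proof (rule that[of "Suc m"])
    fix v :: "'k vec" assume v: "v \<in> carrier_vec n"
      and 0: "A ^\<^sub>m Suc m *\<^sub>v (A ^\<^sub>m Suc m *\<^sub>v v) = 0\<^sub>v n"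
    define w where "w = (\<lambda>i. if i < n then v $ i else 0)"
    have w: "w \<in> fvec n" "vec n w = v" using v by (auto simp: w_def fvec_def)
    have "A ^\<^sub>m (Suc m + Suc m) *\<^sub>v v = 0\<^sub>v n"
      unfolding pow_mat_add[OF A] using 0 v Ak[of "Suc m"] by (simp only: assoc_mult_mat_vec)
    then have "w \<in> K (Suc m + Suc m)" using w by (simp only: K_def mem_Collect_eq)
    then have "w \<in> K (Suc m)" using all by blast
    then show "A ^\<^sub>m Suc m *\<^sub>v v = 0\<^sub>v n" using w(2) by (simp only: K_def mem_Collect_eq)
  qed simp
qed

section \<open>Sums of forms in disjoint variables\<close>

lemma shift_add: "shift a (p + q) = shift a p + shift a q"
  by (simp add: shift_def subst_add)

lemma shift_0 [simp]: "shift a 0 = 0"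
  by (simp add: shift_def)

lemma shift_shift: "shift a (shift b p) = shift (a + b) p"
  by (simp add: shift_def subst_subst add.assoc)

lemma shift_zero [simp]: "shift 0 p = p"
  using subst_X_id[of p] by (simp add: shift_def)

lemma shift_diff: "shift a (p - q) = shift a p - shift a q"
  by (simp add: shift_def subst_diff)

lemma unshift: "subst (\<lambda>i. X (i - a)) (shift a p) = p"
  using subst_X_id[of p] by (simp add: shift_def subst_subst)

lemma shift_eq_iff [simp]: "shift a p = shift a q \<longleftrightarrow> p = q"
  using unshift by metis

lemma hom_in_shift: "form d b h \<Longrightarrow> hom_in {a..<a + b} d (shift a h)"
  unfolding form_hom_in shift_def by (rule hom_in_subst, assumption, rule hom_in_X) auto

lemma hom_in_shiftE:
  assumes r: "hom_in {a..<a + b} d r"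
  obtains h where "form d b h" "shift a h = r"
proof
  show "form d b (subst (\<lambda>i. X (i - a)) r)"
    unfolding form_hom_in by (rule hom_in_subst[OF r], rule hom_in_X) auto
  have "shift a (subst (\<lambda>i. X (i - a)) r) = subst X r"
    unfolding shift_def subst_subst by (rule subst_cong[OF hom_in_vars_in[OF r]]) simp
  then show "shift a (subst (\<lambda>i. X (i - a)) r) = r" by simp
qed

lemma form_shift: "form d b h \<Longrightarrow> form d (a + b) (shift a h)"
  unfolding form_hom_in[of d "a + b"] by (rule hom_in_mono[OF hom_in_shift]) auto

lemma form_mono: "form d a g \<Longrightarrow> a \<le> b \<Longrightarrow> form d b g"
  unfolding form_hom_in by (rule hom_in_mono) auto

lemma form_block_sum2: "form d a g \<Longrightarrow> form d b h \<Longrightarrow> form d (a + b) (g + shift a h)"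
  using form_mono[of d a g "a + b"] form_shift[of d b h a] by (simp add: form_hom_in hom_in_add)

lemma partial_deriv_shift:
  assumes "form d b h" "k < b"
  shows "partial_deriv (a + k) (shift a h) = shift a (partial_deriv k h)"
proof -
  have "partial_deriv (a + k) (shift a h) =
      (\<Sum>i<b. if i = k then subst (\<lambda>i. X (a + i)) (partial_deriv i h) else 0)"
    unfolding shift_def chain_rule[OF hom_in_vars_in[OF assms(1)[unfolded form_hom_in]] finite_lessThan]
    by (intro sum.cong) (auto simp: partial_deriv_X)
  then show ?thesis using assms(2) by (simp add: shift_def)
qed

lemma partial_deriv_shift_0:
  assumes "form d b h" "k < a" shows "partial_deriv k (shift a h) = 0"
  using hom_in_vars_in[OF hom_in_shift[OF assms(1), of a]] assms(2)
  by (intro partial_deriv_eq_0[of "{a..<a + b}"]) auto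

lemma sum_lessThan_add: "(\<Sum>k<a + b. f k) = (\<Sum>k<a. f k) + (\<Sum>k<b. f (a + k))"
  for f :: "nat \<Rightarrow> 'b::comm_monoid_add"
  by (induction b) (simp_all add: add.assoc)

lemma dderiv_block:
  assumes g: "form d a g" and h: "form e b h" and u: "u \<in> carrier_vec a" and w: "w \<in> carrier_vec b"
  shows "dderiv (a + b) (u @\<^sub>v w) (g + shift a h) = dderiv a u g + shift a (dderiv b w h)"
proof -
  have "partial_deriv (a + k) g = 0" for k
    using hom_in_vars_in[OF g[unfolded form_hom_in]] by (intro partial_deriv_eq_0[of "{..<a}"]) auto
  moreover have "shift a (dderiv b w h) = (\<Sum>k<b. C (w $ k) * partial_deriv (a + k) (shift a h))"
    using partial_deriv_shift[OF h] by (simp add: dderiv_def shift_def subst_sum subst_mult)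
  ultimately show ?thesis
    using u w by (simp add: dderiv_def sum_lessThan_add partial_deriv_add partial_deriv_shift_0[OF h])
qed

text \<open>The difference \<open>p - p'\<close> involves only variables below \<open>a\<close>, yet
  it equals a shifted polynomial, whose variables start at \<open>a\<close>. It has no variables
  left and positive degree.\<close>

lemma block_separate:
  assumes "form e a p" "form e a p'" "form e b q" "form e b q'" "e \<ge> 1"
    and eq: "p + shift a q = p' + shift a q'"
  shows "p = p' \<and> q = q'"
proof -
  have "hom_in {..<a} e (p - p')" using assms by (simp add: form_hom_in hom_in_diff)
  moreover have "hom_in {a..<a + b} e (shift a (q' - q))"
    using assms by (intro hom_in_shift) (simp add: form_hom_in hom_in_diff)
  moreover have pq: "p - p' = shift a (q' - q)" using eq by (simp add: shift_diff algebra_simps)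
  ultimately have "hom_in ({..<a} \<inter> {a..<a + b}) e (p - p')"
    by (intro hom_in_Int) (auto intro: hom_in_vars_in)
  moreover have "{..<a} \<inter> {a..<a + b} = {}" by auto
  ultimately have "p - p' = 0" using assms(5) by (intro hom_in_empty[of e]) simp_all
  with eq show ?thesis by simp
qed

text \<open>A direction that kills one summand, padded with zeros, kills the sum.\<close>

lemma indep_partials_block:
  assumes g: "form d a g" and h: "form d b h" and nd: "indep_partials (a + b) (g + shift a h)"
  shows "indep_partials a g" "indep_partials b h"
proof -
  have *: "u @\<^sub>v w = 0\<^sub>v a @\<^sub>v 0\<^sub>v b"
    if "u \<in> carrier_vec a" "w \<in> carrier_vec b" "dderiv a u g = 0" "dderiv b w h = 0" for u w
  proof -
    have "dderiv (a + b) (u @\<^sub>v w) (g + shift a h) = 0"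
      using dderiv_block[OF g h that(1,2)] that(3,4) by simp
    then have "u @\<^sub>v w = 0\<^sub>v (a + b)" using nd that by (simp add: indep_partials_def)
    also have "\<dots> = 0\<^sub>v a @\<^sub>v 0\<^sub>v b" by (intro eq_vecI) auto
    finally show ?thesis .
  qed
  show "indep_partials a g"
    unfolding indep_partials_def
  proof (intro ballI impI)
    fix u assume u: "u \<in> carrier_vec a" "dderiv a u g = 0"
    have "u @\<^sub>v 0\<^sub>v b = 0\<^sub>v a @\<^sub>v 0\<^sub>v b" using u by (intro *) auto
    then show "u = 0\<^sub>v a" using append_vec_eq[OF u(1) zero_carrier_vec] by blast
  qed
  show "indep_partials b h"
    unfolding indep_partials_def
  proof (intro ballI impI)
    fix w assume w: "w \<in> carrier_vec b" "dderiv b w h = 0"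
    have "0\<^sub>v a @\<^sub>v w = 0\<^sub>v a @\<^sub>v 0\<^sub>v b" using w by (intro *) auto
    then show "w = 0\<^sub>v b" using append_vec_eq[OF zero_carrier_vec zero_carrier_vec] by blast
  qed
qed

lemma dderiv2_block:
  assumes g: "form d a g" and h: "form d b h"
    and "u \<in> carrier_vec a" "w \<in> carrier_vec b" "u' \<in> carrier_vec a" "w' \<in> carrier_vec b"
  shows "dderiv (a + b) (u @\<^sub>v w) (dderiv (a + b) (u' @\<^sub>v w') (g + shift a h)) =
    dderiv a u (dderiv a u' g) + shift a (dderiv b w (dderiv b w' h))"
  by (simp only: dderiv_block[OF g h assms(5,6)] dderiv_block[OF form_dderiv[OF g] form_dderiv[OF h] assms(3,4)])

lemma in_center_four_block:
  fixes g h :: "'k::field mpoly"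
  assumes g: "form d a g" and h: "form d b h"
    and A: "in_center a g A" and D: "in_center b h D"
  shows "in_center (a + b) (g + shift a h) (four_block_mat A (0\<^sub>m a b) (0\<^sub>m b a) D)"
proof -
  let ?X = "four_block_mat A (0\<^sub>m a b) (0\<^sub>m b a) D"
  note cA = in_center_carrier[OF A] and cD = in_center_carrier[OF D]
  have "dderiv (a + b) (?X *\<^sub>v u) (dderiv (a + b) v (g + shift a h)) =
      dderiv (a + b) u (dderiv (a + b) (?X *\<^sub>v v) (g + shift a h))"
    if u: "u \<in> carrier_vec (a + b)" and v: "v \<in> carrier_vec (a + b)" for u v
  proof -
    obtain u1 u2 where u: "u = u1 @\<^sub>v u2" "u1 \<in> carrier_vec a" "u2 \<in> carrier_vec b"
      using vec_first_last_append[OF u] vec_first_carrier vec_last_carrier by metis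
    obtain v1 v2 where v: "v = v1 @\<^sub>v v2" "v1 \<in> carrier_vec a" "v2 \<in> carrier_vec b"
      using vec_first_last_append[OF v] vec_first_carrier vec_last_carrier by metis
    note X = mult_mat_vec_split[OF cA cD]
    show ?thesis
      unfolding u(1) v(1) X[OF u(2,3)] X[OF v(2,3)]
      using u v square_mat_closed(2)[OF cA] square_mat_closed(2)[OF cD]
      by (simp add: dderiv2_block[OF g h] in_centerD[OF A] in_centerD[OF D])
  qed
  then show ?thesis using cA cD by (simp add: in_center_def)
qed

text \<open>Both sides of the symmetry condition split into a part in the first and a part in the last
  variables; as they have degree \<open>d - 2 \<ge> 1\<close>, the parts can be compared separately.\<close>

lemma in_center_block_diag:
  fixes g h :: "'k::field mpoly"
  assumes char: "CHAR('k) = 0 \<or> CHAR('k) > d" and d: "d \<ge> 3"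
    and g: "form d a g" and h: "form d b h" and nd: "indep_partials (a + b) (g + shift a h)"
    and Z: "in_center (a + b) (g + shift a h) Z"
  obtains A D where "Z = four_block_mat A (0\<^sub>m a b) (0\<^sub>m b a) D" "in_center a g A" "in_center b h D"
proof -
  obtain A B E D where s: "split_block Z a a = (A, B, E, D)" by (metis prod_cases4)
  note sb = split_block[OF s, of b b]
  have Z': "Z = four_block_mat A B E D" "A \<in> carrier_mat a a" "B \<in> carrier_mat a b"
    "E \<in> carrier_mat b a" "D \<in> carrier_mat b b"
    using sb in_center_carrier[OF Z] by auto
  note ndg = indep_partials_block(1)[OF g h nd] and ndh = indep_partials_block(2)[OF g h nd]
  have sep: "dderiv a (A *\<^sub>v u1 + B *\<^sub>v u2) (dderiv a v1 g) = dderiv a u1 (dderiv a (A *\<^sub>v v1 + B *\<^sub>v v2) g) \<and>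
      dderiv b (E *\<^sub>v u1 + D *\<^sub>v u2) (dderiv b v2 h) = dderiv b u2 (dderiv b (E *\<^sub>v v1 + D *\<^sub>v v2) h)"
    if u: "u1 \<in> carrier_vec a" "u2 \<in> carrier_vec b" and v: "v1 \<in> carrier_vec a" "v2 \<in> carrier_vec b" for u1 u2 v1 v2
  proof (rule block_separate[of "d - 1 - 1" a _ _ b])
    have cl: "A *\<^sub>v x + B *\<^sub>v y \<in> carrier_vec a" "E *\<^sub>v x + D *\<^sub>v y \<in> carrier_vec b"
      if "x \<in> carrier_vec a" "y \<in> carrier_vec b" for x y
      using that Z' by auto
    have "dderiv (a + b) (Z *\<^sub>v (u1 @\<^sub>v u2)) (dderiv (a + b) (v1 @\<^sub>v v2) (g + shift a h)) =
        dderiv (a + b) (u1 @\<^sub>v u2) (dderiv (a + b) (Z *\<^sub>v (v1 @\<^sub>v v2)) (g + shift a h))"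
      using u v by (intro in_centerD[OF Z]) auto
    then show "dderiv a (A *\<^sub>v u1 + B *\<^sub>v u2) (dderiv a v1 g) + shift a (dderiv b (E *\<^sub>v u1 + D *\<^sub>v u2) (dderiv b v2 h)) =
        dderiv a u1 (dderiv a (A *\<^sub>v v1 + B *\<^sub>v v2) g) + shift a (dderiv b u2 (dderiv b (E *\<^sub>v v1 + D *\<^sub>v v2) h))"
      unfolding Z'(1) four_block_mat_mult_vec[OF Z'(2-5) u] four_block_mat_mult_vec[OF Z'(2-5) v]
        dderiv2_block[OF g h cl[OF u] v] dderiv2_block[OF g h u cl[OF v]] .
    show "1 \<le> d - 1 - 1" using d by simp
  qed (intro form_dderiv g h)+
  have char': "CHAR('k) = 0 \<or> d - 1 < CHAR('k)" "1 \<le> d - 1" using char d by auto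
  have B0: "A *\<^sub>v v + B *\<^sub>v 0\<^sub>v b = A *\<^sub>v v" if "v \<in> carrier_vec a" for v
    using that Z' by (auto simp: mult_mat_zero_vec[of _ a b])
  have E0: "E *\<^sub>v 0\<^sub>v a + D *\<^sub>v w = D *\<^sub>v w" if "w \<in> carrier_vec b" for w
    using that Z' by (auto simp: mult_mat_zero_vec[of _ b a])
  have A: "in_center a g A"
    using sep[OF _ zero_carrier_vec _ zero_carrier_vec] Z'(2) by (simp add: in_center_def B0)
  have D: "in_center b h D"
    using sep[OF zero_carrier_vec _ zero_carrier_vec] Z'(5) by (simp add: in_center_def E0)
  \<comment> \<open>Testing \<open>sep\<close> on the directions \<open>(u, 0)\<close> and
    \<open>(0, v)\<close> makes one side 0, so all derivatives of
    \<open>dderiv a (B *\<^sub>v v) g\<close> vanish. The block \<open>E\<close> is treated alike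
    with \<open>h\<close>.\<close>
  have "B = 0\<^sub>m a b"
  proof (rule eq_mat_multI[OF Z'(3)])
    fix v :: "'k vec" assume v: "v \<in> carrier_vec b"
    have Bv: "B *\<^sub>v v \<in> carrier_vec a" using Z' v by auto
    have 0: "dderiv a u (dderiv a (B *\<^sub>v v) g) = 0" if "u \<in> carrier_vec a" for u
      using sep[OF that zero_carrier_vec zero_carrier_vec v] Z' Bv by (simp add: mult_mat_zero_vec[of _ a a])
    have "dderiv a (B *\<^sub>v v) g = 0"
      by (rule form_eq_0_if_partials[OF char' form_dderiv[OF g] 0])
    then show "B *\<^sub>v v = 0\<^sub>m a b *\<^sub>v v" using ndg Bv v by (simp add: indep_partials_def zero_mat_mult_vec)
  qed auto
  moreover have "E = 0\<^sub>m b a"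
  proof (rule eq_mat_multI[OF Z'(4)])
    fix v :: "'k vec" assume v: "v \<in> carrier_vec a"
    have Cv: "E *\<^sub>v v \<in> carrier_vec b" using Z' v by auto
    have 0: "dderiv b u (dderiv b (E *\<^sub>v v) h) = 0" if "u \<in> carrier_vec b" for u
      using sep[OF zero_carrier_vec that v zero_carrier_vec] Z' Cv by (simp add: mult_mat_zero_vec[of _ b b])
    have "dderiv b (E *\<^sub>v v) h = 0"
      by (rule form_eq_0_if_partials[OF char' form_dderiv[OF h] 0])
    then show "E *\<^sub>v v = 0\<^sub>m b a *\<^sub>v v" using ndh Cv v by (simp add: indep_partials_def zero_mat_mult_vec)
  qed auto
  ultimately show ?thesis using that Z'(1) A D by blast
qed


section \<open>Splitting a form\<close>

text \<open>A monomial with variables on both sides of \<open>a\<close> would show up in a mixed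
  second derivative, multiplied by two invertible exponents.\<close>

lemma split_form:
  fixes f :: "'k::field mpoly"
  assumes char: "CHAR('k) = 0 \<or> CHAR('k) > d" and f: "form d n f" and a: "a \<le> n"
    and mixed: "\<And>i j. i < a \<Longrightarrow> a \<le> j \<Longrightarrow> j < n \<Longrightarrow> partial_deriv i (partial_deriv j f) = 0"
  obtains g h where "form d a g" "form d (n - a) h" "f = g + shift a h"
proof -
  let ?G = "{m \<in> Poly_Mapping.keys f. Poly_Mapping.keys m \<subseteq> {..<a}}"
  let ?t = "\<lambda>m. Poly_Mapping.single m (Poly_Mapping.lookup f m)"
  define g where "g = (\<Sum>m\<in>?G. ?t m)"
  define r where "r = (\<Sum>m\<in>Poly_Mapping.keys f - ?G. ?t m)"
  have hom_single: "hom_in A d (?t m)" if "m \<in> Poly_Mapping.keys f" "Poly_Mapping.keys m \<subseteq> A" for A m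
    using f that by (auto simp: form_hom_in hom_in_def)
  have fgr: "f = g + r"
    unfolding g_def r_def
    using sum.subset_diff[of ?G "Poly_Mapping.keys f" ?t] mpoly_sum_single[of "Poly_Mapping.keys f" f]
    by (simp add: add.commute)
  have g: "form d a g"
    unfolding g_def form_hom_in by (intro hom_in_sum hom_single) auto
  have "Poly_Mapping.keys m \<subseteq> {a..<n}" if m: "m \<in> Poly_Mapping.keys f - ?G" for m
  proof
    fix i assume i: "i \<in> Poly_Mapping.keys m"
    have mn: "Poly_Mapping.keys m \<subseteq> {..<n}" "tdeg m = d" using f m by (auto simp: form_hom_in hom_in_def)
    obtain j where j: "j \<in> Poly_Mapping.keys m" "a \<le> j" using m by force
    have "\<not> i < a"
    proof
      assume ia: "i < a"
      then have ij: "i \<noteq> j" using j by simp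
      \<comment> \<open>At this monomial the mixed derivative has as coefficient that of
        \<open>m\<close> in \<open>f\<close> times the exponents of \<open>i\<close> and
        \<open>j\<close> in \<open>m\<close>, since \<open>i \<noteq> j\<close>.\<close>
      let ?k = "m - Poly_Mapping.single i 1 - Poly_Mapping.single j (1::nat)"
      have k: "?k + Poly_Mapping.single i 1 + Poly_Mapping.single j 1 = m"
        using i j ij by (intro poly_mapping_eqI) (auto simp: in_keys_iff lookup_add lookup_minus lookup_single when_def)
      have li: "Poly_Mapping.lookup ?k i + 1 = Poly_Mapping.lookup m i"
        using i ij by (simp add: lookup_minus lookup_single in_keys_iff)
      have lj: "Poly_Mapping.lookup (?k + Poly_Mapping.single i 1) j + 1 = Poly_Mapping.lookup m j"
        using j ij by (simp add: lookup_add lookup_minus lookup_single in_keys_iff)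
      have "of_nat (Poly_Mapping.lookup m i) * (of_nat (Poly_Mapping.lookup m j) * Poly_Mapping.lookup f m) = 0"
        using arg_cong[OF mixed[OF ia j(2)], of "\<lambda>p. Poly_Mapping.lookup p ?k"] j mn(1)
        unfolding lookup_partial_deriv li lj k by auto
      moreover have "of_nat (Poly_Mapping.lookup m l) \<noteq> (0::'k)" if "l \<in> Poly_Mapping.keys m" for l
        using that mn(2) lookup_le_tdeg[of m l] by (intro of_nat_neq_0_char[OF char]) (auto simp: in_keys_iff)
      ultimately show False using i j m by (auto simp: in_keys_iff)
    qed
    then show "i \<in> {a..<n}" using i mn by auto
  qed
  then have r: "hom_in {a..<n} d r"
    unfolding r_def by (intro hom_in_sum hom_single) auto
  with a have "hom_in {a..<a + (n - a)} d r" by simp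
  then obtain h where "form d (n - a) h" "shift a h = r" by (rule hom_in_shiftE)
  then show ?thesis using that g fgr by simp
qed

lemma direct_sum_formI:
  assumes "linear_change n P" "lin_subst P f = g + shift a h" "form d a g" "form d (n - a) h" "1 \<le> a" "a < n"
  shows "direct_sum_form d n f"
  unfolding direct_sum_form_def
  by (rule exI[of _ "[(a, g), (n - a, h)]"]) (use assms in \<open>auto simp: decomposition_def\<close>)

lemma direct_sum_form_splitting:
  fixes f :: "'k::field mpoly"
  assumes char: "CHAR('k) = 0 \<or> CHAR('k) > d" and f: "form d n f"
    and P: "linear_change n P" and a: "1 \<le> a" "a < n"
    and mixed: "\<And>i j. i < a \<Longrightarrow> a \<le> j \<Longrightarrow> j < n \<Longrightarrow> dderiv n (col P i) (dderiv n (col P j) f) = 0"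
  shows "direct_sum_form d n f"
proof -
  have cP: "P \<in> carrier_mat n n" using P by (simp add: linear_change_def)
  have 0: "partial_deriv i (partial_deriv j (lin_subst P f)) = 0" if ij: "i < a" "a \<le> j" "j < n" for i j
  proof -
    have "partial_deriv i (partial_deriv j (lin_subst P f)) =
        dderiv n (unit_vec n i) (dderiv n (unit_vec n j) (lin_subst P f))"
      using ij by (simp add: dderiv_unit_vec)
    also have "\<dots> = lin_subst P (dderiv n (col P i) (dderiv n (col P j) f))"
      using ij cP by (simp add: dderiv_lin_subst[OF f cP] dderiv_lin_subst[OF form_dderiv[OF f] cP] mult_mat_unit_vec)
    finally show ?thesis using mixed[OF ij] by simp
  qed
  obtain g h where "form d a g" "form d (n - a) h" "lin_subst P f = g + shift a h"
    using split_form[OF char form_lin_subst[OF f cP] less_imp_le[OF a(2)] 0] by blast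
  then show ?thesis by (intro direct_sum_formI[OF P _ _ _ a])
qed

section \<open>Reduced centers and Fitting's lemma\<close>

text \<open>Excluding square-zero elements already excludes all nilpotents. The condition speaks of
  matrices, so it makes sense before the center is known to be a ring.\<close>

definition reduced_center :: "nat \<Rightarrow> 'k::field mpoly \<Rightarrow> bool" where
  "reduced_center n f \<longleftrightarrow> (\<forall>N. in_center n f N \<longrightarrow> N * N = 0\<^sub>m n n \<longrightarrow> N = 0\<^sub>m n n)"

text \<open>For \<open>k \<ge> 2\<close> the double of \<open>k - 1\<close> is at least
  \<open>k\<close>, so \<open>A ^\<^sub>m (k - 1)\<close> squares to 0 and the exponent drops by
  one. The case \<open>k = 0\<close> forces \<open>n = 0\<close>.\<close>

lemma reduced_center_pow:
  assumes red: "reduced_center n f" and A: "in_center n f A" and "A ^\<^sub>m k = 0\<^sub>m n n"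
  shows "A = 0\<^sub>m n n"
  using assms(3)
proof (induction k rule: less_induct)
  case (less k)
  note cA = in_center_carrier[OF A]
  consider "k = 0" | "k = 1" | "k \<ge> 2" by linarith
  then show ?case
  proof cases
    case 1
    then have "(1\<^sub>m n :: 'a mat) = 0\<^sub>m n n" using less.prems cA by simp
    then have "A = 0\<^sub>m n n * A" using cA by (metis left_mult_one_mat)
    then show ?thesis using cA by (metis left_mult_zero_mat)
  next
    case 2
    then show ?thesis using less.prems cA by simp
  next
    case 3
    have "(k - 1) + (k - 1) = k + (k - 2)" using 3 by simp
    then have "A ^\<^sub>m (k - 1) * A ^\<^sub>m (k - 1) = A ^\<^sub>m (k + (k - 2))"
      by (simp only: pow_mat_add[OF cA, symmetric])
    also have "\<dots> = 0\<^sub>m n n" unfolding pow_mat_add[OF cA] less.prems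
      using cA by (simp add: left_mult_zero_mat[of _ n n])
    finally have "A ^\<^sub>m (k - 1) = 0\<^sub>m n n"
      using red in_center_pow[OF A] by (simp add: reduced_center_def)
    then show ?thesis using less.IH[of "k - 1"] 3 by simp
  qed
qed

text \<open>Algebraic closedness enters here: the characteristic polynomial has degree
  \<open>n \<ge> 1\<close> and hence a root.\<close>

lemma exists_eigenvector:
  fixes A :: "'k::alg_closed_field mat"
  assumes A: "A \<in> carrier_mat n n" and n: "n \<ge> 1"
  obtains c v where "v \<in> carrier_vec n" "v \<noteq> 0\<^sub>v n" "A *\<^sub>v v = c \<cdot>\<^sub>v v"
proof -
  have "degree (char_poly A) > 0" using degree_monic_char_poly[OF A] n by simp
  then obtain c where "poly (char_poly A) c = 0" using alg_closed_imp_poly_has_root by blast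
  then have "eigenvalue A c" using eigenvalue_root_char_poly[OF A] by simp
  then show ?thesis using that A by (auto simp: eigenvalue_def eigenvector_def)
qed

text \<open>Fitting's lemma: if \<open>Y\<close> in the center is singular, then a high power \<open>Y\<^sup>m\<close> splits the
  variables into image and kernel, and \<open>D\<^sub>u D\<^sub>v f = 0\<close> for \<open>u = Y\<^sup>m w\<close> and \<open>Y\<^sup>m v = 0\<close>.\<close>

lemma indecomposable_center_scalar:
  fixes f :: "'k::alg_closed_field mpoly"
  assumes char: "CHAR('k) = 0 \<or> CHAR('k) > d" and f: "form d n f" and n: "n \<ge> 1"
    and indec: "\<not> direct_sum_form d n f" and red: "reduced_center n f" and Z: "in_center n f Z"
  obtains c where "Z = c \<cdot>\<^sub>m 1\<^sub>m n"
proof -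
  note cZ = in_center_carrier[OF Z]
  obtain c v where v: "v \<in> carrier_vec n" "v \<noteq> 0\<^sub>v n" "Z *\<^sub>v v = c \<cdot>\<^sub>v v"
    by (rule exists_eigenvector[OF cZ n])
  define Y where "Y = Z + (- c) \<cdot>\<^sub>m 1\<^sub>m n"
  have Y: "in_center n f Y"
    unfolding Y_def by (intro in_center_add Z in_center_smult in_center_one)
  note cY = in_center_carrier[OF Y]
  have Yv: "Y *\<^sub>v v = 0\<^sub>v n"
    using v cZ by (auto simp: Y_def add_mult_distrib_mat_vec[of _ n n] smult_mat_mult_vec[of _ n n])
  obtain m where m: "m \<ge> 1"
    "\<And>v. v \<in> carrier_vec n \<Longrightarrow> Y ^\<^sub>m m *\<^sub>v (Y ^\<^sub>m m *\<^sub>v v) = 0\<^sub>v n \<Longrightarrow> Y ^\<^sub>m m *\<^sub>v v = 0\<^sub>v n"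
    using kernel_power_stable[OF cY] by blast
  \<comment> \<open>\<open>T\<close> has the same kernel as its square, and \<open>m \<ge> 1\<close>
    keeps the eigenvector \<open>v\<close> in that kernel.\<close>
  define T where "T = Y ^\<^sub>m m"
  have T: "in_center n f T" unfolding T_def by (rule in_center_pow[OF Y])
  note cT = in_center_carrier[OF T]
  have "T = Y ^\<^sub>m (m - 1) * Y" using m(1) by (cases m) (auto simp: T_def)
  then have Tv: "T *\<^sub>v v = 0\<^sub>v n"
    using cY v(1) Yv by (simp add: assoc_mult_mat_vec[of _ n n _ n] mult_mat_zero_vec[of _ n n])
  obtain P a where P: "linear_change n P" and a: "a \<le> n"
    and im: "\<And>j. j < a \<Longrightarrow> \<exists>w\<in>carrier_vec n. col P j = T *\<^sub>v w"
    and ker: "\<And>j. a \<le> j \<Longrightarrow> j < n \<Longrightarrow> T *\<^sub>v col P j = 0\<^sub>v n"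
    using image_kernel_splitting[OF cT m(2)[folded T_def]] by blast
  obtain Q where PQ: "P \<in> carrier_mat n n" "Q \<in> carrier_mat n n" "P * Q = 1\<^sub>m n"
    by (rule linear_changeE[OF P])
  \<comment> \<open>If the image of \<open>T\<close> were everything, then \<open>v\<close> would be
    \<open>T x\<close> with \<open>T (T x) = 0\<close>, hence \<open>v = T x = 0\<close>. The matrix
    \<open>M\<close> of preimages of the columns of \<open>P\<close> provides
    \<open>x\<close>.\<close>
  have "a < n"
  proof (rule ccontr)
    assume "\<not> a < n"
    then have "\<forall>j<n. \<exists>w\<in>carrier_vec n. col P j = T *\<^sub>v w" using im a by simp
    then obtain w where w: "\<And>j. j < n \<Longrightarrow> w j \<in> carrier_vec n \<and> col P j = T *\<^sub>v w j" by metis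
    define M where "M = mat n n (\<lambda>(i, j). w j $ i)"
    have cM: "M \<in> carrier_mat n n" by (simp add: M_def)
    have colM: "col M j = w j" if "j < n" for j using w[OF that] that by (intro eq_vecI) (auto simp: M_def)
    have "P = T * M"
    proof (rule mat_col_eqI)
      fix j assume "j < dim_col (T * M)"
      then have j: "j < n" using cM by simp
      then show "col P j = col (T * M) j" using w[OF j] colM[OF j] col_mult2[OF cT cM j] by metis
    qed (use PQ cT cM in auto)
    then have "v = T *\<^sub>v (M *\<^sub>v (Q *\<^sub>v v))"
      using PQ v(1) cT cM assoc_mult_mat_vec[of P n n Q n v]
      by (simp add: assoc_mult_mat_vec[of _ n n _ n])
    moreover have "M *\<^sub>v (Q *\<^sub>v v) \<in> carrier_vec n" using cM PQ v by auto
    ultimately show False using m(2)[folded T_def, of "M *\<^sub>v (Q *\<^sub>v v)"] Tv v(2) by simp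
  qed
  have "a < 1"
  proof (rule ccontr)
    assume "\<not> a < 1"
    have "dderiv n (col P i) (dderiv n (col P j) f) = 0" if ij: "i < a" "a \<le> j" "j < n" for i j
    proof -
      obtain w where "w \<in> carrier_vec n" "col P i = T *\<^sub>v w" using im[OF ij(1)] by blast
      then show ?thesis using in_centerD[OF T, of w "col P j"] ker[OF ij(2,3)] PQ ij by simp
    qed
    then have "direct_sum_form d n f"
      using \<open>\<not> a < 1\<close> \<open>a < n\<close> by (intro direct_sum_form_splitting[OF char f P]) auto
    with indec show False by simp
  qed
  \<comment> \<open>With \<open>a = 0\<close> every column of \<open>P\<close> lies in the kernel.
    Thus \<open>T = 0\<close>, and the nilpotent \<open>Y\<close> vanishes because the center is
    reduced.\<close>
  then have "col (T * P) j = 0\<^sub>v n" if "j < n" for j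
    using ker[of j] col_mult2[OF cT PQ(1) that] that by simp
  then have "T * P = 0\<^sub>m n n"
    using cT PQ by (intro mat_col_eqI) (auto simp del: col_mult2)
  then have "T * (P * Q) = 0\<^sub>m n n"
    using PQ(2) by (simp flip: assoc_mult_mat[OF cT PQ(1,2)])
  then have "T = 0\<^sub>m n n" using cT PQ by simp
  then have "Y = 0\<^sub>m n n" using reduced_center_pow[OF red Y] by (simp add: T_def)
  then have "Z $$ (i, j) + (- c) * (if i = j then 1 else 0) = 0" if "i < n" "j < n" for i j
    using that cZ unfolding Y_def mat_eq_iff by auto
  then have "Z = c \<cdot>\<^sub>m 1\<^sub>m n"
    using cZ by (intro eq_matI) (auto split: if_splits)
  then show ?thesis by (rule that)
qed

section \<open>Idempotent bases of the center\<close>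

abbreviation diag2 :: "nat \<Rightarrow> nat \<Rightarrow> 'a::zero mat \<Rightarrow> 'a mat \<Rightarrow> 'a mat" where
  "diag2 a b A D \<equiv> four_block_mat A (0\<^sub>m a b) (0\<^sub>m b a) D"

lemma diag2_mult:
  fixes A :: "'a::semiring_1 mat"
  assumes "A \<in> carrier_mat a a" "A' \<in> carrier_mat a a" "D \<in> carrier_mat b b" "D' \<in> carrier_mat b b"
  shows "diag2 a b A D * diag2 a b A' D' = diag2 a b (A * A') (D * D')"
  using assms by (subst mult_four_block_mat[of _ a a _ b _ b _ _ a _ b]) auto

lemma diag2_eq_iff:
  assumes "A \<in> carrier_mat a a" "A' \<in> carrier_mat a a" "D \<in> carrier_mat b b" "D' \<in> carrier_mat b b"
  shows "diag2 a b A D = diag2 a b A' D' \<longleftrightarrow> A = A' \<and> D = D'"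
proof
  assume eq: "diag2 a b A D = diag2 a b A' D'"
  have "A $$ (i, j) = A' $$ (i, j)" if "i < a" "j < a" for i j
    using arg_cong[OF eq, of "\<lambda>M. M $$ (i, j)"] assms that by simp
  moreover have "D $$ (i, j) = D' $$ (i, j)" if "i < b" "j < b" for i j
    using arg_cong[OF eq, of "\<lambda>M. M $$ (a + i, a + j)"] assms that by simp
  ultimately show "A = A' \<and> D = D'" using assms by (auto intro!: eq_matI)
qed simp

lemma diag2_zero: "diag2 a b (0\<^sub>m a a) (0\<^sub>m b b) = 0\<^sub>m (a + b) (a + b)"
  by (rule four_block_zero_mat)

text \<open>Nonzero orthogonal idempotents spanning the center; independence follows on multiplying
  by each of them. Spanning is stated by entries because matrices of all sizes share one type
  without a common zero, over which no sum can be formed.\<close>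

definition idempotent_basis :: "nat \<Rightarrow> 'k::field mpoly \<Rightarrow> nat \<Rightarrow> (nat \<Rightarrow> 'k mat) \<Rightarrow> bool" where
  "idempotent_basis n f t E \<longleftrightarrow>
    (\<forall>i<t. in_center n f (E i) \<and> E i \<noteq> 0\<^sub>m n n) \<and>
    (\<forall>i<t. \<forall>j<t. E i * E j = (if i = j then E i else 0\<^sub>m n n)) \<and>
    (\<forall>A. in_center n f A \<longrightarrow> (\<exists>c. \<forall>p<n. \<forall>q<n. A $$ (p, q) = (\<Sum>i<t. c i * E i $$ (p, q))))"

lemma idempotent_basisD:
  assumes "idempotent_basis n f t E"
  shows "i < t \<Longrightarrow> in_center n f (E i)" "i < t \<Longrightarrow> E i \<noteq> 0\<^sub>m n n"
    "i < t \<Longrightarrow> j < t \<Longrightarrow> E i * E j = (if i = j then E i else 0\<^sub>m n n)"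
    "in_center n f A \<Longrightarrow> \<exists>c. \<forall>p<n. \<forall>q<n. A $$ (p, q) = (\<Sum>i<t. c i * E i $$ (p, q))"
  using assms unfolding idempotent_basis_def by (fast, fast, meson, meson)

text \<open>A square-zero element for one block, padded with zeros, is one for the sum.\<close>

lemma reduced_center_block:
  fixes g h :: "'k::field mpoly"
  assumes g: "form d a g" and h: "form d b h" and red: "reduced_center (a + b) (g + shift a h)"
  shows "reduced_center a g" "reduced_center b h"
proof -
  have *: "N = 0\<^sub>m a a \<and> M = 0\<^sub>m b b"
    if N: "in_center a g N" "N * N = 0\<^sub>m a a" and M: "in_center b h M" "M * M = 0\<^sub>m b b" for N M
  proof -
    note cN = in_center_carrier[OF N(1)] and cM = in_center_carrier[OF M(1)]
    have "diag2 a b N M * diag2 a b N M = 0\<^sub>m (a + b) (a + b)"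
      by (simp add: diag2_mult[OF cN cN cM cM] N(2) M(2))
    then have "diag2 a b N M = diag2 a b (0\<^sub>m a a) (0\<^sub>m b b)"
      using red in_center_four_block[OF g h N(1) M(1)] by (simp add: reduced_center_def)
    then show ?thesis by (simp only: diag2_eq_iff[OF cN zero_carrier_mat cM zero_carrier_mat])
  qed
  show "reduced_center a g"
    unfolding reduced_center_def using *[OF _ _ in_center_zero] by simp
  show "reduced_center b h"
    unfolding reduced_center_def using *[OF in_center_zero] by simp
qed

lemma form_block_sum: "\<forall>(a, g)\<in>set fs. form d a g \<Longrightarrow> form d (\<Sum>(a, g)\<leftarrow>fs. a) (block_sum fs)"
proof (induction fs)
  case (Cons ag fs)
  then show ?case by (cases ag) (auto intro: form_block_sum2)
qed (simp add: form_def)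

text \<open>Induction on the blocks. Independence of the partials and reducedness pass to the first
  block and to the rest; the center is block diagonal and scalar on the first block, which therefore
  contributes exactly one idempotent, its projection.\<close>

lemma idempotent_basis_block_sum:
  fixes fs :: "(nat \<times> 'k::alg_closed_field mpoly) list"
  assumes char: "CHAR('k) = 0 \<or> CHAR('k) > d" and d: "d \<ge> 3"
    and "\<forall>(a, g)\<in>set fs. a \<ge> 1 \<and> form d a g \<and> \<not> direct_sum_form d a g"
    and "indep_partials (\<Sum>(a, g)\<leftarrow>fs. a) (block_sum fs)"
    and "reduced_center (\<Sum>(a, g)\<leftarrow>fs. a) (block_sum fs)"
  shows "\<exists>E. idempotent_basis (\<Sum>(a, g)\<leftarrow>fs. a) (block_sum fs) (length fs) E"
  using assms(3-)
proof (induction fs)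
  case Nil
  then show ?case by (simp add: idempotent_basis_def)
next
  case (Cons ag fs)
  obtain a g where ag: "ag = (a, g)" by fastforce
  define b h where "b = (\<Sum>(a, g)\<leftarrow>fs. a)" and "h = block_sum fs"
  define t where "t = length fs"
  have g: "form d a g" "a \<ge> 1" "\<not> direct_sum_form d a g" using Cons.prems(1) ag by auto
  have h: "form d b h" unfolding b_def h_def using Cons.prems(1) by (intro form_block_sum) auto
  have nd: "indep_partials (a + b) (g + shift a h)" and red: "reduced_center (a + b) (g + shift a h)"
    using Cons.prems(2,3) by (simp_all add: ag b_def h_def)
  note redg = reduced_center_block(1)[OF g(1) h red] and redh = reduced_center_block(2)[OF g(1) h red]
  have "\<exists>E. idempotent_basis b h t E"
    unfolding b_def h_def t_def
  proof (rule Cons.IH)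
    show "indep_partials (\<Sum>(a, g)\<leftarrow>fs. a) (block_sum fs)"
      using indep_partials_block(2)[OF g(1) h nd] by (simp add: b_def h_def)
  qed (use Cons.prems(1) redh in \<open>auto simp: b_def h_def\<close>)
  then obtain E where E': "idempotent_basis b h t E" by blast
  note E = idempotent_basisD[OF E']
  note cE = in_center_carrier[OF E(1)]
  define G where "G i = (case i of 0 \<Rightarrow> diag2 a b (1\<^sub>m a) (0\<^sub>m b b) | Suc i \<Rightarrow> diag2 a b (0\<^sub>m a a) (E i))" for i
  have G0: "G 0 = diag2 a b (1\<^sub>m a) (0\<^sub>m b b)" and GS: "G (Suc i) = diag2 a b (0\<^sub>m a a) (E i)" for i
    by (simp_all add: G_def)
  \<comment> \<open>Here \<open>a \<ge> 1\<close> matters: the projection onto an empty block would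
    be 0.\<close>
  have one_neq: "(1\<^sub>m a :: 'k mat) \<noteq> 0\<^sub>m a a"
  proof
    assume "(1\<^sub>m a :: 'k mat) = 0\<^sub>m a a"
    then have "(1\<^sub>m a :: 'k mat) $$ (0, 0) = 0\<^sub>m a a $$ (0, 0)" by simp
    then show False using g(2) by simp
  qed
  have "idempotent_basis (a + b) (g + shift a h) (Suc t) G"
    unfolding idempotent_basis_def
  proof (intro conjI allI impI)
    fix i assume i: "i < Suc t"
    show "in_center (a + b) (g + shift a h) (G i)"
      using i by (cases i) (auto simp: G0 GS intro!: in_center_four_block[OF g(1) h] in_center_one in_center_zero E(1))
    show "G i \<noteq> 0\<^sub>m (a + b) (a + b)"
    proof (cases i)
      case 0
      then show ?thesis
        unfolding diag2_zero[symmetric] 0 G0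
        using one_neq by (subst diag2_eq_iff) auto
    next
      case (Suc i')
      then show ?thesis
        unfolding diag2_zero[symmetric] Suc GS
        using E(2)[of i'] cE[of i'] i Suc by (subst diag2_eq_iff) auto
    qed
    fix j assume j: "j < Suc t"
    show "G i * G j = (if i = j then G i else 0\<^sub>m (a + b) (a + b))"
      using i j cE E(3)
      by (cases i; cases j) (auto simp: G0 GS diag2_mult[of _ a _ _ b] diag2_zero left_mult_zero_mat[of _ b b] right_mult_zero_mat[of _ b b])
  next
    fix Z assume Z: "in_center (a + b) (g + shift a h) Z"
    obtain A D where AD: "Z = diag2 a b A D" "in_center a g A" "in_center b h D"
      by (rule in_center_block_diag[OF char d g(1) h nd Z])
    obtain c0 where c0: "A = c0 \<cdot>\<^sub>m 1\<^sub>m a"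
      by (rule indecomposable_center_scalar[OF char g redg AD(2)])
    obtain c where c: "\<And>p q. p < b \<Longrightarrow> q < b \<Longrightarrow> D $$ (p, q) = (\<Sum>i<t. c i * E i $$ (p, q))"
      using E(4)[OF AD(3)] by blast
    note cD = in_center_carrier[OF AD(3)]
    define c' where "c' i = (case i of 0 \<Rightarrow> c0 | Suc i \<Rightarrow> c i)" for i
    have "Z $$ (p, q) = (\<Sum>i<Suc t. c' i * G i $$ (p, q))" if p: "p < a + b" and q: "q < a + b" for p q
    proof -
      have "(\<Sum>i<Suc t. c' i * G i $$ (p, q)) = c0 * G 0 $$ (p, q) + (\<Sum>i<t. c i * G (Suc i) $$ (p, q))"
        by (simp only: sum.lessThan_Suc_shift c'_def nat.case)
      also have "(\<Sum>i<t. c i * G (Suc i) $$ (p, q)) =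
          (\<Sum>i<t. c i * (if p < a \<or> q < a then 0 else E i $$ (p - a, q - a)))"
        using p q carrier_matD[OF cE] by (intro sum.cong) (simp_all add: GS)
      also have "\<dots> = (if p < a \<or> q < a then 0 else D $$ (p - a, q - a))"
        using c p q by auto
      finally show ?thesis using p q cD by (auto simp: AD(1) c0 G0)
    qed
    then show "\<exists>c. \<forall>p<a + b. \<forall>q<a + b. Z $$ (p, q) = (\<Sum>i<Suc t. c i * G i $$ (p, q))" by blast
  qed
  then show ?case by (auto simp: ag b_def h_def t_def)
qed


section \<open>Invariance under linear changes of variables\<close>

lemma conj_mult:
  fixes P Q A B :: "'a::semiring_1 mat"
  assumes "P \<in> carrier_mat n n" "Q \<in> carrier_mat n n" "Q * P = 1\<^sub>m n" "A \<in> carrier_mat n n" "B \<in> carrier_mat n n"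
  shows "(P * A * Q) * (P * B * Q) = P * (A * B) * Q"
proof -
  have "(P * A * Q) * (P * B * Q) = P * A * ((Q * P) * (B * Q))"
    using assms(1,2,4,5) by (simp add: assoc_mult_mat[of _ n n _ n _ n])
  then show ?thesis using assms by (simp add: assoc_mult_mat[of _ n n _ n _ n])
qed

lemma conj_conj:
  fixes P Q A :: "'a::semiring_1 mat"
  assumes "P \<in> carrier_mat n n" "Q \<in> carrier_mat n n" "P * Q = 1\<^sub>m n" "A \<in> carrier_mat n n"
  shows "P * (Q * A * P) * Q = A"
proof -
  have "P * (Q * A * P) * Q = (P * Q) * (A * (P * Q))"
    using assms(1,2,4) by (simp add: assoc_mult_mat[of _ n n _ n _ n])
  then show ?thesis using assms by simp
qed

lemma in_center_conj:
  fixes f :: "'k::field mpoly"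
  assumes f: "form d n f" and P: "P \<in> carrier_mat n n" and Q: "Q \<in> carrier_mat n n"
    and PQ: "P * Q = 1\<^sub>m n" and A: "in_center n f A"
  shows "in_center n (lin_subst P f) (Q * A * P)"
proof (rule in_center_lin_subst[OF f P A])
  note cA = in_center_carrier[OF A]
  show "Q * A * P \<in> carrier_mat n n" using P Q cA by simp
  have "P * (Q * A * P) = (P * Q) * (A * P)"
    using P Q cA by (simp add: assoc_mult_mat[of _ n n _ n _ n])
  then show "A * P = P * (Q * A * P)" using PQ P cA by simp
qed

lemma conj_eq_0_iff:
  fixes P Q A :: "'a::semiring_1 mat"
  assumes "P \<in> carrier_mat n n" "Q \<in> carrier_mat n n" "P * Q = 1\<^sub>m n" "A \<in> carrier_mat n n"
  shows "Q * A * P = 0\<^sub>m n n \<longleftrightarrow> A = 0\<^sub>m n n"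
proof
  assume "Q * A * P = 0\<^sub>m n n"
  then have "P * 0\<^sub>m n n * Q = A" using conj_conj[OF assms] by simp
  then show "A = 0\<^sub>m n n" using assms by simp
qed (use assms in simp)

lemma reduced_center_lin_subst:
  fixes f :: "'k::field mpoly"
  assumes f: "form d n f" and P: "linear_change n P"
  shows "reduced_center n (lin_subst P f) \<longleftrightarrow> reduced_center n f"
proof -
  \<comment> \<open>The passage from the new coordinates to the old ones, for all forms and matrices
    at once; the converse is the same passage for \<open>Q\<close> and the form
    \<open>lin_subst P f\<close>.\<close>
  have *: "reduced_center n f" if f: "form d n f" and P: "linear_change n P"
    and red: "reduced_center n (lin_subst P f)" for f :: "'k mpoly" and P
    unfolding reduced_center_def
  proof (intro allI impI)
    obtain Q where Q: "P \<in> carrier_mat n n" "Q \<in> carrier_mat n n" "P * Q = 1\<^sub>m n" by (rule linear_changeE[OF P])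
    fix N assume N: "in_center n f N" "N * N = 0\<^sub>m n n"
    note cN = in_center_carrier[OF N(1)]
    have "(Q * N * P) * (Q * N * P) = 0\<^sub>m n n"
      unfolding conj_mult[OF Q(2,1,3) cN cN] N(2) using Q by simp
    then have "Q * N * P = 0\<^sub>m n n"
      using red in_center_conj[OF f Q N(1)] by (simp add: reduced_center_def)
    then show "N = 0\<^sub>m n n" using conj_eq_0_iff[OF Q cN] by simp
  qed
  obtain Q where Q: "P \<in> carrier_mat n n" "Q \<in> carrier_mat n n" "P * Q = 1\<^sub>m n" "linear_change n Q"
    by (rule linear_changeE[OF P])
  have "lin_subst Q (lin_subst P f) = f"
    using lin_subst_mult[OF f Q(1,2)] lin_subst_one[OF f] Q(3) by simp
  then show ?thesis using *[OF f P] *[OF form_lin_subst[OF f Q(1)] Q(4)] by auto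
qed

lemma idempotent_basis_lin_subst:
  fixes f :: "'k::field mpoly"
  assumes f: "form d n f" and P: "linear_change n P" and E: "idempotent_basis n (lin_subst P f) t E"
  shows "\<exists>E'. idempotent_basis n f t E'"
proof -
  obtain Q where Q: "P \<in> carrier_mat n n" "Q \<in> carrier_mat n n" "P * Q = 1\<^sub>m n" "Q * P = 1\<^sub>m n"
    by (rule linear_changeE[OF P])
  let ?F = "lin_subst P f"
  have F: "form d n ?F" by (rule form_lin_subst[OF f Q(1)])
  have QF: "lin_subst Q ?F = f"
    using lin_subst_mult[OF f Q(1,2)] lin_subst_one[OF f] Q(3) by simp
  note E' = idempotent_basisD[OF E]
  note cE = in_center_carrier[OF E'(1)]
  \<comment> \<open>As a double sum over the entries of \<open>M\<close>, conjugation visibly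
    commutes with the entrywise linear combinations in \<open>idempotent_basis\<close>.\<close>
  have entry: "(P * M * Q) $$ (p, q) = (\<Sum>r<n. \<Sum>s<n. P $$ (p, r) * M $$ (r, s) * Q $$ (s, q))"
    if "M \<in> carrier_mat n n" "p < n" "q < n" for M p q
    using that Q(1,2) by (simp add: scalar_prod_def lessThan_atLeast0 sum_distrib_left mult.assoc)
  have "idempotent_basis n f t (\<lambda>i. P * E i * Q)"
    unfolding idempotent_basis_def
  proof (intro conjI allI impI)
    fix i assume i: "i < t"
    show "in_center n f (P * E i * Q)"
      using in_center_conj[OF F Q(2,1,4) E'(1)[OF i]] by (simp add: QF)
    show "P * E i * Q \<noteq> 0\<^sub>m n n"
      using conj_eq_0_iff[OF Q(2,1,4) cE[OF i]] E'(2)[OF i] by simp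
    fix j assume j: "j < t"
    show "(P * E i * Q) * (P * E j * Q) = (if i = j then P * E i * Q else 0\<^sub>m n n)"
      unfolding conj_mult[OF Q(1,2,4) cE[OF i] cE[OF j]] E'(3)[OF i j] using Q by simp
  next
    fix A assume A: "in_center n f A"
    note cA = in_center_carrier[OF A]
    let ?B = "Q * A * P"
    have cB: "?B \<in> carrier_mat n n" using Q cA by simp
    obtain c where c: "\<And>p q. p < n \<Longrightarrow> q < n \<Longrightarrow> ?B $$ (p, q) = (\<Sum>i<t. c i * E i $$ (p, q))"
      using E'(4)[OF in_center_conj[OF f Q(1-3) A]] by blast
    have "A $$ (p, q) = (\<Sum>i<t. c i * (P * E i * Q) $$ (p, q))" if pq: "p < n" "q < n" for p q
    proof -
      have "A $$ (p, q) = (\<Sum>r<n. \<Sum>s<n. P $$ (p, r) * ?B $$ (r, s) * Q $$ (s, q))"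
        using entry[OF cB pq] by (simp only: conj_conj[OF Q(1-3) cA])
      also have "\<dots> = (\<Sum>r<n. \<Sum>s<n. \<Sum>i<t. c i * (P $$ (p, r) * E i $$ (r, s) * Q $$ (s, q)))"
        by (intro sum.cong refl) (simp add: c sum_distrib_left sum_distrib_right mult_ac del: index_mult_mat)
      also have "\<dots> = (\<Sum>r<n. \<Sum>i<t. \<Sum>s<n. c i * (P $$ (p, r) * E i $$ (r, s) * Q $$ (s, q)))"
        by (rule sum.cong[OF refl], rule sum.swap)
      also have "\<dots> = (\<Sum>i<t. \<Sum>r<n. \<Sum>s<n. c i * (P $$ (p, r) * E i $$ (r, s) * Q $$ (s, q)))"
        by (rule sum.swap)
      also have "\<dots> = (\<Sum>i<t. c i * (P * E i * Q) $$ (p, q))"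
        by (intro sum.cong refl) (simp add: entry[OF cE pq] sum_distrib_left del: index_mult_mat)
      finally show ?thesis .
    qed
    then show "\<exists>c. \<forall>p<n. \<forall>q<n. A $$ (p, q) = (\<Sum>i<t. c i * (P * E i * Q) $$ (p, q))" by blast
  qed
  then show ?thesis by blast
qed


section \<open>Existence of indecomposable decompositions\<close>

lemma block_sum_append:
  "block_sum (fs @ gs) = block_sum fs + shift (\<Sum>(a, g)\<leftarrow>fs. a) (block_sum gs)"
  by (induction fs) (auto simp: shift_add shift_shift add.assoc)

lemma lin_subst_diag2:
  fixes g h :: "'k::field mpoly"
  assumes g: "form d a g" and h: "form d b h" and P: "P \<in> carrier_mat a a" and Q: "Q \<in> carrier_mat b b"
  shows "lin_subst (diag2 a b P Q) (g + shift a h) = lin_subst P g + shift a (lin_subst Q h)"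
proof -
  have "lin_form (diag2 a b P Q) i = lin_form P i" if "i < a" for i
    using that P Q by (simp add: lin_form_def sum_lessThan_add)
  then have 1: "subst (lin_form (diag2 a b P Q)) g = subst (lin_form P) g"
    by (intro subst_cong[OF hom_in_vars_in[OF g[unfolded form_hom_in]]]) auto
  have "lin_form (diag2 a b P Q) (a + i) = shift a (lin_form Q i)" if "i < b" for i
    using that P Q by (simp add: lin_form_def sum_lessThan_add shift_def subst_sum subst_mult)
  then have 2: "subst (\<lambda>i. lin_form (diag2 a b P Q) (a + i)) h = subst (\<lambda>i. shift a (lin_form Q i)) h"
    by (intro subst_cong[OF hom_in_vars_in[OF h[unfolded form_hom_in]]]) auto
  show ?thesis
    unfolding lin_subst_def' subst_add 1 using 2 by (simp add: shift_def subst_subst)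
qed

lemma linear_change_diag2:
  fixes P Q :: "'k::field mat"
  assumes "linear_change a P" "linear_change b Q"
  shows "linear_change (a + b) (diag2 a b P Q)"
proof -
  obtain P' where P': "P \<in> carrier_mat a a" "P' \<in> carrier_mat a a" "P * P' = 1\<^sub>m a"
    by (rule linear_changeE[OF assms(1)])
  obtain Q' where Q': "Q \<in> carrier_mat b b" "Q' \<in> carrier_mat b b" "Q * Q' = 1\<^sub>m b"
    by (rule linear_changeE[OF assms(2)])
  show ?thesis
    using P' Q' by (intro linear_changeI[of _ _ "diag2 a b P' Q'"]) (auto simp: diag2_mult[of _ a _ _ b])
qed

text \<open>Grouping all summands but the first yields a binary splitting, as needed for an
  induction.\<close>

lemma direct_sum_formE:
  assumes "direct_sum_form d n f"
  obtains a b g h P where "a \<ge> 1" "b \<ge> 1" "n = a + b" "form d a g" "form d b h"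
    "linear_change n P" "lin_subst P f = g + shift a h"
proof -
  obtain fs P where fs: "length fs \<ge> 2" "\<forall>(a, g)\<in>set fs. a \<ge> 1 \<and> form d a g" "(\<Sum>(a, g)\<leftarrow>fs. a) = n"
      and P: "linear_change n P" "lin_subst P f = block_sum fs"
    using assms by (auto simp: direct_sum_form_def decomposition_def)
  obtain a g a' g' fs' where fs': "fs = (a, g) # (a', g') # fs'"
    using fs(1) by (cases fs rule: list.exhaust; cases "tl fs" rule: list.exhaust) auto
  let ?b = "\<Sum>(a, g)\<leftarrow>(a', g') # fs'. a"
  have "form d ?b (block_sum ((a', g') # fs'))" using fs(2) fs' by (intro form_block_sum) auto
  then show ?thesis
    using fs P by (intro that[of a ?b g "block_sum ((a', g') # fs')" P]) (auto simp: fs')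
qed

text \<open>Both parts of a splitting have fewer variables, so splitting repeatedly must end. The
  changes of variables of the parts combine to a block diagonal one.\<close>

lemma indecomposable_decomposition_exists:
  fixes f :: "'k::field mpoly"
  assumes "form d n f" "n \<ge> 1"
  shows "\<exists>fs. indecomposable_decomposition d n f fs"
  using assms
proof (induction n arbitrary: f rule: less_induct)
  case (less n)
  show ?case
  proof (cases "direct_sum_form d n f")
    case False
    have "linear_change n (1\<^sub>m n :: 'k mat) \<and> lin_subst (1\<^sub>m n) f = f"
      using linear_change_one lin_subst_one less.prems by blast
    then have "indecomposable_decomposition d n f [(n, f)]"
      using less.prems False by (auto simp: indecomposable_decomposition_def decomposition_def)
    then show ?thesis by blast
  next
    case True
    obtain a b g h P where ab: "a \<ge> 1" "b \<ge> 1" "n = a + b" and g: "form d a g" and h: "form d b h"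
      and P: "linear_change n P" "lin_subst P f = g + shift a h"
      by (rule direct_sum_formE[OF True])
    obtain fs where fs: "indecomposable_decomposition d a g fs" using less.IH[OF _ g] ab by auto
    obtain gs where gs: "indecomposable_decomposition d b h gs" using less.IH[OF _ h] ab by auto
    obtain Q where Q: "linear_change a Q" "lin_subst Q g = block_sum fs"
      using fs by (auto simp: indecomposable_decomposition_def decomposition_def)
    obtain R where R: "linear_change b R" "lin_subst R h = block_sum gs"
      using gs by (auto simp: indecomposable_decomposition_def decomposition_def)
    have suma: "(\<Sum>(a, g)\<leftarrow>fs. a) = a" and sumb: "(\<Sum>(a, g)\<leftarrow>gs. a) = b"
      using fs gs by (auto simp: indecomposable_decomposition_def decomposition_def)
    let ?D = "diag2 a b Q R"
    have D: "linear_change n ?D" using linear_change_diag2[OF Q(1) R(1)] ab by simp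
    have "lin_subst (P * ?D) f = lin_subst ?D (lin_subst P f)"
      using lin_subst_mult[OF less.prems(1), of P n ?D n] P(1) D by (simp add: linear_change_def)
    also have "\<dots> = block_sum (fs @ gs)"
      using lin_subst_diag2[OF g h, of Q R] Q R by (simp add: P(2) linear_change_def block_sum_append suma)
    finally have "linear_change n (P * ?D) \<and> lin_subst (P * ?D) f = block_sum (fs @ gs)"
      using linear_change_mult[OF P(1) D] by simp
    then have "indecomposable_decomposition d n f (fs @ gs)"
      using fs gs suma sumb ab(3) by (auto simp: indecomposable_decomposition_def decomposition_def)
    then show ?thesis by blast
  qed
qed

section \<open>Limits of direct sums and nilpotents in the center\<close>

lemma partial_deriv_sum_X_mult:
  assumes "k < l" "\<And>i. i < l \<Longrightarrow> partial_deriv k (p i) = 0"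
  shows "partial_deriv k (\<Sum>i<l. X i * p i) = p k"
proof -
  have "partial_deriv k (\<Sum>i<l. X i * p i) = (\<Sum>i<l. if i = k then p i else 0)"
    unfolding partial_deriv_sum
    by (intro sum.cong) (auto simp: partial_deriv_mult partial_deriv_X assms(2))
  then show ?thesis using assms(1) by simp
qed

text \<open>For every \<open>j\<close>, the derivative of \<open>F\<close> along column
  \<open>j\<close> of \<open>N\<close> is the \<open>j\<close>-th partial derivative of
  \<open>shift l h\<close>. The Hessian of \<open>F\<close> times \<open>N\<close> is thus the
  Hessian of \<open>shift l h\<close>, which is symmetric.\<close>

lemma LDS_form_not_reduced:
  fixes f :: "'k::field mpoly"
  assumes f: "form d n f" and LDS: "LDS_form d n f"
  shows "\<not> reduced_center n f"
proof -
  obtain l h g P where l: "1 \<le> l" "2 * l \<le> n" and h: "form d l h" and g: "form d (n - l) g"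
    and P: "linear_change n P"
    and F: "lin_subst P f = (\<Sum>i<l. X i * partial_deriv (l + i) (shift l h)) + shift l g"
    using LDS by (auto simp: LDS_form_def)
  define F where "F = lin_subst P f"
  note sh = hom_in_shift[OF h, of l]
  define N :: "'k mat" where "N = mat n n (\<lambda>(i, j). if l \<le> j \<and> j < 2 * l \<and> i = j - l then 1 else 0)"
  have cN: "N \<in> carrier_mat n n" by (simp add: N_def)
  have dF: "partial_deriv k F = partial_deriv (l + k) (shift l h)" if k: "k < l" for k
  proof -
    have "partial_deriv k (partial_deriv (l + i) (shift l h)) = 0" for i
      using hom_in_vars_in[OF hom_in_partial_deriv[OF sh]] k by (intro partial_deriv_eq_0) auto
    then show ?thesis
      using k by (simp add: F_def F partial_deriv_add partial_deriv_sum_X_mult partial_deriv_shift_0[OF g])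
  qed
  have ddN: "dderiv n (col N j) F = partial_deriv j (shift l h)" if j: "j < n" for j
  proof (cases "l \<le> j \<and> j < 2 * l")
    case True
    then have "col N j = unit_vec n (j - l)" using j by (intro eq_vecI) (auto simp: N_def)
    moreover have "j - l < l" using True by auto
    ultimately show ?thesis using True j dF[of "j - l"] by (simp add: dderiv_unit_vec)
  next
    case False
    then have "col N j = 0\<^sub>v n" using j by (intro eq_vecI) (auto simp: N_def)
    moreover have "partial_deriv j (shift l h) = 0"
      using hom_in_vars_in[OF sh] False by (intro partial_deriv_eq_0) auto
    ultimately show ?thesis by simp
  qed
  have "in_center n F N"
    unfolding in_center_entries[OF cN] by (simp add: ddN partial_deriv_commute)
  moreover have "N * N = 0\<^sub>m n n"
  proof (rule eq_matI)
    fix i j assume "i < dim_row (0\<^sub>m n n :: 'k mat)" "j < dim_col (0\<^sub>m n n :: 'k mat)"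
    then show "(N * N) $$ (i, j) = 0\<^sub>m n n $$ (i, j)"
      by (auto simp: N_def scalar_prod_def intro!: sum.neutral)
  qed (auto simp: N_def)
  moreover have "N \<noteq> 0\<^sub>m n n"
  proof
    assume "N = 0\<^sub>m n n"
    then have "N $$ (0, l) = 0\<^sub>m n n $$ (0, l)" by simp
    then show False using l by (simp add: N_def)
  qed
  ultimately have "\<not> reduced_center n F" by (auto simp: reduced_center_def)
  then show ?thesis using reduced_center_lin_subst[OF f P] by (simp add: F_def)
qed

text \<open>In coordinates adapted to a square-zero \<open>N\<close>, the derivatives \<open>p\<^sub>i\<close> of \<open>f\<close> in the image
  directions only involve the \<open>l\<close> preimage variables and form a closed system, which the Euler
  formula integrates to \<open>h = (1/d) (\<Sum> x\<^bsub>l+i\<^esub> p\<^sub>i)\<close>.\<close>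

lemma not_reduced_LDS_form:
  fixes f :: "'k::field mpoly"
  assumes char: "CHAR('k) = 0 \<or> CHAR('k) > d" and d: "d \<ge> 1"
    and f: "form d n f" and red: "\<not> reduced_center n f"
  shows "LDS_form d n f"
proof -
  obtain N where N: "in_center n f N" "N * N = 0\<^sub>m n n" "N \<noteq> 0\<^sub>m n n"
    using red by (auto simp: reduced_center_def)
  note cN = in_center_carrier[OF N(1)]
  obtain P l where P: "linear_change n P" and l: "2 * l \<le> n"
    and NP: "\<And>j. j < n \<Longrightarrow> N *\<^sub>v col P j = (if l \<le> j \<and> j < 2 * l then col P (j - l) else 0\<^sub>v n)"
    using square_zero_basis[OF cN N(2)] by blast
  obtain Q where PQ: "P \<in> carrier_mat n n" "Q \<in> carrier_mat n n" "P * Q = 1\<^sub>m n"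
    by (rule linear_changeE[OF P])
  have l1: "1 \<le> l"
  proof (rule ccontr)
    assume "\<not> 1 \<le> l"
    then have "col (N * P) j = 0\<^sub>v n" if "j < n" for j
      using NP[of j] col_mult2[OF cN PQ(1) that] that by simp
    then have "N * P = 0\<^sub>m n n"
      using cN PQ by (intro mat_col_eqI) (auto simp del: col_mult2)
    then have "N * (P * Q) = 0\<^sub>m n n"
      using PQ(2) by (simp flip: assoc_mult_mat[OF cN PQ(1,2)])
    with N(3) cN PQ show False by simp
  qed
  define F where "F = lin_subst P f"
  have F: "form d n F" unfolding F_def by (rule form_lin_subst[OF f PQ(1)])
  have dd: "partial_deriv i (partial_deriv j F) = lin_subst P (dderiv n (col P i) (dderiv n (col P j) f))"
    if "i < n" "j < n" for i j
  proof -
    have "partial_deriv i (partial_deriv j F) = dderiv n (unit_vec n i) (dderiv n (unit_vec n j) F)"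
      using that by (simp add: dderiv_unit_vec)
    then show ?thesis
      using that PQ(1) by (simp add: F_def dderiv_lin_subst[OF f PQ(1)]
        dderiv_lin_subst[OF form_dderiv[OF f] PQ(1)] mult_mat_unit_vec)
  qed
  \<comment> \<open>For \<open>i < l\<close>, column \<open>i\<close> of \<open>P\<close> is
    \<open>N\<close> applied to column \<open>l + i\<close>. The center relation moves
    \<open>N\<close> to column \<open>j\<close>, where it lowers the index by \<open>l\<close> or
    gives 0.\<close>
  have move: "partial_deriv i (partial_deriv j F) =
      (if l \<le> j \<and> j < 2 * l then partial_deriv (l + i) (partial_deriv (j - l) F) else 0)"
    if i: "i < l" and j: "j < n" for i j
  proof -
    have il: "i < n" "l + i < n" using i l by auto
    have "col P i = N *\<^sub>v col P (l + i)" using NP[OF il(2)] i by simp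
    then have "dderiv n (col P i) (dderiv n (col P j) f) = dderiv n (col P (l + i)) (dderiv n (N *\<^sub>v col P j) f)"
      using in_centerD[OF N(1), of "col P (l + i)" "col P j"] PQ(1) il j by simp
    then show ?thesis using NP[OF j] il j by (auto simp: dd)
  qed
  define p where "p i = partial_deriv i F" for i
  have p: "hom_in {l..<2 * l} (d - 1) (p i)" if i: "i < l" for i
  proof -
    \<comment> \<open>By \<open>move\<close>, the derivative of \<open>p i\<close> by a variable
      outside the preimage block is 0, and variables with vanishing derivative can be
      removed.\<close>
    have "hom_in ({..<n} - ({..<l} \<union> {2 * l..<n})) (d - 1) (p i)"
    proof (rule hom_in_remove_vars)
      show "CHAR('k) = 0 \<or> d - 1 < CHAR('k)" using char by auto
      show "hom_in {..<n} (d - 1) (p i)"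
        using F unfolding p_def form_hom_in by (rule hom_in_partial_deriv)
      fix j assume "j \<in> {..<l} \<union> {2 * l..<n}"
      then show "partial_deriv j (p i) = 0"
        using move[OF i, of j] l by (auto simp: p_def partial_deriv_commute[of j i])
    qed auto
    then show ?thesis by (rule hom_in_mono) auto
  qed
  have closed: "partial_deriv (l + j) (p i) = partial_deriv (l + i) (p j)" if "i < l" "j < l" for i j
    using move[OF that(1), of "l + j"] that l by (simp add: p_def partial_deriv_commute[of "l + j" i])
  have lin: "partial_deriv k (p i) = 0" if "i < l" "k < l" for i k
    using hom_in_vars_in[OF p[OF that(1)]] that(2) by (intro partial_deriv_eq_0) auto
  define h0 where "h0 = C (1 / of_nat d) * (\<Sum>i<l. X (l + i) * p i)"
  have dd1: "1 + (d - 1) = d" using d by simp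
  have "hom_in {l..<l + l} d (X (l + i) * p i)" if "i < l" for i
    using hom_in_mult[OF hom_in_X[of "l + i" "{l..<l + l}"], of "d - 1" "p i"] p[OF that] that
    unfolding dd1 by (simp add: mult_2)
  then have "hom_in {l..<l + l} d h0"
    unfolding h0_def by (intro hom_in_C_mult hom_in_sum) auto
  then obtain h where h: "form d l h" "shift l h = h0" by (rule hom_in_shiftE)
  \<comment> \<open>By \<open>closed\<close>, all derivatives fall on \<open>p j\<close>, where the
    sum becomes the Euler operator on a form of degree \<open>d - 1\<close>. With the term
    \<open>p j\<close> from the product rule this makes \<open>d\<close> times \<open>p j\<close>,
    which cancels \<open>1 / d\<close>.\<close>
  have dh0: "partial_deriv (l + j) h0 = p j" if j: "j < l" for j
  proof -
    have "partial_deriv (l + j) (\<Sum>i<l. X (l + i) * p i) =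
        (\<Sum>i<l. (if i = j then p i else 0) + X (l + i) * partial_deriv (l + i) (p j))"
      unfolding partial_deriv_sum partial_deriv_mult partial_deriv_X
      using closed j by (intro sum.cong) auto
    also have "\<dots> = p j + (\<Sum>i<l. X (l + i) * partial_deriv (l + i) (p j))"
      using j by (simp add: sum.distrib)
    also have "(\<Sum>i<l. X (l + i) * partial_deriv (l + i) (p j)) = (\<Sum>k\<in>{l..<2 * l}. X k * partial_deriv k (p j))"
      by (rule sum.reindex_bij_witness[of _ "\<lambda>k. k - l" "\<lambda>i. l + i"]) auto
    also have "\<dots> = C (of_nat (d - 1)) * p j" by (rule euler_formula[OF p[OF j]]) simp
    also have "p j + C (of_nat (d - 1)) * p j = C (of_nat d) * p j"
    proof -
      have "(of_nat d :: 'k) = 1 + of_nat (d - 1)" using d by (simp add: of_nat_diff)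
      then show ?thesis by (simp add: C_add distrib_right)
    qed
    finally have "partial_deriv (l + j) h0 = C (1 / of_nat d) * (C (of_nat d) * p j)"
      by (simp add: h0_def partial_deriv_C_mult)
    also have "\<dots> = C (1 / of_nat d * of_nat d) * p j" by (simp only: C_mult mult.assoc)
    also have "1 / of_nat d * of_nat d = (1 :: 'k)" using of_nat_neq_0_char[OF char, of d] d by simp
    also have "C 1 * p j = p j" by simp
    finally show ?thesis .
  qed
  \<comment> \<open>The polynomials \<open>p i\<close> are free of the first \<open>l\<close>
    variables, so subtracting this sum removes these variables from \<open>F\<close>.\<close>
  define r where "r = F - (\<Sum>i<l. X i * p i)"
  have "{l..<2 * l} \<subseteq> {..<n}" using l by auto
  then have "hom_in {..<n} d (X i * p i)" if "i < l" for i
    using hom_in_mult[OF hom_in_X[of i "{..<n}"] hom_in_mono[OF p[OF that], of "{..<n}"]] that l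
    unfolding dd1 by auto
  then have "hom_in {..<n} d r"
    using F unfolding r_def form_hom_in by (intro hom_in_diff hom_in_sum) auto
  moreover have "partial_deriv k r = 0" if "k \<in> {..<l}" for k
    using that partial_deriv_sum_X_mult[of k l p] lin by (simp add: r_def partial_deriv_diff p_def)
  ultimately have "hom_in ({..<n} - {..<l}) d r" using char by (intro hom_in_remove_vars) auto
  then have "hom_in {l..<l + (n - l)} d r" by (rule hom_in_mono) auto
  then obtain g where g: "form d (n - l) g" "shift l g = r" by (rule hom_in_shiftE)
  have "lin_subst P f = (\<Sum>i<l. X i * partial_deriv (l + i) (shift l h)) + shift l g"
    by (simp add: h g dh0 r_def flip: F_def)
  with l1 l h g P show ?thesis unfolding LDS_form_def by blast
qed

section \<open>Semisimplicity and dimension of the center\<close>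

lemma center_simps:
  "x \<otimes>\<^bsub>center n f\<^esub> y = x * y" "x \<oplus>\<^bsub>center n f\<^esub> y = x + y" "\<zero>\<^bsub>center n f\<^esub> = 0\<^sub>m n n"
  "c \<odot>\<^bsub>center n f\<^esub> x = c \<cdot>\<^sub>m x"
  by (simp_all add: center_def module_mat_simps)

lemma vectorspace_center: "vectorspace class_ring (center n f)"
  for f :: "'k::field mpoly"
proof -
  interpret V: vectorspace "class_ring :: 'k ring" "module_mat TYPE('k) n n" by (rule matrix_vs)
  have "submodule class_ring (carrier (center n f)) (module_mat TYPE('k) n n)"
    by (rule submodule.intro[OF V.module_axioms])
      (auto simp: carrier_center matrix_vs_simps in_center_carrier intro: in_center_add in_center_smult in_center_zero)
  then have "vectorspace class_ring (V.vs (carrier (center n f)))"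
    by (intro V.subspace_is_vs subspace.intro V.vectorspace_axioms)
  moreover have "V.vs (carrier (center n f)) = center n f" by (simp add: center_def)
  ultimately show ?thesis by simp
qed

text \<open>Closure under scalars supplies additive inverses, as multiples by -1.\<close>

lemma additive_subgroup_centerI:
  fixes f :: "'k::field mpoly"
  assumes sub: "I \<subseteq> carrier (center n f)" and zero: "0\<^sub>m n n \<in> I"
    and add: "\<And>x y. x \<in> I \<Longrightarrow> y \<in> I \<Longrightarrow> x + y \<in> I"
    and smult: "\<And>c x. x \<in> I \<Longrightarrow> c \<cdot>\<^sub>m x \<in> I"
  shows "additive_subgroup I (center n f)"
proof -
  interpret V: vectorspace "class_ring :: 'k ring" "center n f" by (rule vectorspace_center)
  have neg: "inv\<^bsub>add_monoid (center n f)\<^esub> x \<in> I" if x: "x \<in> I" for x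
  proof -
    have cx: "x \<in> carrier_mat n n" using sub x by (auto simp: carrier_center dest: in_center_carrier)
    have "\<ominus>\<^bsub>center n f\<^esub> x = (- 1) \<cdot>\<^sub>m x"
    proof (rule V.minus_equality)
      show "(- 1) \<cdot>\<^sub>m x \<oplus>\<^bsub>center n f\<^esub> x = \<zero>\<^bsub>center n f\<^esub>"
        unfolding center_simps using cx by (intro eq_matI) auto
    qed (use sub x smult[OF x] in auto)
    then show ?thesis using smult[OF x] by (simp add: a_inv_def)
  qed
  show ?thesis
    using sub zero add neg by unfold_locales (auto simp: center_simps)
qed

text \<open>Let \<open>I\<close> be the ideal generated by \<open>N\<close> and \<open>J\<close> a
  complement, so 1 is \<open>A * N + j\<close> with \<open>j\<close> in \<open>J\<close>.
  Multiplying by \<open>N\<close> kills the first term, since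
  \<open>N * A * N = A * N * N = 0\<close>. Hence \<open>N = N * j\<close> lies in \<open>J\<close>
  as well as in \<open>I\<close>.\<close>

lemma semisimple_imp_reduced_center:
  fixes f :: "'k::field mpoly"
  assumes char: "CHAR('k) = 0 \<or> CHAR('k) > d" and d: "d \<ge> 3"
    and f: "form d n f" and nd: "indep_partials n f" and ss: "semisimple_ring (center n f)"
  shows "reduced_center n f"
  unfolding reduced_center_def
proof (intro allI impI)
  fix N assume N: "in_center n f N" and NN: "N * N = 0\<^sub>m n n"
  note cN = in_center_carrier[OF N]
  note mult = in_center_mult[OF char d f nd]
  define I where "I = (\<lambda>A. A * N) ` carrier (center n f)"
  have "left_ideal (center n f) I"
    unfolding left_ideal_def
  proof (intro conjI ballI additive_subgroup_centerI)
    show "I \<subseteq> carrier (center n f)" using mult N by (auto simp: I_def carrier_center)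
    show "0\<^sub>m n n \<in> I"
      unfolding I_def by (rule image_eqI[of _ _ "0\<^sub>m n n"]) (use cN in \<open>auto simp: carrier_center in_center_zero\<close>)
    fix x assume "x \<in> I"
    then obtain A where A: "in_center n f A" "x = A * N" by (auto simp: I_def carrier_center)
    note cA = in_center_carrier[OF A(1)]
    show "c \<cdot>\<^sub>m x \<in> I" for c
      unfolding I_def by (rule image_eqI[of _ _ "c \<cdot>\<^sub>m A"])
        (use A cN cA in \<open>auto simp: carrier_center in_center_smult mult_smult_assoc_mat[of _ n n]\<close>)
    {
      fix y assume "y \<in> I"
      then obtain B where B: "in_center n f B" "y = B * N" by (auto simp: I_def carrier_center)
      show "x + y \<in> I"
        unfolding I_def by (rule image_eqI[of _ _ "A + B"])
          (use A B cN cA in_center_carrier[OF B(1)] in \<open>auto simp: carrier_center in_center_add add_mult_distrib_mat[of _ n n]\<close>)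
    }
    {
      fix B assume B: "B \<in> carrier (center n f)"
      show "B \<otimes>\<^bsub>center n f\<^esub> x \<in> I"
        unfolding I_def center_simps by (rule image_eqI[of _ _ "B * A"])
          (use A B cN cA mult in \<open>auto simp: carrier_center assoc_mult_mat[of _ n n _ n _ n] dest: in_center_carrier\<close>)
    }
  qed
  then obtain J where J: "left_ideal (center n f) J" "I <+>\<^bsub>center n f\<^esub> J = carrier (center n f)"
      "I \<inter> J = {0\<^sub>m n n}"
    using ss by (auto simp: semisimple_ring_def center_simps)
  have "1\<^sub>m n \<in> I <+>\<^bsub>center n f\<^esub> J" unfolding J(2) by (simp add: carrier_center in_center_one)
  then obtain i j where ij: "i \<in> I" "j \<in> J" "1\<^sub>m n = i + j"
    by (auto simp: AbelCoset.set_add_def' center_simps)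
  obtain A where A: "in_center n f A" "i = A * N" using ij(1) by (auto simp: I_def carrier_center)
  note cA = in_center_carrier[OF A(1)]
  have "J \<subseteq> carrier (center n f)"
    using J(1) by (auto simp: left_ideal_def dest: additive_subgroup.a_subset)
  then have cj: "j \<in> carrier_mat n n" using ij(2) by (auto simp: carrier_center dest: in_center_carrier)
  have "N * (A * N) = (N * A) * N" by (rule assoc_mult_mat[OF cN cA cN, symmetric])
  also have "\<dots> = (A * N) * N" using in_center_comm[OF char d f nd N A(1)] by simp
  also have "\<dots> = A * (N * N)" by (rule assoc_mult_mat[OF cA cN cN])
  finally have "N * (A * N) = A * (N * N)" .
  then have "N * (A * N) = 0\<^sub>m n n" using cA by (simp add: NN)
  moreover have "N = N * (A * N) + N * j"
    using ij(3) A(2) cA cN cj mult_add_distrib_mat[OF cN, of "A * N" n j] right_mult_one_mat[OF cN] by simp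
  ultimately have "N = N * j" using cN cj by simp
  also have "\<dots> \<in> J" using J(1) N ij(2) by (auto simp: left_ideal_def center_simps carrier_center)
  finally have "N \<in> J" .
  moreover have "N \<in> I"
    unfolding I_def by (rule image_eqI[of _ _ "1\<^sub>m n"]) (use cN in \<open>auto simp: carrier_center in_center_one\<close>)
  ultimately show "N = 0\<^sub>m n n" using J(3) by blast
qed

section \<open>Dimension and left ideals in a basis of orthogonal idempotents\<close>

context
  fixes n t :: nat and f :: "'k::field mpoly" and E :: "nat \<Rightarrow> 'k mat"
  assumes E: "idempotent_basis n f t E"
begin

lemma idempotent_basis_carrier: "i < t \<Longrightarrow> E i \<in> carrier_mat n n"
  using in_center_carrier[OF idempotent_basisD(1)[OF E]] .

text \<open>By orthogonality, multiplication by \<open>E j\<close> isolates the \<open>j\<close>-th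
  coefficient. Linear independence and the complements of ideals both rest on this.\<close>

lemma idempotent_basis_mult:
  assumes A: "A \<in> carrier_mat n n" and j: "j < t"
    and c: "\<And>p q. p < n \<Longrightarrow> q < n \<Longrightarrow> A $$ (p, q) = (\<Sum>i<t. c i * E i $$ (p, q))"
  shows "E j * A = c j \<cdot>\<^sub>m E j"
proof (rule eq_matI)
  note cE = idempotent_basis_carrier
  fix p q assume "p < dim_row (c j \<cdot>\<^sub>m E j)" "q < dim_col (c j \<cdot>\<^sub>m E j)"
  then have pq: "p < n" "q < n" using cE[OF j] by auto
  have entry: "(E j * M) $$ (p, q) = (\<Sum>r<n. E j $$ (p, r) * M $$ (r, q))" if "M \<in> carrier_mat n n" for M
    using that cE[OF j] pq by (simp add: scalar_prod_def lessThan_atLeast0)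
  have "(E j * A) $$ (p, q) = (\<Sum>r<n. \<Sum>i<t. c i * (E j $$ (p, r) * E i $$ (r, q)))"
    unfolding entry[OF A] by (intro sum.cong refl) (simp add: c pq sum_distrib_left mult_ac)
  also have "\<dots> = (\<Sum>i<t. \<Sum>r<n. c i * (E j $$ (p, r) * E i $$ (r, q)))" by (rule sum.swap)
  also have "\<dots> = (\<Sum>i<t. c i * (E j * E i) $$ (p, q))"
    by (intro sum.cong refl) (simp add: entry[OF cE] sum_distrib_left del: index_mult_mat)
  also have "\<dots> = (\<Sum>i<t. if i = j then c i * E i $$ (p, q) else 0)"
    using pq j by (intro sum.cong refl) (simp add: idempotent_basisD(3)[OF E] del: index_mult_mat)
  also have "\<dots> = (c j \<cdot>\<^sub>m E j) $$ (p, q)" using j pq cE[OF j] by simp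
  finally show "(E j * A) $$ (p, q) = (c j \<cdot>\<^sub>m E j) $$ (p, q)" .
qed (use A idempotent_basis_carrier[OF j] in auto)

lemma smult_idempotent_eq_0:
  assumes "j < t" "c \<cdot>\<^sub>m E j = 0\<^sub>m n n" shows "c = 0"
proof (rule ccontr)
  assume "c \<noteq> 0"
  then have "E j = (1 / c) \<cdot>\<^sub>m (c \<cdot>\<^sub>m E j)" by (intro eq_matI) auto
  then have "E j = 0\<^sub>m n n" unfolding assms(2) by (simp add: smult_zero_mat)
  then show False using idempotent_basisD(2)[OF E assms(1)] by simp
qed

lemma sum_idempotents_mem:
  assumes "finite S" "S \<subseteq> {..<t}" "0\<^sub>m n n \<in> I"
    and "\<And>x y. x \<in> I \<Longrightarrow> y \<in> I \<Longrightarrow> x + y \<in> I" "\<And>i. i \<in> S \<Longrightarrow> c i \<cdot>\<^sub>m E i \<in> I"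
  shows "mat n n (\<lambda>(p, q). \<Sum>i\<in>S. c i * E i $$ (p, q)) \<in> I"
  using assms(1,2,5)
proof (induction S rule: finite_induct)
  case empty
  have "mat n n (\<lambda>(p, q). 0) = (0\<^sub>m n n :: 'k mat)" by (intro eq_matI) auto
  then show ?case using assms(3) by (simp only: sum.empty)
next
  case (insert i S)
  then have eq: "mat n n (\<lambda>(p, q). \<Sum>i\<in>insert i S. c i * E i $$ (p, q)) =
      c i \<cdot>\<^sub>m E i + mat n n (\<lambda>(p, q). \<Sum>i\<in>S. c i * E i $$ (p, q))"
    using idempotent_basis_carrier[of i] by (intro eq_matI) auto
  show ?case unfolding eq by (intro assms(4) insert.IH insert.prems(2)) (use insert.prems in auto)
qed

lemma dim_center_idempotent_basis: "vectorspace.dim class_ring (center n f) = t"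
proof -
  interpret V: vectorspace "class_ring :: 'k ring" "center n f" by (rule vectorspace_center)
  note cE = idempotent_basis_carrier
  have inj: "inj_on E {..<t}"
  proof (rule inj_onI)
    fix i j assume ij: "i \<in> {..<t}" "j \<in> {..<t}" "E i = E j"
    then have "E i = (if i = j then E i else 0\<^sub>m n n)"
      using idempotent_basisD(3)[OF E, of i j] idempotent_basisD(3)[OF E, of i i] by simp
    then show "i = j" using idempotent_basisD(2)[OF E, of i] ij by (auto split: if_splits)
  qed
  let ?B = "E ` {..<t}"
  have sub: "?B \<subseteq> carrier (center n f)"
    using idempotent_basisD(1)[OF E] by (auto simp: carrier_center)
  \<comment> \<open>Abstract linear combinations are read by entries to match the spanning clause of
    \<open>idempotent_basis\<close>.\<close>
  have lc: "V.lincomb a A \<in> carrier_mat n n \<and>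
      (\<forall>p<n. \<forall>q<n. V.lincomb a A $$ (p, q) = (\<Sum>v\<in>A. a v * v $$ (p, q)))"
    if "finite A" "A \<subseteq> carrier (center n f)" for a A
    using that
  proof (induction A rule: finite_induct)
    case empty
    then show ?case by (simp add: V.lincomb_def center_simps)
  next
    case (insert v A)
    have cv: "v \<in> carrier_mat n n" using insert.prems by (auto simp: carrier_center dest: in_center_carrier)
    have "V.lincomb a (insert v A) = a v \<cdot>\<^sub>m v + V.lincomb a A"
      using V.lincomb_insert2[of A a v] insert by (simp add: center_simps class_ring_simps)
    then show ?case using insert cv by auto
  qed
  have lcE: "V.lincomb a ?B $$ (p, q) = (\<Sum>i<t. a (E i) * E i $$ (p, q))" if "p < n" "q < n" for a p q
    using lc[OF _ sub] that by (simp add: sum.reindex[OF inj])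
  have "V.basis ?B"
    unfolding V.basis_def
  proof (intro conjI sub)
    show "V.lin_indpt ?B"
    proof (rule V.finite_lin_indpt2)
      fix a assume 0: "V.lincomb a ?B = \<zero>\<^bsub>center n f\<^esub>"
      show "\<forall>v\<in>?B. a v = \<zero>\<^bsub>class_ring\<^esub>"
      proof
        fix v assume "v \<in> ?B"
        then obtain j where j: "j < t" "v = E j" by auto
        \<comment> \<open>The vanishing combination represents the zero matrix, so multiplying by
          \<open>E j\<close> leaves only the \<open>j\<close>-th coefficient.\<close>
        have "E j * 0\<^sub>m n n = a (E j) \<cdot>\<^sub>m E j"
          using lcE[of _ _ a] by (intro idempotent_basis_mult j(1)) (simp_all add: 0 center_simps)
        then show "a v = \<zero>\<^bsub>class_ring\<^esub>"
          using smult_idempotent_eq_0[OF j(1), of "a (E j)"] j cE[OF j(1)] by (simp add: class_ring_simps)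
      qed
    qed (use sub in auto)
    show "V.span ?B = carrier (center n f)"
    proof
      show "V.span ?B \<subseteq> carrier (center n f)" by (rule V.span_is_subset2[OF sub])
      show "carrier (center n f) \<subseteq> V.span ?B"
      proof
        fix A assume "A \<in> carrier (center n f)"
        then have A: "in_center n f A" by (simp add: carrier_center)
        obtain c where c: "\<And>p q. p < n \<Longrightarrow> q < n \<Longrightarrow> A $$ (p, q) = (\<Sum>i<t. c i * E i $$ (p, q))"
          using idempotent_basisD(4)[OF E A] by blast
        let ?L = "V.lincomb (\<lambda>v. c (inv_into {..<t} E v)) ?B"
        have cL: "?L \<in> carrier_mat n n" using lc[OF _ sub] by simp
        have "A = ?L"
        proof (rule eq_matI)
          fix p q assume "p < dim_row ?L" "q < dim_col ?L"
          then have "p < n" "q < n" using cL by auto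
          then show "A $$ (p, q) = ?L $$ (p, q)" by (simp add: lcE c inv_into_f_f[OF inj])
        qed (use cL in_center_carrier[OF A] in auto)
        then show "A \<in> V.span ?B" unfolding V.span_def by (auto simp: class_ring_simps)
      qed
    qed
  qed
  then have "V.dim = card ?B" by (intro V.dim_basis) simp_all
  then show ?thesis using card_image[OF inj] by simp
qed

text \<open>Every left ideal is spanned by the basis idempotents it contains.\<close>

lemma semisimple_idempotent_basis:
  assumes char: "CHAR('k) = 0 \<or> CHAR('k) > d" and d: "d \<ge> 3"
    and f: "form d n f" and nd: "indep_partials n f"
  shows "semisimple_ring (center n f)"
  unfolding semisimple_ring_def
proof (intro allI impI)
  fix I assume I: "left_ideal (center n f) I"
  note cE = idempotent_basis_carrier and mult = in_center_mult[OF char d f nd]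
  have addI: "additive_subgroup I (center n f)" using I by (simp add: left_ideal_def)
  have subI: "I \<subseteq> carrier (center n f)" by (rule additive_subgroup.a_subset[OF addI])
  have zeroI: "0\<^sub>m n n \<in> I" using additive_subgroup.zero_closed[OF addI] by (simp add: center_simps)
  have plusI: "x + y \<in> I" if "x \<in> I" "y \<in> I" for x y
    using additive_subgroup.a_closed[OF addI that] by (simp add: center_simps)
  have multI: "a * x \<in> I" if "in_center n f a" "x \<in> I" for a x
    using I that by (auto simp: left_ideal_def center_simps carrier_center)
  have smultI: "c \<cdot>\<^sub>m x \<in> I" if "x \<in> I" for c x
  proof -
    have "x \<in> carrier_mat n n" using subI that by (auto simp: carrier_center dest: in_center_carrier)
    then have "(c \<cdot>\<^sub>m 1\<^sub>m n) * x = c \<cdot>\<^sub>m x" by (simp add: mult_smult_assoc_mat[of _ n n])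
    then show ?thesis using multI[OF in_center_smult[OF in_center_one] that, of c] by simp
  qed
  define S where "S = {i. i < t \<and> E i \<in> I}"
  \<comment> \<open>The annihilator of the idempotents in \<open>I\<close>; it contains all the
    other idempotents by orthogonality.\<close>
  define J where "J = {x \<in> carrier (center n f). \<forall>i\<in>S. E i * x = 0\<^sub>m n n}"
  have J: "left_ideal (center n f) J"
    unfolding left_ideal_def
  proof (intro conjI ballI additive_subgroup_centerI)
    show "J \<subseteq> carrier (center n f)" by (auto simp: J_def)
    show "0\<^sub>m n n \<in> J" using cE by (auto simp: J_def carrier_center in_center_zero S_def right_mult_zero_mat[of _ n n])
    fix x assume x: "x \<in> J"
    then have cx: "in_center n f x" "x \<in> carrier_mat n n"
      by (auto simp: J_def carrier_center dest: in_center_carrier)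
    have Ex: "i < t \<Longrightarrow> E i \<in> I \<Longrightarrow> E i * x = 0\<^sub>m n n" for i using x by (auto simp: J_def S_def)
    show "c \<cdot>\<^sub>m x \<in> J" for c
      using cx Ex cE by (auto simp: J_def S_def carrier_center in_center_smult mult_smult_distrib[of _ n n])
    show "x + y \<in> J" if "y \<in> J" for y
      using x cx that cE by (auto simp: J_def S_def carrier_center in_center_add mult_add_distrib_mat[of _ n n] dest: in_center_carrier)
    show "a \<otimes>\<^bsub>center n f\<^esub> x \<in> J" if "a \<in> carrier (center n f)" for a
    proof -
      have a: "in_center n f a" "a \<in> carrier_mat n n" using that by (auto simp: carrier_center dest: in_center_carrier)
      have "E i * (a * x) = 0\<^sub>m n n" if i: "i < t" "E i \<in> I" for i
      proof -
        have "E i * (a * x) = (E i * a) * x"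
          using a(2) cx(2) cE[OF i(1)] by (simp add: assoc_mult_mat[of _ n n _ n _ n])
        also have "\<dots> = (a * E i) * x"
          using in_center_comm[OF char d f nd a(1) idempotent_basisD(1)[OF E i(1)]] by simp
        also have "\<dots> = 0\<^sub>m n n"
          using a(2) cx(2) cE[OF i(1)] Ex[OF i] by (simp add: assoc_mult_mat[of _ n n _ n _ n])
        finally show ?thesis .
      qed
      then show ?thesis using mult[OF a(1) cx(1)] by (auto simp: J_def S_def center_simps carrier_center)
    qed
  qed
  have subJ: "J \<subseteq> carrier (center n f)" by (auto simp: J_def)
  have addJ: "additive_subgroup J (center n f)" using J by (simp add: left_ideal_def)
  have EJ: "c \<cdot>\<^sub>m E i \<in> J" if i: "i < t" "i \<notin> S" for i c
  proof -
    have "E j * (c \<cdot>\<^sub>m E i) = 0\<^sub>m n n" if "j \<in> S" for j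
      using that i cE[of j] cE[OF i(1)] idempotent_basisD(3)[OF E, of j i]
      by (auto simp: S_def mult_smult_distrib[of _ n n] smult_zero_mat)
    then show ?thesis
      using i by (auto simp: J_def carrier_center intro!: in_center_smult idempotent_basisD(1)[OF E])
  qed
  have sum_sup: "carrier (center n f) \<subseteq> I <+>\<^bsub>center n f\<^esub> J"
  proof
    fix A assume "A \<in> carrier (center n f)"
    then have A: "in_center n f A" by (simp add: carrier_center)
    obtain c where c: "\<And>p q. p < n \<Longrightarrow> q < n \<Longrightarrow> A $$ (p, q) = (\<Sum>i<t. c i * E i $$ (p, q))"
      using idempotent_basisD(4)[OF E A] by blast
    let ?M = "\<lambda>T. mat n n (\<lambda>(p, q). \<Sum>i\<in>T. c i * E i $$ (p, q))"
    have "?M S \<in> I"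
      using zeroI plusI smultI by (intro sum_idempotents_mem) (auto simp: S_def)
    moreover have "?M ({..<t} - S) \<in> J"
    proof (rule sum_idempotents_mem)
      show "0\<^sub>m n n \<in> J" using additive_subgroup.zero_closed[OF addJ] by (simp add: center_simps)
      show "x + y \<in> J" if "x \<in> J" "y \<in> J" for x y
        using additive_subgroup.a_closed[OF addJ that] by (simp add: center_simps)
    qed (use EJ in auto)
    moreover have "A = ?M S + ?M ({..<t} - S)"
    proof (rule eq_matI)
      have "S \<subseteq> {..<t}" by (auto simp: S_def)
      then show "A $$ (p, q) = (?M S + ?M ({..<t} - S)) $$ (p, q)"
        if "p < dim_row (?M S + ?M ({..<t} - S))" "q < dim_col (?M S + ?M ({..<t} - S))" for p q
        using that by (simp add: c sum.subset_diff[of S "{..<t}"] add.commute)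
    qed (use in_center_carrier[OF A] in auto)
    ultimately show "A \<in> I <+>\<^bsub>center n f\<^esub> J"
      by (auto simp: AbelCoset.set_add_def' center_simps)
  qed
  have sum_sub: "I <+>\<^bsub>center n f\<^esub> J \<subseteq> carrier (center n f)"
    using subI subJ by (auto simp: AbelCoset.set_add_def' center_simps carrier_center intro!: in_center_add)
  have int: "x = 0\<^sub>m n n" if x: "x \<in> I" "x \<in> J" for x
  proof -
    have cx: "in_center n f x" using x subI by (auto simp: carrier_center)
    obtain c where c: "\<And>p q. p < n \<Longrightarrow> q < n \<Longrightarrow> x $$ (p, q) = (\<Sum>i<t. c i * E i $$ (p, q))"
      using idempotent_basisD(4)[OF E cx] by blast
    \<comment> \<open>If \<open>E i\<close> lies in \<open>I\<close>, then it annihilates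
      \<open>x\<close>, as \<open>x\<close> is in \<open>J\<close>. Otherwise a nonzero
      \<open>c i\<close> would put \<open>E i\<close>, a multiple of \<open>E i * x\<close>, into
      \<open>I\<close>.\<close>
    have "c i = 0" if i: "i < t" for i
    proof -
      have Eix: "E i * x = c i \<cdot>\<^sub>m E i"
        by (rule idempotent_basis_mult[OF in_center_carrier[OF cx] i c])
      show ?thesis
      proof (cases "i \<in> S")
        case True
        then show ?thesis using x(2) Eix smult_idempotent_eq_0[OF i] by (auto simp: J_def)
      next
        case False
        show ?thesis
        proof (rule ccontr)
          assume ci: "c i \<noteq> 0"
          have "(1 / c i) \<cdot>\<^sub>m (c i \<cdot>\<^sub>m E i) \<in> I"
            using multI[OF idempotent_basisD(1)[OF E i] x(1)] smultI unfolding Eix by blast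
          moreover have "(1 / c i) \<cdot>\<^sub>m (c i \<cdot>\<^sub>m E i) = E i" using ci by (intro eq_matI) auto
          ultimately show False using False i by (simp add: S_def)
        qed
      qed
    qed
    then show ?thesis using c in_center_carrier[OF cx] by (intro eq_matI) auto
  qed
  have "0\<^sub>m n n \<in> J" using additive_subgroup.zero_closed[OF addJ] by (simp add: center_simps)
  then have "I \<inter> J = {\<zero>\<^bsub>center n f\<^esub>}"
    unfolding center_simps using int zeroI by blast
  then show "\<exists>J. left_ideal (center n f) J \<and> I <+>\<^bsub>center n f\<^esub> J = carrier (center n f) \<and>
      I \<inter> J = {\<zero>\<^bsub>center n f\<^esub>}"
    using J sum_sup sum_sub by blast
qed

end

theorem theorem3p7:
  fixes f :: "'k::alg_closed_field mpoly" and d n :: nat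
  assumes "d \<ge> 3" and "n \<ge> 1"
    and "CHAR('k) = 0 \<or> CHAR('k) > d"
    and "form d n f" and "nondegenerate n f"
  shows "(semisimple_ring (center n f) \<longleftrightarrow> \<not> LDS_form d n f) \<and>
    (semisimple_ring (center n f) \<longrightarrow>
      (\<exists>fs. indecomposable_decomposition d n f fs) \<and>
      (\<forall>fs. indecomposable_decomposition d n f fs \<longrightarrow>
         length fs = vectorspace.dim class_ring (center n f)))"
proof -
  note d = assms(1) and char = assms(3) and f = assms(4)
  have nd: "indep_partials n f" by (rule nondegenerate_imp_indep_partials[OF char f assms(5)])
  have basis: "\<exists>E. idempotent_basis n f (length fs) E"
    if red: "reduced_center n f" and fs: "indecomposable_decomposition d n f fs" for fs
  proof -
    obtain P where P: "linear_change n P" "lin_subst P f = block_sum fs"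
      using fs by (auto simp: indecomposable_decomposition_def decomposition_def)
    have n: "(\<Sum>(a, g)\<leftarrow>fs. a) = n"
      using fs by (auto simp: indecomposable_decomposition_def decomposition_def)
    have "\<exists>E. idempotent_basis (\<Sum>(a, g)\<leftarrow>fs. a) (block_sum fs) (length fs) E"
    proof (rule idempotent_basis_block_sum[OF char d])
      show "\<forall>(a, g)\<in>set fs. a \<ge> 1 \<and> form d a g \<and> \<not> direct_sum_form d a g"
        using fs by (auto simp: indecomposable_decomposition_def decomposition_def)
      show "indep_partials (\<Sum>(a, g)\<leftarrow>fs. a) (block_sum fs)"
        using indep_partials_lin_subst[OF f P(1) nd] P(2) n by simp
      show "reduced_center (\<Sum>(a, g)\<leftarrow>fs. a) (block_sum fs)"
        using reduced_center_lin_subst[OF f P(1)] red P(2) n by simp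
    qed
    then obtain E where "idempotent_basis n (lin_subst P f) (length fs) E" using P(2) n by auto
    then show ?thesis by (rule idempotent_basis_lin_subst[OF f P(1)])
  qed
  obtain fs where fs: "indecomposable_decomposition d n f fs"
    using indecomposable_decomposition_exists[OF f assms(2)] by blast
  have red_LDS: "reduced_center n f \<longleftrightarrow> \<not> LDS_form d n f"
    using LDS_form_not_reduced[OF f] not_reduced_LDS_form[OF char _ f] d by fastforce
  \<comment> \<open>A reduced center is semisimple because the decomposition \<open>fs\<close>,
    which exists for every form, yields an idempotent basis.\<close>
  have ss_red: "semisimple_ring (center n f) \<longleftrightarrow> reduced_center n f"
    using semisimple_imp_reduced_center[OF char d f nd] basis[OF _ fs]
      semisimple_idempotent_basis[OF _ char d f nd] by blast
  \<comment> \<open>Each decomposition brings an idempotent basis of its own length, and the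
    dimension of the center is the size of any such basis.\<close>
  have "length gs = vectorspace.dim class_ring (center n f)"
    if "reduced_center n f" "indecomposable_decomposition d n f gs" for gs
    using basis[OF that] dim_center_idempotent_basis by fastforce
  then show ?thesis using red_LDS ss_red fs by blast
qed

end
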